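(* For any $\alpha\in(0,1]$ and $1\le p<\infty$, the problem of $L_p$-approximation is polynomially tractable on $F_d^{\alpha}$. More precisely, for $p\ge 2$ (and $p<\infty$), there is a constant $c>0$, depending only on $\alpha$, such that for all $d\ge 2$ and $\varepsilon\in(0,1/2)$, \[ n(\varepsilon,F_d^{\alpha},L_p)\,\le\, c\,d^2\log^2(d)\,\varepsilon^{-p}\log^4(\varepsilon^{-1}). \]
   Context: For $f\in C([0,1]^d)$ (continuous, complex-valued) and $k\in\mathbb{Z}^d$, let $\hat f(k)=\int_{[0,1]^d} f(x)e^{-2\pi i\langle k,x\rangle}\,dx$. For $0<\alpha\le 1$ define \[ F_d^{\alpha}:=\Big\{f\in C([0,1]^d)\ \Big|\ \sum_{k\in\mathbb{Z}^d}|\hat f(k)|\le 1\ \text{ and }\ \sup_{x\ne y}\frac{|f(x)-f(y)|}{\|x-y\|_2^{\alpha}}\le 1\Big\}, \] where the supremum is taken over all $x,y\in\mathbb{R}^d$ with $x\neq y$, considering $f$ as a 1-periodic function on $\mathbb{R}^d$ (1-periodic in each variable). For a class $F_d$ of functions on $[0,1]^d$, the (information) complexity $n(\varepsilon,F_d,L_p)$ is the minimal $n\in\mathbb{N}=\{0,1,2,\dots\}$ for which there are sampling points $x_1,\dots,x_n\in[0,1]^d$ and a (possibly non-linear) recovery map $\phi\colon\mathbb{C}^n\to L_p([0,1]^d)$ such that $A_n(f)=\phi(f(x_1),\dots,f(x_n))$ satisfies $\sup_{f\in F_d}\|f-A_n(f)\|_p\le\varepsilon$ (for $n=0$, $A_n$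 is a constant map), where $\|\cdot\|_p$ is the norm of $L_p([0,1]^d)$ with Lebesgue measure. The problem of $L_p$-approximation (sampling recovery in $L_p$) on $F_d$ is polynomially tractable if there exist $C,q,r\ge 0$ such that $n(\varepsilon,F_d,L_p)\le C d^q\varepsilon^{-r}$ for all integers $d\ge 1$ and all $\varepsilon>0$. *)

theory Defs
  imports "HOL-Analysis.Analysis"
begin

text \<open>
  Since the dimension \<open>d\<close> is quantified inside the statement, points of $R^d$ (and of $Z^d$) are
  functions on \<open>nat\<close> that are extensional on \<open>{..<d}\<close>. On these sets the product topology of
  \<open>nat \<Rightarrow> real\<close> is the Euclidean topology.
\<close>

definition euclid :: "nat \<Rightarrow> (nat \<Rightarrow> real) set" where
  "euclid d = {..<d} \<rightarrow>\<^sub>E UNIV"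

definition int_lattice :: "nat \<Rightarrow> (nat \<Rightarrow> int) set" where
  "int_lattice d = {..<d} \<rightarrow>\<^sub>E UNIV"

definition cube :: "nat \<Rightarrow> (nat \<Rightarrow> real) set" where
  "cube d = {..<d} \<rightarrow>\<^sub>E {0..1}"

definition cube_measure :: "nat \<Rightarrow> (nat \<Rightarrow> real) measure" where
  "cube_measure d = (\<Pi>\<^sub>M i\<in>{..<d}. restrict_space lborel {0..1})"

lemma space_cube_measure: "space (cube_measure d) = cube d"
  by (simp add: cube_measure_def cube_def space_PiM space_restrict_space)

definition cube_continuous :: "nat \<Rightarrow> ((nat \<Rightarrow> real) \<Rightarrow> complex) set" where
  "cube_continuous d = {f \<in> extensional (cube d). continuous_on (cube d) f}"

definition fourier_coeff :: "nat \<Rightarrow> ((nat \<Rightarrow> real) \<Rightarrow> complex) \<Rightarrow> (nat \<Rightarrow> int) \<Rightarrow> complex" where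
  "fourier_coeff d f k =
     (LINT x|cube_measure d. f x * exp (- 2 * pi * \<i> * of_real (\<Sum>i<d. of_int (k i) * x i)))"

definition periodic_extension ::
  "nat \<Rightarrow> ((nat \<Rightarrow> real) \<Rightarrow> complex) \<Rightarrow> ((nat \<Rightarrow> real) \<Rightarrow> complex) \<Rightarrow> bool" where
  "periodic_extension d f g \<longleftrightarrow>
     (\<forall>x\<in>cube d. g x = f x) \<and> (\<forall>x\<in>euclid d. \<forall>i<d. g (x(i := x i + 1)) = g x)"

text \<open>
  On \<open>euclid d\<close> a 1-periodic extension of \<open>f\<close> is unique, and it exists iff \<open>f\<close> agrees on opposite
  faces of the cube. The explicit summability condition is needed because \<open>infsum\<close> is 0 for
  families that are not summable.
\<close>

definition F_class :: "real \<Rightarrow> nat \<Rightarrow> ((nat \<Rightarrow> real) \<Rightarrow> complex) set" where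
  "F_class \<alpha> d =
     {f \<in> cube_continuous d.
        (\<lambda>k. cmod (fourier_coeff d f k)) summable_on int_lattice d \<and>
        (\<Sum>\<^sub>\<infinity>k\<in>int_lattice d. cmod (fourier_coeff d f k)) \<le> 1 \<and>
        (\<exists>g. periodic_extension d f g \<and>
             (\<forall>x\<in>euclid d. \<forall>y\<in>euclid d. x \<noteq> y \<longrightarrow>
                cmod (g x - g y) / L2_set (\<lambda>i. x i - y i) {..<d} powr \<alpha> \<le> 1))}"

definition Lp_space :: "real \<Rightarrow> nat \<Rightarrow> ((nat \<Rightarrow> real) \<Rightarrow> complex) set" where
  "Lp_space p d = {f \<in> borel_measurable (cube_measure d).
                     integrable (cube_measure d) (\<lambda>x. cmod (f x) powr p)}"

definition Lp_norm :: "real \<Rightarrow> nat \<Rightarrow> ((nat \<Rightarrow> real) \<Rightarrow> complex) \<Rightarrow> real" where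
  "Lp_norm p d f = (LINT x|cube_measure d. cmod (f x) powr p) powr (1 / p)"

text \<open>
  The sampling points and the data vectors in $C^n$ are lists of length \<open>n\<close>. The recovery map
  picks a representative of a class in $L_p$.
\<close>

definition recoverable ::
  "real \<Rightarrow> nat \<Rightarrow> ((nat \<Rightarrow> real) \<Rightarrow> complex) set \<Rightarrow> real \<Rightarrow> nat \<Rightarrow> bool" where
  "recoverable p d F \<epsilon> n \<longleftrightarrow>
     (\<exists>(xs :: (nat \<Rightarrow> real) list) (\<phi> :: complex list \<Rightarrow> (nat \<Rightarrow> real) \<Rightarrow> complex).
        length xs = n \<and> set xs \<subseteq> cube d \<and>
        (\<forall>ys. length ys = n \<longrightarrow> \<phi> ys \<in> Lp_space p d) \<and>
        (\<forall>f\<in>F. Lp_norm p d (\<lambda>x. f x - \<phi> (map f xs) x) \<le> \<epsilon>))"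

text \<open>The infimum is \<open>\<infinity>\<close> if no number of samples suffices, and a minimum otherwise.\<close>

definition info_complexity ::
  "real \<Rightarrow> nat \<Rightarrow> ((nat \<Rightarrow> real) \<Rightarrow> complex) set \<Rightarrow> real \<Rightarrow> enat" where
  "info_complexity p d F \<epsilon> = (INF n\<in>{n. recoverable p d F \<epsilon> n}. enat n)"

definition polynomially_tractable ::
  "real \<Rightarrow> (nat \<Rightarrow> ((nat \<Rightarrow> real) \<Rightarrow> complex) set) \<Rightarrow> bool" where
  "polynomially_tractable p F \<longleftrightarrow>
     (\<exists>C q r. C \<ge> 0 \<and> q \<ge> 0 \<and> r \<ge> 0 \<and>
        (\<forall>d\<ge>1. \<forall>\<epsilon>>0.
           ereal_of_enat (info_complexity p d (F d) \<epsilon>) \<le> ereal (C * real d powr q * \<epsilon> powr (- r))))"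

end

theory Submission
  imports Defs "HOL-Probability.Infinite_Product_Measure"
begin

text \<open>
  Why a few samples suffice. Let \<open>f\<close> and \<open>g\<close> be in the class and agree on the sampling points. A
  Fejer mean replaces them, up to a uniform error \<open>l\<close>, by trigonometric polynomials whose degree is
  polynomial in \<open>d\<close> and \<open>1 / l\<close>; here the Hoelder condition enters. Since the coefficients have
  absolute sum at most 1, such a polynomial is an expectation of signed characters, and an average of
  about \<open>d * ln (d / l) / l^2\<close> characters is within \<open>l\<close> of it everywhere (\<open>sparse_approximation\<close>).
  There are only \<open>exp (O (d^2 * ln (d / l)^2 / l^2))\<close> such averages. For each pair of them that
  differ by more than a multiple of \<open>l\<close> on a set of measure at least \<open>\<nu>\<close>, one sampling point has to
  fall into this set, and by a greedy choice the logarithm of the number of pairs, divided by \<open>\<nu>\<close>,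
  is enough points for all of them (\<open>hitting_points\<close>). Hence \<open>f - g\<close> exceeds \<open>l\<close> only on a set of
  measure \<open>\<nu>\<close> (\<open>sampling_level\<close>). Using levels \<open>l = 2^-i\<close> with suitable \<open>\<nu>\<close> and returning any
  function of the class with the observed data bounds the error in $L_p$, at the price of a
  factor \<open>2^p\<close>, because \<open>f - g\<close> may have modulus 2. For \<open>p \<le> 256\<close> this factor is a constant.

  For large \<open>p\<close> the factor must be avoided, as the constant must not depend on \<open>p\<close>. The recovery map
  then returns \<open>g\<close> on a set \<open>D\<close> and 0 elsewhere. It suffices that \<open>\<bar>f - g\<bar> \<le> 1 + O (1 / p)\<close> on
  \<open>D\<close> for every \<open>f\<close> with the same data, and that \<open>f\<close> contributes little off \<open>D\<close>, where \<open>\<bar>f\<bar> \<le> 1\<close>.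
  To find \<open>D\<close>, multiply the Fourier coefficients by a multiplier \<open>q\<close> with values in \<open>[0, 1]\<close> and split
  \<open>f\<close> into \<open>q f\<close> and \<open>(1 - q) f\<close>. If \<open>1 - q\<close> is assembled from autocorrelations of test functions
  that are spread over sets too large for \<open>f - g\<close> to be noticeable there, then \<open>(1 - q) (f - g)\<close> is
  uniformly small, so

  \<open>\<bar>f - g\<bar> \<le> \<bar>q f\<bar> + \<bar>q g\<bar> + small \<le> 1 - \<kappa> + \<bar>q g\<bar> + small\<close>,

  where \<open>\<kappa>\<close> bounds the absolute sum of the coefficients of \<open>(1 - q) f\<close> from below. While \<open>\<bar>q g\<bar>\<close> exceeds
  \<open>(\<theta> + \<kappa>) / 2\<close> on a set of noticeable measure, the normalized phase of \<open>q g\<close> on this set is a further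
  test function, and including it raises \<open>\<kappa>\<close> by a multiple of \<open>(\<theta> + \<kappa>)^2\<close> (\<open>boost_step\<close>). Since
  \<open>\<kappa> \<le> 1\<close>, this ends after \<open>O (1 / \<theta>)\<close> steps (\<open>boost_iterate\<close>), and the set where \<open>\<bar>q g\<bar>\<close> is at
  most \<open>(\<theta> + \<kappa>) / 2\<close> serves as \<open>D\<close>. Each step doubles the uniform error. For \<open>\<theta> = 256 / p\<close> the error
  grows by \<open>2^(p / 8)\<close>, whereas the average of \<open>\<bar>f - g\<bar>\<close> over noticeable sets is of order \<open>2^(-p / 2)\<close>.
\<close>

section \<open>Empirical averages\<close>

lemma exp_le_1_plus_x_plus_square:
  fixes x :: real
  assumes "x \<le> 1"
  shows "exp x \<le> 1 + x + x\<^sup>2"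
proof (cases "x \<ge> 0")
  case True
  then show ?thesis using exp_bound assms by (simp add: add.assoc)
next
  case False
  define y where "y = - x"
  have y: "y > 0" using False by (simp add: y_def)
  have "1 \<le> (1 + y) * (1 - y + y\<^sup>2)" using y by (simp add: algebra_simps power2_eq_square)
  moreover have "1 - y + y\<^sup>2 = (y - 1/2)\<^sup>2 + 3/4" by (simp add: power2_eq_square algebra_simps)
  then have "1 - y + y\<^sup>2 \<ge> 0" by simp
  ultimately have "1 \<le> exp y * (1 - y + y\<^sup>2)"
    using mult_right_mono[OF exp_ge_add_one_self[of y], of "1 - y + y\<^sup>2"] by linarith
  then have "exp (- y) \<le> 1 - y + y\<^sup>2" by (simp add: exp_minus field_simps)
  then show ?thesis by (simp add: y_def)
qed

text \<open>
  The linear term of the exponential averages out, and \<open>\<bar>X i - m\<bar> \<le> 2\<close> bounds the quadratic one: a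
  weak form of Hoeffding's lemma.
\<close>

lemma exp_moment_centered:
  fixes X :: "'i \<Rightarrow> real"
  assumes "finite I" "\<And>i. i \<in> I \<Longrightarrow> w i \<ge> 0" "sum w I = 1" "\<And>i. i \<in> I \<Longrightarrow> \<bar>X i\<bar> \<le> 1"
    and t: "\<bar>t\<bar> \<le> 1/2"
  defines "m \<equiv> (\<Sum>i\<in>I. w i * X i)"
  shows "(\<Sum>i\<in>I. w i * exp (t * (X i - m))) \<le> exp (4 * t\<^sup>2)"
proof -
  have m: "\<bar>m\<bar> \<le> 1"
  proof -
    have "\<bar>m\<bar> \<le> (\<Sum>i\<in>I. w i * \<bar>X i\<bar>)"
      unfolding m_def by (rule order.trans[OF sum_abs]) (simp add: abs_mult assms)
    also have "\<dots> \<le> (\<Sum>i\<in>I. w i * 1)" using assms by (intro sum_mono mult_left_mono) auto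
    finally show ?thesis using assms by simp
  qed
  have dev: "\<bar>X i - m\<bar> \<le> 2" if "i \<in> I" for i using assms(4)[OF that] m by linarith
  have "(\<Sum>i\<in>I. w i * exp (t * (X i - m))) \<le> (\<Sum>i\<in>I. w i * (1 + t * (X i - m) + 4 * t\<^sup>2))"
  proof (intro sum_mono mult_left_mono)
    fix i assume i: "i \<in> I"
    have "\<bar>t * (X i - m)\<bar> \<le> (1/2) * 2" unfolding abs_mult using t dev[OF i] by (intro mult_mono) auto
    then have "exp (t * (X i - m)) \<le> 1 + t * (X i - m) + (t * (X i - m))\<^sup>2"
      by (intro exp_le_1_plus_x_plus_square) auto
    moreover have "(X i - m)\<^sup>2 \<le> 2\<^sup>2" using dev[OF i] abs_le_square_iff[of "X i - m" 2] by simp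
    then have "(t * (X i - m))\<^sup>2 \<le> 4 * t\<^sup>2"
      using mult_left_mono[of "(X i - m)\<^sup>2" "2\<^sup>2" "t\<^sup>2"] by (simp add: power_mult_distrib)
    ultimately show "exp (t * (X i - m)) \<le> 1 + t * (X i - m) + 4 * t\<^sup>2" by linarith
  qed (use assms in auto)
  also have "\<dots> = sum w I * (1 + 4 * t\<^sup>2 - t * m) + t * (\<Sum>i\<in>I. w i * X i)"
    by (simp add: sum_distrib_left sum_distrib_right sum.distrib[symmetric] algebra_simps)
  also have "\<dots> = 1 + 4 * t\<^sup>2" using assms by (simp add: m_def)
  also have "\<dots> \<le> exp (4 * t\<^sup>2)" by (rule exp_ge_add_one_self)
  finally show ?thesis .
qed

lemma weighted_average_attained:
  fixes X :: "'i \<Rightarrow> real"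
  assumes "finite I" "\<And>i. i \<in> I \<Longrightarrow> w i \<ge> 0" "sum w I = 1" "(\<Sum>i\<in>I. w i * X i) \<le> c"
  shows "\<exists>i\<in>I. X i \<le> c"
proof (rule ccontr)
  assume "\<not> ?thesis"
  then have gt: "X i > c" if "i \<in> I" for i using that by force
  obtain i0 where i0: "i0 \<in> I" "w i0 > 0"
    using assms by (metis less_eq_real_def sum.neutral zero_neq_one)
  have "c = (\<Sum>i\<in>I. w i * c)" using assms by (simp add: sum_distrib_right[symmetric])
  also have "\<dots> < (\<Sum>i\<in>I. w i * X i)"
  proof (intro sum_strict_mono_ex1 ballI)
    show "\<exists>a\<in>I. w a * c < w a * X a" using i0 gt by (intro bexI[of _ i0]) auto
    show "w i * c \<le> w i * X i" if "i \<in> I" for i using assms(2)[OF that] gt[OF that] by (intro mult_left_mono) auto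
  qed (use assms in auto)
  finally show False using assms by simp
qed

text \<open>
  Maurey's empirical method without randomness. The potential \<open>\<Phi>\<close> adds up, over all \<open>j\<close>, exponentials
  of the deviation in both directions. Averaged over the next item it grows at most by the factor
  \<open>exp (4 * \<tau>^2)\<close>, so some item achieves this. After \<open>K\<close> steps a deviation above \<open>l\<close> at a single \<open>j\<close>
  would exceed the whole potential. Only the logarithm of the size of \<open>J\<close> matters.
\<close>

lemma empirical_average_close:
  fixes v :: "'i \<Rightarrow> 'j \<Rightarrow> real"
  assumes I: "finite I" "\<And>i. i \<in> I \<Longrightarrow> w i \<ge> 0" "sum w I = 1"
    and J: "finite J" "\<And>i j. i \<in> I \<Longrightarrow> j \<in> J \<Longrightarrow> \<bar>v i j\<bar> \<le> 1"
    and l: "0 < l" "l \<le> 1" and K: "2 * real (card J) < exp (real K * l\<^sup>2 / 16)"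
  shows "\<exists>s::nat \<Rightarrow> 'i. s ` {..<K} \<subseteq> I \<and>
     (\<forall>j\<in>J. \<bar>(\<Sum>t<K. v (s t) j) / real K - (\<Sum>i\<in>I. w i * v i j)\<bar> \<le> l)"
proof -
  define m where "m j = (\<Sum>i\<in>I. w i * v i j)" for j
  \<comment> \<open>the maximizer of \<open>\<tau> * l - 4 * \<tau>^2\<close>, the gain per item\<close>
  define \<tau> where "\<tau> = l / 8"
  define \<Phi> where "\<Phi> = (\<lambda>(s::nat \<Rightarrow> 'i) n. \<Sum>j\<in>J.
     exp (\<tau> * (\<Sum>t<n. v (s t) j - m j)) + exp (- \<tau> * (\<Sum>t<n. v (s t) j - m j)))"
  have "\<exists>s. s ` {..<n} \<subseteq> I \<and> \<Phi> s n \<le> 2 * real (card J) * exp (4 * \<tau>\<^sup>2) ^ n" for n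
  proof (induction n)
    case 0
    show ?case by (simp add: \<Phi>_def mult.commute)
  next
    case (Suc n)
    then obtain s where s: "s ` {..<n} \<subseteq> I" "\<Phi> s n \<le> 2 * real (card J) * exp (4 * \<tau>\<^sup>2) ^ n" by blast
    define P where "P j = exp (\<tau> * (\<Sum>t<n. v (s t) j - m j))" for j
    define N where "N j = exp (- \<tau> * (\<Sum>t<n. v (s t) j - m j))" for j
    have step: "\<Phi> (s(n := i)) (Suc n) =
       (\<Sum>j\<in>J. P j * exp (\<tau> * (v i j - m j)) + N j * exp (- \<tau> * (v i j - m j)))" for i
      by (simp add: \<Phi>_def P_def N_def distrib_left exp_add[symmetric] right_diff_distrib)
    have "(\<Sum>i\<in>I. w i * \<Phi> (s(n := i)) (Suc n)) =
       (\<Sum>j\<in>J. P j * (\<Sum>i\<in>I. w i * exp (\<tau> * (v i j - m j))) + N j * (\<Sum>i\<in>I. w i * exp (- \<tau> * (v i j - m j))))"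
      unfolding step sum_distrib_left sum.distrib[symmetric] distrib_left
      by (subst sum.swap) (simp add: algebra_simps)
    also have "\<dots> \<le> (\<Sum>j\<in>J. P j * exp (4 * \<tau>\<^sup>2) + N j * exp (4 * \<tau>\<^sup>2))"
    proof (intro sum_mono add_mono mult_left_mono)
      fix j assume "j \<in> J"
      then show "(\<Sum>i\<in>I. w i * exp (\<tau> * (v i j - m j))) \<le> exp (4 * \<tau>\<^sup>2)"
        "(\<Sum>i\<in>I. w i * exp (- \<tau> * (v i j - m j))) \<le> exp (4 * \<tau>\<^sup>2)"
        using exp_moment_centered[OF I, of "\<lambda>i. v i j" \<tau>] exp_moment_centered[OF I, of "\<lambda>i. v i j" "-\<tau>"] J l
        by (auto simp: m_def \<tau>_def)
    qed (auto simp: P_def N_def)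
    also have "\<dots> = \<Phi> s n * exp (4 * \<tau>\<^sup>2)"
      by (simp add: \<Phi>_def P_def N_def sum_distrib_right distrib_right)
    finally obtain i where i: "i \<in> I" "\<Phi> (s(n := i)) (Suc n) \<le> \<Phi> s n * exp (4 * \<tau>\<^sup>2)"
      using weighted_average_attained[OF I, of "\<lambda>i. \<Phi> (s(n := i)) (Suc n)"] by blast
    have "\<Phi> s n * exp (4 * \<tau>\<^sup>2) \<le> 2 * real (card J) * exp (4 * \<tau>\<^sup>2) ^ n * exp (4 * \<tau>\<^sup>2)"
      using s(2) by (intro mult_right_mono) auto
    then have "\<Phi> (s(n := i)) (Suc n) \<le> 2 * real (card J) * exp (4 * \<tau>\<^sup>2) ^ Suc n"
      using i by (simp only: power_Suc2 mult.assoc)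
    moreover have "(s(n := i)) ` {..<Suc n} \<subseteq> I" using s i by (auto simp: less_Suc_eq)
    ultimately show ?case by blast
  qed
  then obtain s where s: "s ` {..<K} \<subseteq> I" "\<Phi> s K \<le> 2 * real (card J) * exp (4 * \<tau>\<^sup>2) ^ K" by blast
  have "\<bar>(\<Sum>t<K. v (s t) j) / real K - m j\<bar> \<le> l" if j: "j \<in> J" for j
  proof (rule ccontr)
    define S where "S = (\<Sum>t<K. v (s t) j - m j)"
    assume neg: "\<not> ?thesis"
    have "K > 0"
    proof (rule ccontr)
      assume "\<not> K > 0"
      moreover have "card J \<ge> 1" using j J by (metis card_0_eq empty_iff less_one not_less)
      ultimately show False using K by simp
    qed
    then have "(\<Sum>t<K. v (s t) j) / real K - m j = S / real K"
      by (simp add: S_def sum_subtractf field_simps)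
    then have big: "\<bar>S\<bar> > real K * l" using neg \<open>K > 0\<close> by (simp add: field_simps)
    have "exp (\<tau> * (real K * l)) \<le> exp (\<tau> * \<bar>S\<bar>)" using big l by (simp add: \<tau>_def mult_left_mono)
    also have "\<dots> \<le> exp (\<tau> * S) + exp (- \<tau> * S)" by (cases "S \<ge> 0") (auto)
    also have "\<dots> \<le> \<Phi> s K"
      unfolding \<Phi>_def S_def using j J(1) by (intro member_le_sum) auto
    also have "\<dots> \<le> 2 * real (card J) * exp (4 * \<tau>\<^sup>2) ^ K" by (rule s(2))
    also have "\<dots> < exp (real K * l\<^sup>2 / 16) * exp (4 * \<tau>\<^sup>2) ^ K" using K by (intro mult_strict_right_mono) auto
    also have "\<dots> = exp (\<tau> * (real K * l))"
      by (simp add: \<tau>_def exp_of_nat_mult[symmetric] exp_add[symmetric] power2_eq_square)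
    finally show False by simp
  qed
  then show ?thesis using s unfolding m_def by blast
qed

section \<open>The cube as a probability space\<close>

abbreviation unit_interval_measure :: "real measure" where
  "unit_interval_measure \<equiv> restrict_space lborel {0..1}"

lemma prob_space_unit_interval: "prob_space unit_interval_measure"
  by (rule prob_spaceI) (simp add: space_restrict_space emeasure_restrict_space)

lemma product_prob_space_unit_interval:
  "product_prob_space (\<lambda>i::nat. unit_interval_measure)"
  by (simp add: product_prob_space_def product_prob_space_axioms_def product_sigma_finite_def
      prob_space_unit_interval prob_space_imp_sigma_finite)

lemma product_sigma_finite_unit_interval:
  "product_sigma_finite (\<lambda>i::nat. unit_interval_measure)"
  by (simp add: product_sigma_finite_def prob_space_unit_interval prob_space_imp_sigma_finite)

lemma prob_space_cube_measure: "prob_space (cube_measure d)"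
  unfolding cube_measure_def by (intro prob_space_PiM prob_space_unit_interval)

lemma finite_measure_cube_measure: "finite_measure (cube_measure d)"
  by (simp add: prob_space.finite_measure prob_space_cube_measure)

lemma cube_coord_measurable: "i < d \<Longrightarrow> (\<lambda>x. x i) \<in> borel_measurable (cube_measure d)"
proof -
  assume "i < d"
  then have "(\<lambda>x. x i) \<in> cube_measure d \<rightarrow>\<^sub>M unit_interval_measure"
    unfolding cube_measure_def by (intro measurable_component_singleton) auto
  also have "\<dots> \<subseteq> cube_measure d \<rightarrow>\<^sub>M borel"
    by (metis measurable_lborel1 measurable_restrict_space2_iff subsetI)
  finally show ?thesis .
qed

text \<open>
  Continuity on the cube refers to the topology of \<open>nat \<Rightarrow> real\<close>, measurability to the finite
  product. The inclusion of the cube links the two; its remaining coordinates are constant.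
\<close>

lemma id_measurable_cube_borel: "(\<lambda>x. x) \<in> cube_measure d \<rightarrow>\<^sub>M borel"
proof (rule measurable_coordinatewise_then_product)
  fix i
  show "(\<lambda>x. x i) \<in> borel_measurable (cube_measure d)"
  proof (cases "i < d")
    case False
    have "(\<lambda>x. x i) \<in> borel_measurable (cube_measure d) \<longleftrightarrow>
        (\<lambda>x. undefined :: real) \<in> borel_measurable (cube_measure d)"
      using False by (intro measurable_cong) (auto simp: space_cube_measure cube_def)
    then show ?thesis by simp
  qed (rule cube_coord_measurable)
qed

lemma cube_continuous_measurable:
  assumes "f \<in> cube_continuous d"
  shows "f \<in> borel_measurable (cube_measure d)"
proof -
  have "f \<in> borel_measurable (restrict_space borel (cube d))"
    using assms by (intro borel_measurable_continuous_on_restrict) (auto simp: cube_continuous_def)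
  moreover have "(\<lambda>x. x) \<in> cube_measure d \<rightarrow>\<^sub>M restrict_space borel (cube d)"
    by (intro measurable_restrict_space2 id_measurable_cube_borel) (auto simp: space_cube_measure)
  ultimately show ?thesis by measurable
qed

lemma integrable_cube_bounded:
  fixes h :: "(nat \<Rightarrow> real) \<Rightarrow> 'b::{banach, second_countable_topology}"
  assumes "h \<in> borel_measurable (cube_measure d)" "\<And>x. x \<in> cube d \<Longrightarrow> norm (h x) \<le> B"
  shows "integrable (cube_measure d) h"
  by (rule finite_measure.integrable_const_bound[OF finite_measure_cube_measure, where B = B])
     (use assms in \<open>auto simp: space_cube_measure\<close>)

section \<open>Characters and trigonometric polynomials\<close>

definition character :: "nat \<Rightarrow> (nat \<Rightarrow> int) \<Rightarrow> (nat \<Rightarrow> real) \<Rightarrow> complex" where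
  "character d k x = cis (2 * pi * (\<Sum>i<d. of_int (k i) * x i))"

definition trig_poly ::
  "nat \<Rightarrow> (nat \<Rightarrow> int) set \<Rightarrow> ((nat \<Rightarrow> int) \<Rightarrow> complex) \<Rightarrow> (nat \<Rightarrow> real) \<Rightarrow> complex" where
  "trig_poly d \<Lambda> a x = (\<Sum>k\<in>\<Lambda>. a k * character d k x)"

lemma norm_character [simp]: "cmod (character d k x) = 1"
  by (simp add: character_def)

lemma character_add: "character d k (\<lambda>i. x i + y i) = character d k x * character d k y"
  by (simp add: character_def cis_mult sum.distrib algebra_simps)

lemma character_diff: "character d k (\<lambda>i. x i - y i) = character d k x * cnj (character d k y)"
  by (simp add: character_def cis_mult cis_cnj sum_subtractf algebra_simps)

lemma cis_sum: "cis (sum f A) = (\<Prod>i\<in>A. cis (f i))"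
  by (induction A rule: infinite_finite_induct) (simp_all add: cis_mult[symmetric])

lemma character_prod: "character d k x = (\<Prod>i<d. cis (2 * pi * of_int (k i) * x i))"
  by (simp add: character_def sum_distrib_left cis_sum mult.assoc)

lemma borel_measurable_cis [measurable]:
  "f \<in> borel_measurable M \<Longrightarrow> (\<lambda>x. cis (f x)) \<in> borel_measurable M"
  by (rule measurable_compose[OF _ borel_measurable_continuous_onI]) (auto intro!: continuous_intros)

lemma borel_measurable_cnj [measurable]:
  "f \<in> borel_measurable M \<Longrightarrow> (\<lambda>x. cnj (f x)) \<in> borel_measurable M"
  by (rule measurable_compose[OF _ borel_measurable_continuous_onI]) (auto intro!: continuous_intros)

lemma character_measurable [measurable]:
  "(\<lambda>y. character d k y) \<in> borel_measurable (cube_measure d)"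
  unfolding character_def
  by (intro borel_measurable_cis borel_measurable_times borel_measurable_sum borel_measurable_const
      cube_coord_measurable) auto

lemma character_translate_measurable [measurable]:
  "(\<lambda>y. character d k (\<lambda>i. z i + y i)) \<in> borel_measurable (cube_measure d)"
  unfolding character_add by measurable

lemma trig_poly_measurable [measurable]:
  "trig_poly d \<Lambda> a \<in> borel_measurable (cube_measure d)"
  unfolding trig_poly_def by measurable

lemma trig_poly_translate_measurable [measurable]:
  "(\<lambda>y. trig_poly d \<Lambda> a (\<lambda>i. z i + y i)) \<in> borel_measurable (cube_measure d)"
  unfolding trig_poly_def by measurable

lemma norm_trig_poly_le: "cmod (trig_poly d \<Lambda> a x) \<le> (\<Sum>k\<in>\<Lambda>. cmod (a k))"
  unfolding trig_poly_def by (rule order.trans[OF norm_sum]) (simp add: norm_mult)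

lemma trig_poly_diff: "trig_poly d \<Lambda> (\<lambda>k. a k - b k) x = trig_poly d \<Lambda> a x - trig_poly d \<Lambda> b x"
  by (simp add: trig_poly_def sum_subtractf algebra_simps)

lemma trig_poly_add: "trig_poly d \<Lambda> (\<lambda>k. a k + b k) x = trig_poly d \<Lambda> a x + trig_poly d \<Lambda> b x"
  by (simp add: trig_poly_def sum.distrib algebra_simps)

lemma fourier_coeff_eq:
  "fourier_coeff d f k = (LINT x|cube_measure d. f x * cnj (character d k x))"
proof -
  have "exp (- 2 * pi * \<i> * of_real (\<Sum>i<d. of_int (k i) * x i)) = cnj (character d k x)" for x
    unfolding character_def cis_cnj by (simp add: cis_conv_exp algebra_simps)
  then show ?thesis by (simp add: fourier_coeff_def)
qed

section \<open>Translations of the circle\<close>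

lemma emeasure_lborel_translate:
  fixes A :: "real set"
  assumes "A \<in> sets borel"
  shows "emeasure lborel {x. x + c \<in> A} = emeasure lborel A"
proof -
  have "emeasure lborel A = emeasure (distr lborel borel ((+) c)) A"
    by (simp add: lborel_distr_plus)
  also have "\<dots> = emeasure lborel ((+) c -` A \<inter> space lborel)"
    using assms by (intro emeasure_distr) auto
  also have "(+) c -` A \<inter> space lborel = {x. x + c \<in> A}" by (auto simp: add.commute)
  finally show ?thesis by simp
qed

lemma frac_translate_measurable:
  "(\<lambda>x. frac (x + c)) \<in> unit_interval_measure \<rightarrow>\<^sub>M unit_interval_measure"
proof -
  have "(\<lambda>x. x + c - real_of_int \<lfloor>x + c\<rfloor>) \<in> borel_measurable borel"
    by (intro borel_measurable_diff measurable_compose[OF _ borel_measurable_real_floor]) measurable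
  then have "(\<lambda>x. frac (x + c)) \<in> borel_measurable lborel" by (simp add: frac_def[abs_def])
  then show ?thesis
    by (intro measurable_restrict_space2 measurable_restrict_space1)
       (auto simp: space_restrict_space frac_lt_1 less_imp_le)
qed

text \<open>
  A rotation of the circle cuts the unit interval at \<open>1 - s\<close> and exchanges the two pieces by
  translations. The point 1, which \<open>frac\<close> identifies with 0, is a null set.
\<close>

lemma distr_unit_interval_frac:
  "distr unit_interval_measure unit_interval_measure (\<lambda>x. frac (x + c)) = unit_interval_measure"
proof (rule measure_eqI)
  fix A assume "A \<in> sets (distr unit_interval_measure unit_interval_measure (\<lambda>x. frac (x + c)))"
  then have A: "A \<in> sets borel" "A \<subseteq> {0..1}"
    by (auto simp: sets_restrict_space_iff)
  define s where "s = frac c"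
  have s: "0 \<le> s" "s < 1" by (auto simp: s_def frac_lt_1)
  have meas: "(\<lambda>x. frac (x + c)) \<in> unit_interval_measure \<rightarrow>\<^sub>M unit_interval_measure"
    by (rule frac_translate_measurable)
  define B where "B = (\<lambda>x. frac (x + c)) -` A \<inter> {0..1}"
  have "c = s + of_int \<lfloor>c\<rfloor>" by (simp add: s_def frac_def)
  then have int: "x + c - (x + s) \<in> \<int>" "x + c - (x + s - 1) \<in> \<int>" for x
    by (metis Ints_of_int add_diff_cancel_left add_diff_cancel_left',
        metis Ints_1 Ints_add Ints_of_int add_diff_cancel_left add_diff_cancel_left' diff_diff_eq2 diff_add_eq)
  have fr: "frac (x + c) = (if x < 1 - s then x + s else x + (s - 1))" if "0 \<le> x" "x < 1" for x
    using that s int[of x] by (auto simp: frac_unique_iff add_diff_eq)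
  define B1 where "B1 = {x. x + s \<in> A \<inter> {s..<1}}"
  define B2 where "B2 = {x. x + (s - 1) \<in> A \<inter> {0..<s}}"
  have B1: "emeasure lborel B1 = emeasure lborel (A \<inter> {s..<1})" "B1 \<in> sets lborel"
    unfolding B1_def using A(1) emeasure_lborel_translate[of "A \<inter> {s..<1}" s] by auto
  have B2: "emeasure lborel B2 = emeasure lborel (A \<inter> {0..<s})" "B2 \<in> sets lborel"
    unfolding B2_def using A(1) emeasure_lborel_translate[of "A \<inter> {0..<s}" "s-1"] by (auto)
  have null1: "emeasure lborel {1::real} = 0" by simp
  have "B - {1} = (B1 \<union> B2)"
    using s by (auto simp: B_def B1_def B2_def fr split: if_splits)
  have Bm: "B \<in> sets lborel"
    using measurable_sets[OF meas, of A] A by (auto simp: B_def sets_restrict_space_iff space_restrict_space)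
  have "emeasure lborel B = emeasure lborel (B - {1})"
    using Bm by (intro emeasure_Diff_null_set[symmetric]) auto
  also have "\<dots> = emeasure lborel B1 + emeasure lborel B2"
    unfolding \<open>B - {1} = B1 \<union> B2\<close> using B1 B2
    by (intro plus_emeasure[symmetric]) (auto simp: B1_def B2_def)
  also have "\<dots> = emeasure lborel (A \<inter> {s..<1} \<union> A \<inter> {0..<s})"
    unfolding B1 B2 using A by (intro plus_emeasure) auto
  also have "A \<inter> {s..<1} \<union> A \<inter> {0..<s} = A - {1}" using A s by auto
  also have "emeasure lborel (A - {1}) = emeasure lborel A"
    using A by (intro emeasure_Diff_null_set) auto
  finally have *: "emeasure lborel B = emeasure lborel A" .
  have "emeasure (distr unit_interval_measure unit_interval_measure (\<lambda>x. frac (x + c))) A =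
      emeasure unit_interval_measure B"
    using A meas by (subst emeasure_distr) (auto simp: sets_restrict_space_iff space_restrict_space B_def)
  also have "\<dots> = emeasure lborel B"
    by (intro emeasure_restrict_space) (auto simp: B_def)
  also have "\<dots> = emeasure lborel A" by (rule *)
  also have "\<dots> = emeasure unit_interval_measure A"
    using A by (intro emeasure_restrict_space[symmetric]) auto
  finally show "emeasure (distr unit_interval_measure unit_interval_measure (\<lambda>x. frac (x + c))) A =
      emeasure unit_interval_measure A" .
qed simp

section \<open>The Fejer kernel\<close>

text \<open>
  As a normalized square the kernel is visibly nonnegative; \<open>fejer_expansion\<close> recovers the usual
  triangular weights.
\<close>

definition fejer :: "nat \<Rightarrow> real \<Rightarrow> real" where
  "fejer R s = (cmod (\<Sum>j<R. cis (2 * pi * real j * s)))\<^sup>2 / real R"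

lemma fejer_nonneg: "fejer R s \<ge> 0"
  by (simp add: fejer_def)

lemma fejer_expansion_aux:
  fixes s :: real
  defines "c \<equiv> \<lambda>k::int. cis (2 * pi * of_int k * s)"
  shows "(\<Sum>j<R. c (int j)) * cnj (\<Sum>j<R. c (int j)) =
     (\<Sum>k\<in>{- int R<..<int R}. of_int (int R - \<bar>k\<bar>) * c k)"
proof (induction R)
  case 0
  show ?case by simp
next
  case (Suc R)
  define S where "S = (\<Sum>j<R. c (int j))"
  have c_mult: "c a * cnj (c b) = c (a - b)" for a b
    by (simp add: c_def cis_cnj cis_mult algebra_simps)
  have c0: "c 0 = 1" by (simp add: c_def)
  have 1: "c (int R) * cnj S = (\<Sum>k\<in>{1..int R}. c k)"
  proof -
    have "c (int R) * cnj S = (\<Sum>j<R. c (int R - int j))"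
      by (simp add: S_def sum_distrib_left c_mult)
    also have "\<dots> = (\<Sum>k\<in>{1..int R}. c k)"
      by (rule sum.reindex_bij_witness[of _ "\<lambda>k. nat (int R - k)" "\<lambda>j. int R - int j"]) auto
    finally show ?thesis .
  qed
  have 2: "S * cnj (c (int R)) = (\<Sum>k\<in>{-int R..-1}. c k)"
  proof -
    have "S * cnj (c (int R)) = (\<Sum>j<R. c (int j - int R))"
      by (simp add: S_def sum_distrib_right c_mult)
    also have "\<dots> = (\<Sum>k\<in>{-int R..-1}. c k)"
      by (rule sum.reindex_bij_witness[of _ "\<lambda>k. nat (int R + k)" "\<lambda>j. int j - int R"]) auto
    finally show ?thesis .
  qed
  have "(\<Sum>j<Suc R. c (int j)) * cnj (\<Sum>j<Suc R. c (int j)) =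
      S * cnj S + S * cnj (c (int R)) + c (int R) * cnj S + 1"
    using c_mult[of "int R" "int R"] c0 by (simp add: S_def algebra_simps)
  also have "\<dots> = (\<Sum>k\<in>{- int R<..<int R}. of_int (int R - \<bar>k\<bar>) * c k) +
      ((\<Sum>k\<in>{-int R..-1}. c k) + (\<Sum>k\<in>{1..int R}. c k) + (\<Sum>k\<in>{0}. c k))"
    unfolding 1 2 using Suc.IH by (simp add: S_def c0)
  also have "(\<Sum>k\<in>{-int R..-1}. c k) + (\<Sum>k\<in>{1..int R}. c k) + (\<Sum>k\<in>{0}. c k) =
      (\<Sum>k\<in>{-int R..-1} \<union> {1..int R} \<union> {0}. c k)"
    by (subst sum.union_disjoint; auto)+
  also have "{-int R..-1} \<union> {1..int R} \<union> {0} = {- int (Suc R)<..<int (Suc R)}"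
    by auto
  also have "(\<Sum>k\<in>{- int R<..<int R}. of_int (int R - \<bar>k\<bar>) * c k) =
     (\<Sum>k\<in>{- int (Suc R)<..<int (Suc R)}. of_int (int R - \<bar>k\<bar>) * c k)"
  proof (rule sum.mono_neutral_left)
    have "\<bar>k\<bar> = int R" if "k \<in> {- int (Suc R)<..<int (Suc R)} - {- int R<..<int R}" for k
      using that by auto
    then show "\<forall>k\<in>{- int (Suc R)<..<int (Suc R)} - {- int R<..<int R}. of_int (int R - \<bar>k\<bar>) * c k = 0"
      by simp
  qed auto
  finally show ?case
    by (simp add: sum.distrib[symmetric] algebra_simps)
qed

lemma fejer_expansion:
  assumes "R > 0"
  shows "of_real (fejer R s) =
    (\<Sum>k\<in>{- int R<..<int R}. of_real (1 - \<bar>of_int k\<bar> / real R) * cis (2 * pi * of_int k * s))"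
proof -
  have "of_real (fejer R s) = (\<Sum>j<R. cis (2 * pi * of_int (int j) * s)) *
      cnj (\<Sum>j<R. cis (2 * pi * of_int (int j) * s)) / of_real (real R)"
    by (simp add: fejer_def complex_norm_square flip: of_real_power)
  also have "\<dots> = (\<Sum>k\<in>{- int R<..<int R}. of_int (int R - \<bar>k\<bar>) * cis (2 * pi * of_int k * s)) / of_real (real R)"
    unfolding fejer_expansion_aux ..
  also have "\<dots> = (\<Sum>k\<in>{- int R<..<int R}. of_real (1 - \<bar>of_int k\<bar> / real R) * cis (2 * pi * of_int k * s))"
    unfolding sum_divide_distrib
  proof (intro sum.cong refl)
    fix k :: int
    have "1 - \<bar>of_int k\<bar> / real R = real_of_int (int R - \<bar>k\<bar>) / real R"
      using assms by (simp add: field_simps)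
    then show "of_int (int R - \<bar>k\<bar>) * cis (2 * pi * of_int k * s) / of_real (real R) =
        of_real (1 - \<bar>of_int k\<bar> / real R) * cis (2 * pi * of_int k * s)"
      by (simp only: of_real_divide of_real_of_int_eq times_divide_eq_left)
  qed
  finally show ?thesis .
qed

lemma cis_measurable_unit_interval [measurable]: "(\<lambda>y. cis (a * y)) \<in> borel_measurable unit_interval_measure"
  by (intro borel_measurable_cis measurable_restrict_space1) measurable

lemma integral_unit_interval_translate:
  fixes u :: "real \<Rightarrow> complex"
  assumes "u \<in> borel_measurable unit_interval_measure"
  shows "(LINT y|unit_interval_measure. u (frac (y + c))) = (LINT y|unit_interval_measure. u y)"
proof -
  have "(\<lambda>x. frac (x + c)) \<in> unit_interval_measure \<rightarrow>\<^sub>M unit_interval_measure"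
    by (rule frac_translate_measurable)
  then have "(LINT y|distr unit_interval_measure unit_interval_measure (\<lambda>x. frac (x + c)). u y) =
     (LINT y|unit_interval_measure. u (frac (y + c)))"
    using assms by (intro integral_distr) auto
  then show ?thesis by (simp add: distr_unit_interval_frac)
qed

lemma cis_2pi_frac: "cis (2 * pi * of_int k * frac x) = cis (2 * pi * of_int k * x)"
proof -
  have "cis (2 * pi * of_int k * frac x) = cis (2 * pi * of_int k * x) * cis (2 * pi * of_int (- k * \<lfloor>x\<rfloor>))"
    by (simp add: cis_mult frac_def algebra_simps)
  also have "cis (2 * pi * of_int (- k * \<lfloor>x\<rfloor>)) = 1" by (rule cis_multiple_2pi) simp
  finally show ?thesis by simp
qed

text \<open>
  Rotation by half a period changes the sign of a nontrivial character but not its integral.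
\<close>

lemma integral_cis_unit_interval:
  "(LINT y|unit_interval_measure. cis (2 * pi * of_int k * y)) = (if k = 0 then 1 else 0)"
proof (cases "k = 0")
  case True
  then show ?thesis
    using prob_space.prob_space[OF prob_space_unit_interval] by simp
next
  case False
  let ?I = "LINT y|unit_interval_measure. cis (2 * pi * of_int k * y)"
  have "?I = (LINT y|unit_interval_measure. cis (2 * pi * of_int k * frac (y + 1 / (2 * of_int k))))"
    by (rule integral_unit_interval_translate[symmetric])
       measurable
  also have "\<dots> = (LINT y|unit_interval_measure. - cis (2 * pi * of_int k * y))"
  proof -
    have "cis (2 * pi * of_int k * frac (y + 1 / (2 * of_int k))) = - cis (2 * pi * of_int k * y)" for y
    proof -
      have "cis (2 * pi * of_int k * (y + 1 / (2 * of_int k))) = cis (2 * pi * of_int k * y) * cis pi"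
        using False by (simp add: cis_mult distrib_left del: cis_pi)
      then show ?thesis by (simp add: cis_2pi_frac)
    qed
    then show ?thesis by simp
  qed
  finally have "?I = - ?I" by simp
  then show ?thesis using False by simp
qed

lemma integral_fejer_cis:
  assumes "R > 0"
  shows "(LINT y|unit_interval_measure. of_real (fejer R (t - y)) * cis (2 * pi * of_int m * (t - y))) =
    (if \<bar>m\<bar> < int R then of_real (1 - \<bar>of_int m\<bar> / real R) else 0)"
proof -
  interpret U: prob_space unit_interval_measure by (rule prob_space_unit_interval)
  have int: "integrable unit_interval_measure (\<lambda>y. cis (2 * pi * of_int k * y))" for k :: int
    by (rule U.integrable_const_bound[where B = 1])
       auto
  have "of_real (fejer R (t - y)) * cis (2 * pi * of_int m * (t - y)) =
     (\<Sum>k\<in>{- int R<..<int R}. of_real (1 - \<bar>of_int k\<bar> / real R) * cis (2 * pi * of_int (k + m) * t) *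
        cis (2 * pi * of_int (- (k + m)) * y))" for y
    unfolding fejer_expansion[OF assms] sum_distrib_right
    by (intro sum.cong refl) (simp add: mult.assoc cis_mult algebra_simps)
  then have "(LINT y|unit_interval_measure. of_real (fejer R (t - y)) * cis (2 * pi * of_int m * (t - y))) =
     (\<Sum>k\<in>{- int R<..<int R}. of_real (1 - \<bar>of_int k\<bar> / real R) * cis (2 * pi * of_int (k + m) * t) *
        (if k = - m then 1 else 0))"
    by (simp add: Bochner_Integration.integral_sum integrable_mult_right[OF int] integral_cis_unit_interval
        del: of_int_add of_int_minus minus_add_distrib)
       (auto intro!: sum.cong simp: integral_cis_unit_interval simp del: of_int_add of_int_minus minus_add_distrib)
  also have "\<dots> = (\<Sum>k\<in>{- int R<..<int R}. if k = - m
      then of_real (1 - \<bar>of_int k\<bar> / real R) * cis (2 * pi * of_int (k + m) * t) else 0)"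
    by (intro sum.cong) auto
  also have "\<dots> = (if \<bar>m\<bar> < int R then of_real (1 - \<bar>of_int m\<bar> / real R) else 0)"
    by (subst sum.delta) auto
  finally show ?thesis .
qed

lemma fejer_measurable [measurable]: "(\<lambda>y. fejer R (t - y)) \<in> borel_measurable borel"
  unfolding fejer_def by measurable

lemma fejer_le: "fejer R s \<le> real R"
proof (cases "R = 0")
  case False
  have "cmod (\<Sum>j<R. cis (2 * pi * real j * s)) \<le> (\<Sum>j<R. cmod (cis (2 * pi * real j * s)))"
    by (rule norm_sum)
  then have "(cmod (\<Sum>j<R. cis (2 * pi * real j * s)))\<^sup>2 \<le> (real R)\<^sup>2"
    by (intro power_mono) auto
  then show ?thesis using False by (simp add: fejer_def field_simps power2_eq_square)
qed (simp add: fejer_def)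

lemma integrable_fejer:
  assumes "u \<in> borel_measurable borel" "\<And>s. \<bar>u s\<bar> \<le> 1"
  shows "integrable unit_interval_measure (\<lambda>y. fejer R (t - y) * u (y::real))"
proof -
  interpret U: prob_space unit_interval_measure by (rule prob_space_unit_interval)
  show ?thesis
  proof (rule U.integrable_const_bound[where B = "real R"])
    show "AE y in unit_interval_measure. norm (fejer R (t - y) * u y) \<le> real R"
    proof (rule AE_I2)
      fix y
      have "\<bar>fejer R (t - y)\<bar> * \<bar>u y\<bar> \<le> real R * 1"
        using fejer_le fejer_nonneg assms by (intro mult_mono) auto
      then show "norm (fejer R (t - y) * u y) \<le> real R" by (simp add: abs_mult)
    qed
  qed (use assms in \<open>auto intro!: measurable_restrict_space1\<close>)
qed

lemma integral_fejer:
  assumes "R > 0"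
  shows "(LINT y|unit_interval_measure. fejer R (t - y)) = 1"
proof -
  have "complex_of_real (LINT y|unit_interval_measure. fejer R (t - y)) = 1"
    using integral_fejer_cis[OF assms, of t 0] assms
    by (simp flip: integral_complex_of_real)
  then show ?thesis by simp
qed

text \<open>
  This quantifies the concentration of the kernel at the integers. As \<open>sin^2\<close> is a trigonometric
  polynomial of degree 1, its integral is given by the two weights \<open>1\<close> and \<open>1 - 1 / R\<close>.
\<close>

lemma integral_fejer_sin_square:
  assumes "R > 0"
  shows "(LINT y|unit_interval_measure. fejer R (t - y) * (sin (pi * (t - y)))\<^sup>2) = 1 / (2 * real R)"
proof -
  interpret U: prob_space unit_interval_measure by (rule prob_space_unit_interval)
  have i1: "integrable unit_interval_measure (\<lambda>y. fejer R (t - y))"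
    using integrable_fejer[of "\<lambda>_. 1"] by simp
  have i2: "integrable unit_interval_measure (\<lambda>y. fejer R (t - y) * cos (2 * pi * (t - y)))"
    by (intro integrable_fejer) auto
  have *: "(LINT y|unit_interval_measure. fejer R (t - y) * cos (2 * pi * (t - y))) = 1 - 1 / real R"
  proof -
    have "integrable unit_interval_measure (\<lambda>y. of_real (fejer R (t - y)) * cis (2 * pi * of_int 1 * (t - y)))"
    proof (rule U.integrable_const_bound[where B = "real R"])
      show "(\<lambda>y. of_real (fejer R (t - y)) * cis (2 * pi * of_int 1 * (t - y))) \<in> borel_measurable unit_interval_measure"
        by (intro measurable_restrict_space1) measurable
    qed (auto simp: norm_mult fejer_le fejer_nonneg)
    then have "Re (LINT y|unit_interval_measure. of_real (fejer R (t - y)) * cis (2 * pi * of_int 1 * (t - y))) =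
      (LINT y|unit_interval_measure. fejer R (t - y) * cos (2 * pi * (t - y)))"
      by (subst integral_Re[symmetric]) (auto)
    then show ?thesis
      unfolding integral_fejer_cis[OF assms] using assms by (auto split: if_splits)
  qed
  have "(LINT y|unit_interval_measure. fejer R (t - y) * (sin (pi * (t - y)))\<^sup>2) =
     (LINT y|unit_interval_measure. (fejer R (t - y) - fejer R (t - y) * cos (2 * pi * (t - y))) / 2)"
  proof (intro Bochner_Integration.integral_cong refl)
    fix y
    have "(sin (pi * (t - y)))\<^sup>2 = (1 - cos (2 * pi * (t - y))) / 2"
      using cos_double_sin[of "pi * (t - y)"] by (simp add: mult.assoc)
    then show "fejer R (t - y) * (sin (pi * (t - y)))\<^sup>2 =
        (fejer R (t - y) - fejer R (t - y) * cos (2 * pi * (t - y))) / 2"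
      by (simp only: right_diff_distrib mult_1_right times_divide_eq_right)
  qed
  also have "\<dots> = 1 / (2 * real R)"
    using i1 i2 * integral_fejer[OF assms, of t] by simp
  finally show ?thesis .
qed

section \<open>Uniform approximation in the class by trigonometric polynomials\<close>

definition freq_box :: "nat \<Rightarrow> nat \<Rightarrow> (nat \<Rightarrow> int) set" where
  "freq_box d R = {..<d} \<rightarrow>\<^sub>E {- int R<..<int R}"

definition fejer_kernel :: "nat \<Rightarrow> nat \<Rightarrow> (nat \<Rightarrow> real) \<Rightarrow> (nat \<Rightarrow> real) \<Rightarrow> real" where
  "fejer_kernel d R x y = (\<Prod>i<d. fejer R (x i - y i))"

definition fejer_weight :: "nat \<Rightarrow> nat \<Rightarrow> (nat \<Rightarrow> int) \<Rightarrow> real" where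
  "fejer_weight d R k = (\<Prod>i<d. 1 - \<bar>of_int (k i)\<bar> / real R)"

lemma finite_freq_box [simp]: "finite (freq_box d R)"
  by (simp add: freq_box_def finite_PiE)

lemma freq_box_subset: "freq_box d R \<subseteq> int_lattice d"
  by (auto simp: freq_box_def int_lattice_def)

lemma fejer_weight_bounds:
  assumes "k \<in> freq_box d R"
  shows "0 \<le> fejer_weight d R k" "fejer_weight d R k \<le> 1"
proof -
  have "0 \<le> 1 - \<bar>of_int (k i)\<bar> / real R \<and> 1 - \<bar>of_int (k i)\<bar> / real R \<le> 1" if "i < d" for i
  proof -
    have "\<bar>k i\<bar> < int R" using assms that by (force simp: freq_box_def PiE_iff)
    then have "real_of_int \<bar>k i\<bar> \<le> real R" "R > 0" by linarith+
    then show ?thesis by (simp add: field_simps)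
  qed
  then show "0 \<le> fejer_weight d R k" "fejer_weight d R k \<le> 1"
    unfolding fejer_weight_def by (auto intro!: prod_nonneg prod_le_1)
qed

lemma fejer_kernel_nonneg: "fejer_kernel d R x y \<ge> 0"
  unfolding fejer_kernel_def by (intro prod_nonneg) (simp add: fejer_nonneg)

lemma fejer_kernel_expansion:
  assumes "R > 0"
  shows "of_real (fejer_kernel d R x y) =
    (\<Sum>k\<in>freq_box d R. of_real (fejer_weight d R k) * character d k x * cnj (character d k y))"
proof -
  have "of_real (fejer_kernel d R x y) = (\<Prod>i<d. \<Sum>k\<in>{- int R<..<int R}.
      of_real (1 - \<bar>of_int k\<bar> / real R) * cis (2 * pi * of_int k * (x i - y i)))"
    unfolding fejer_kernel_def of_real_prod fejer_expansion[OF assms] ..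
  also have "\<dots> = (\<Sum>k\<in>freq_box d R. \<Prod>i<d. of_real (1 - \<bar>of_int (k i)\<bar> / real R) *
      cis (2 * pi * of_int (k i) * (x i - y i)))"
    unfolding freq_box_def by (subst prod_sum_PiE) auto
  also have "\<dots> = (\<Sum>k\<in>freq_box d R. of_real (fejer_weight d R k) * character d k x * cnj (character d k y))"
  proof (intro sum.cong refl)
    fix k
    have "(\<Prod>i<d. cis (2 * pi * of_int (k i) * (x i - y i))) = character d k x * cnj (character d k y)"
      using character_diff[of d k x y] by (simp only: character_prod)
    then show "(\<Prod>i<d. of_real (1 - \<bar>of_int (k i)\<bar> / real R) * cis (2 * pi * of_int (k i) * (x i - y i))) =
       of_real (fejer_weight d R k) * character d k x * cnj (character d k y)"
      by (simp only: prod.distrib fejer_weight_def of_real_prod mult.assoc)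
  qed
  finally show ?thesis .
qed

lemma integral_fejer_kernel:
  assumes "R > 0"
  shows "integrable (cube_measure d) (\<lambda>y. fejer_kernel d R x y)"
    and "(LINT y|cube_measure d. fejer_kernel d R x y) = 1"
proof -
  interpret product_sigma_finite "\<lambda>i::nat. unit_interval_measure"
    by (rule product_sigma_finite_unit_interval)
  have int: "integrable unit_interval_measure (\<lambda>y. fejer R (x i - y))" for i
    using integrable_fejer[of "\<lambda>_. 1"] by simp
  show "integrable (cube_measure d) (\<lambda>y. fejer_kernel d R x y)"
    unfolding fejer_kernel_def cube_measure_def using int by (intro product_integrable_prod) auto
  have "(LINT y|cube_measure d. fejer_kernel d R x y) =
      (\<Prod>i<d. LINT y|unit_interval_measure. fejer R (x i - y))"
    unfolding fejer_kernel_def cube_measure_def using int by (intro product_integral_prod) auto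
  then show "(LINT y|cube_measure d. fejer_kernel d R x y) = 1"
    by (simp add: integral_fejer assms)
qed

lemma integral_fejer_kernel_sin_square:
  assumes "R > 0" "i < d"
  shows "integrable (cube_measure d) (\<lambda>y. fejer_kernel d R x y * (sin (pi * (x i - y i)))\<^sup>2)"
    and "(LINT y|cube_measure d. fejer_kernel d R x y * (sin (pi * (x i - y i)))\<^sup>2) = 1 / (2 * real R)"
proof -
  interpret product_sigma_finite "\<lambda>i::nat. unit_interval_measure"
    by (rule product_sigma_finite_unit_interval)
  define h where "h = (\<lambda>j y. fejer R (x j - y) * (if j = i then (sin (pi * (x j - y)))\<^sup>2 else 1))"
  have eq: "fejer_kernel d R x y * (sin (pi * (x i - y i)))\<^sup>2 = (\<Prod>j<d. h j (y j))" for y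
    using assms by (simp add: h_def prod.distrib fejer_kernel_def prod.delta)
  have "\<bar>(sin s)\<^sup>2\<bar> \<le> 1" for s :: real
    using abs_sin_le_one[of s] by (simp add: abs_square_le_1)
  then have int: "integrable unit_interval_measure (h j)" for j
    unfolding h_def by (intro integrable_fejer) (auto split: if_splits)
  show "integrable (cube_measure d) (\<lambda>y. fejer_kernel d R x y * (sin (pi * (x i - y i)))\<^sup>2)"
    unfolding eq cube_measure_def using int by (intro product_integrable_prod) auto
  have "(LINT y|cube_measure d. fejer_kernel d R x y * (sin (pi * (x i - y i)))\<^sup>2) =
      (\<Prod>j<d. LINT y|unit_interval_measure. h j y)"
    unfolding eq cube_measure_def using int by (intro product_integral_prod) auto
  also have "\<dots> = (\<Prod>j<d. if j = i then 1 / (2 * real R) else 1)"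
    by (intro prod.cong refl) (simp add: h_def integral_fejer integral_fejer_sin_square assms)
  also have "\<dots> = 1 / (2 * real R)" using assms by (simp add: prod.delta)
  finally show "(LINT y|cube_measure d. fejer_kernel d R x y * (sin (pi * (x i - y i)))\<^sup>2) = 1 / (2 * real R)" .
qed

lemma sin_pi_ge_twice:
  assumes "0 \<le> t" "t \<le> 1 / 2"
  shows "2 * t \<le> sin (pi * t)"
proof -
  have "convex_on {0..pi} (\<lambda>x. - sin x)"
    by (rule f''_ge0_imp_convex[where f' = "\<lambda>x. - cos x" and f'' = "\<lambda>x. sin x"])
       (auto intro!: derivative_eq_intros sin_ge_zero)
  from convex_onD[OF this, of "2 * t" 0 "pi / 2"] assms show ?thesis by (simp add: mult.commute)
qed

lemma abs_le_half_abs_sin: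
  assumes "\<bar>t\<bar> \<le> 1 / 2"
  shows "\<bar>t\<bar> \<le> \<bar>sin (pi * t)\<bar> / 2"
  using sin_pi_ge_twice[of t] sin_pi_ge_twice[of "- t"] assms by (cases "t \<ge> 0") auto

lemma periodic_extension_shift:
  assumes g: "\<And>x i. x \<in> euclid d \<Longrightarrow> i < d \<Longrightarrow> g (x(i := x i + 1)) = g x" and x: "x \<in> euclid d"
  shows "g (\<lambda>i. if i < d then x i + of_int (k i) else x i) = g x"
proof -
  have upd: "x(i := c) \<in> euclid d" if "x \<in> euclid d" "i < d" for x i and c :: real
    using that by (auto simp: euclid_def PiE_iff extensional_def)
  have nat: "g (x(i := x i + real n)) = g x" if "x \<in> euclid d" "i < d" for x i n
  proof (induction n)
    case (Suc n)
    have "g (x(i := x i + real (Suc n))) = g ((x(i := x i + real n))(i := (x(i := x i + real n)) i + 1))"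
      by (simp add: add_ac)
    also have "\<dots> = g x" unfolding g[OF upd[OF that] that(2)] by (rule Suc)
    finally show ?case .
  qed simp
  have int: "g (x(i := x i + of_int m)) = g x" if "x \<in> euclid d" "i < d" for x i m
  proof (cases "m \<ge> 0")
    case True
    then show ?thesis using nat[OF that, of "nat m"] by simp
  next
    case False
    then show ?thesis using nat[OF upd[OF that] that(2), of "x i + of_int m" "nat (- m)"] by simp
  qed
  have "g (\<lambda>i. if i < n then x i + of_int (k i) else x i) = g x \<and>
      (\<lambda>i. if i < n then x i + of_int (k i) else x i) \<in> euclid d" if "n \<le> d" for n
    using that
  proof (induction n)
    case 0
    then show ?case using x by simp
  next
    case (Suc n)
    let ?y = "\<lambda>i. if i < n then x i + of_int (k i) else x i"
    have "(\<lambda>i. if i < Suc n then x i + of_int (k i) else x i) = ?y(n := ?y n + of_int (k n))"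
      by (auto simp: less_Suc_eq)
    then show ?case using Suc int[of ?y n "k n"] upd[of ?y n] by auto
  qed
  then show ?thesis by blast
qed

text \<open>
  Shifting \<open>y\<close> by the nearest integer vector makes all coordinate differences at most \<open>1 / 2\<close>, where
  \<open>\<bar>t\<bar> \<le> \<bar>sin (pi * t)\<bar>\<close>, and the sine does not see the shift. In this form the Hoelder condition can
  be integrated against the Fejer kernel.
\<close>

lemma F_class_modulus:
  assumes f: "f \<in> F_class \<alpha> d" and xy: "x \<in> cube d" "y \<in> cube d" and "0 < \<alpha>"
  shows "cmod (f x - f y) \<le> sqrt (\<Sum>i<d. (sin (pi * (x i - y i)))\<^sup>2) powr \<alpha>"
proof -
  obtain g where ext: "periodic_extension d f g" and lip: "\<forall>x\<in>euclid d. \<forall>y\<in>euclid d. x \<noteq> y \<longrightarrow>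
                cmod (g x - g y) / L2_set (\<lambda>i. x i - y i) {..<d} powr \<alpha> \<le> 1"
    using f by (auto simp only: F_class_def mem_Collect_eq)
  have g: "g x = f x" if "x \<in> cube d" for x
    using ext that by (simp add: periodic_extension_def)
  have g_per: "g (x(i := x i + 1)) = g x" if "x \<in> euclid d" "i < d" for x i
    using ext that by (simp add: periodic_extension_def)
  have holder: "cmod (g x - g y) / L2_set (\<lambda>i. x i - y i) {..<d} powr \<alpha> \<le> 1"
    if "x \<in> euclid d" "y \<in> euclid d" "x \<noteq> y" for x y
    using lip that by blast
  have eu: "x \<in> euclid d" "y \<in> euclid d" using xy by (auto simp: cube_def euclid_def)
  define z where "z = (\<lambda>i. if i < d then y i + of_int (round (x i - y i)) else y i)"
  have z: "g z = f y" "z \<in> euclid d"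
  proof -
    show "g z = f y"
      unfolding z_def using periodic_extension_shift[of d g y "\<lambda>i. round (x i - y i)", OF g_per eu(2)] g[OF xy(2)] by simp
    show "z \<in> euclid d" using eu by (simp add: z_def euclid_def PiE_iff extensional_def)
  qed
  have coord: "\<bar>x i - z i\<bar> \<le> \<bar>sin (pi * (x i - y i))\<bar>" if "i < d" for i
  proof -
    have "\<bar>x i - z i\<bar> \<le> 1 / 2"
    proof -
      have eq: "x i - z i = - (of_int (round (x i - y i)) - (x i - y i))" using that by (simp add: z_def)
      show ?thesis unfolding eq abs_minus_cancel by (rule of_int_round_abs_le)
    qed
    then have "\<bar>x i - z i\<bar> \<le> \<bar>sin (pi * (x i - z i))\<bar>" using abs_le_half_abs_sin[of "x i - z i"] by linarith
    also have "sin (pi * (x i - z i)) = sin (pi * (x i - y i) - pi * of_int (round (x i - y i)))"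
      using that by (simp add: z_def algebra_simps)
    also have "\<bar>\<dots>\<bar> = \<bar>sin (pi * (x i - y i))\<bar>"
      by (simp add: sin_diff abs_mult mult.commute)
    finally show ?thesis .
  qed
  have L2: "L2_set (\<lambda>i. x i - z i) {..<d} \<le> sqrt (\<Sum>i<d. (sin (pi * (x i - y i)))\<^sup>2)"
    unfolding L2_set_def using coord by (intro real_sqrt_le_mono sum_mono) (simp add: abs_le_square_iff[symmetric])
  show ?thesis
  proof (cases "x = z")
    case True
    then show ?thesis using g[OF xy(1)] z by simp
  next
    case False
    then have "\<exists>i<d. x i \<noteq> z i"
      using eu(1) z(2) PiE_ext[of x "{..<d}" "\<lambda>_. UNIV" z] by (auto simp: euclid_def)
    then have pos: "L2_set (\<lambda>i. x i - z i) {..<d} > 0"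
      by (metis (no_types, lifting) L2_set_nonneg L2_set_eq_0_iff finite_lessThan lessThan_iff
          order.not_eq_order_implies_strict right_minus_eq)
    have "cmod (f x - f y) = cmod (g x - g z)" using g xy z by simp
    also have "\<dots> \<le> L2_set (\<lambda>i. x i - z i) {..<d} powr \<alpha>"
      using holder[OF eu(1) z(2) False] pos by (simp add: field_simps)
    also have "\<dots> \<le> sqrt (\<Sum>i<d. (sin (pi * (x i - y i)))\<^sup>2) powr \<alpha>"
      using L2 pos \<open>0 < \<alpha>\<close> by (intro powr_mono2) auto
    finally show ?thesis .
  qed
qed

text \<open>
  The power \<open>\<alpha>\<close> of the distance is replaced by a bound that is linear in the squared distance,
  because only the integrals of the latter against the kernel are known.
\<close>

lemma sqrt_powr_le_linear:
  fixes S \<delta> \<alpha> :: real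
  assumes "S \<ge> 0" "\<delta> > 0" "0 < \<alpha>" "\<alpha> \<le> 1"
  shows "sqrt S powr \<alpha> \<le> \<delta> powr \<alpha> + \<delta> powr \<alpha> * S / \<delta>\<^sup>2"
proof (cases "sqrt S \<le> \<delta>")
  case True
  then have "sqrt S powr \<alpha> \<le> \<delta> powr \<alpha>" using assms by (intro powr_mono2) auto
  then show ?thesis using assms by (simp add: add_increasing2)
next
  case False
  define r where "r = sqrt S / \<delta>"
  have r: "r \<ge> 1" "sqrt S = \<delta> * r" using False assms by (auto simp: r_def)
  have "r powr \<alpha> \<le> r powr 2" using r assms by (intro powr_mono) auto
  then have "(\<delta> * r) powr \<alpha> \<le> \<delta> powr \<alpha> * r\<^sup>2"
    using assms r by (simp add: powr_mult mult_left_mono)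
  also have "r\<^sup>2 = S / \<delta>\<^sup>2" using assms by (simp add: r_def power_divide)
  finally show ?thesis using r(2) by (simp add: add_increasing)
qed

text \<open>
  The approximant is the Fejer mean. Its coefficients are Fourier coefficients times weights in
  \<open>[0, 1]\<close>. Its error is a kernel average of \<open>f x - f y\<close>, and the condition on \<open>R\<close> makes the part of
  the modulus that is linear in the squared distance contribute at most \<open>\<delta> powr \<alpha>\<close>.
\<close>

lemma fejer_approximation:
  assumes f: "f \<in> F_class \<alpha> d" and \<alpha>: "0 < \<alpha>" "\<alpha> \<le> 1" and \<delta>: "\<delta> > 0"
    and R: "R > 0" "real d \<le> real R * \<delta>\<^sup>2"
  shows "\<exists>a. (\<Sum>k\<in>freq_box d R. cmod (a k)) \<le> 1 \<and>
     (\<forall>x\<in>cube d. cmod (f x - trig_poly d (freq_box d R) a x) \<le> 2 * \<delta> powr \<alpha>)"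
proof -
  define a where "a k = of_real (fejer_weight d R k) * fourier_coeff d f k" for k
  have f_cont: "f \<in> cube_continuous d"
    and f_sum: "(\<lambda>k. cmod (fourier_coeff d f k)) summable_on int_lattice d"
      "(\<Sum>\<^sub>\<infinity>k\<in>int_lattice d. cmod (fourier_coeff d f k)) \<le> 1"
    using f by (auto simp: F_class_def)
  have meas [measurable]: "f \<in> borel_measurable (cube_measure d)"
    using f_cont by (rule cube_continuous_measurable)
  have modulus: "cmod (f x - f y) \<le> \<delta> powr \<alpha> + \<delta> powr \<alpha> / \<delta>\<^sup>2 * (\<Sum>i<d. (sin (pi * (x i - y i)))\<^sup>2)"
    if "x \<in> cube d" "y \<in> cube d" for x y
    using order.trans[OF F_class_modulus[OF f that \<alpha>(1)] sqrt_powr_le_linear[OF _ \<delta> \<alpha>]]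
    by (simp add: sum_nonneg)
  have "(\<Sum>k\<in>freq_box d R. cmod (a k)) \<le> (\<Sum>k\<in>freq_box d R. cmod (fourier_coeff d f k))"
    by (intro sum_mono) (auto simp: a_def norm_mult fejer_weight_bounds intro!: mult_left_le_one_le)
  also have "\<dots> \<le> (\<Sum>\<^sub>\<infinity>k\<in>int_lattice d. cmod (fourier_coeff d f k))"
    using f_sum(1) freq_box_subset by (intro finite_sum_le_infsum) auto
  finally have coeffs: "(\<Sum>k\<in>freq_box d R. cmod (a k)) \<le> 1" using f_sum(2) by simp
  have bounded: "\<exists>B. \<forall>x\<in>cube d. cmod (f x) \<le> B"
  proof -
    define x0 :: "nat \<Rightarrow> real" where "x0 = (\<lambda>i\<in>{..<d}. 0)"
    have x0: "x0 \<in> cube d" by (auto simp: x0_def cube_def)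
    have "cmod (f x) \<le> cmod (f x0) + (\<delta> powr \<alpha> + \<delta> powr \<alpha> / \<delta>\<^sup>2 * real d)" if "x \<in> cube d" for x
    proof -
      have "(\<Sum>i<d. (sin (pi * (x i - x0 i)))\<^sup>2) \<le> (\<Sum>i<d. 1)"
        by (intro sum_mono) (simp add: abs_square_le_1)
      then have "\<delta> powr \<alpha> / \<delta>\<^sup>2 * (\<Sum>i<d. (sin (pi * (x i - x0 i)))\<^sup>2) \<le> \<delta> powr \<alpha> / \<delta>\<^sup>2 * real d"
        by (intro mult_left_mono) auto
      then show ?thesis using modulus[OF that x0] norm_triangle_ineq2[of "f x" "f x0"] by linarith
    qed
    then show ?thesis by blast
  qed
  then obtain B where B: "\<And>x. x \<in> cube d \<Longrightarrow> cmod (f x) \<le> B" by blast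
  have int_fc: "integrable (cube_measure d) (\<lambda>y. f y * cnj (character d k y))" for k
    using B by (intro integrable_cube_bounded[where B = B]) (auto simp: norm_mult)
  have approx: "cmod (f x - trig_poly d (freq_box d R) a x) \<le> 2 * \<delta> powr \<alpha>" if x: "x \<in> cube d" for x
  proof -
    define \<kappa> where "\<kappa> = fejer_kernel d R x"
    have k_int: "integrable (cube_measure d) \<kappa>" "(LINT y|cube_measure d. \<kappa> y) = 1"
      using integral_fejer_kernel[OF R(1)] by (auto simp: \<kappa>_def)
    have prod: "f y * of_real (\<kappa> y) = (\<Sum>k\<in>freq_box d R. of_real (fejer_weight d R k) * character d k x *
          (f y * cnj (character d k y)))" for y
      unfolding \<kappa>_def fejer_kernel_expansion[OF R(1)] sum_distrib_left by (intro sum.cong refl) simp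
    have fk_int: "integrable (cube_measure d) (\<lambda>y. f y * of_real (\<kappa> y))"
      unfolding prod by (intro Bochner_Integration.integrable_sum integrable_mult_right int_fc)
    have "trig_poly d (freq_box d R) a x = (LINT y|cube_measure d. f y * of_real (\<kappa> y))"
      unfolding prod trig_poly_def
      by (subst Bochner_Integration.integral_sum)
         (auto simp: a_def fourier_coeff_eq int_fc intro!: sum.cong integrable_mult_right)
    moreover have "f x = (LINT y|cube_measure d. f x * of_real (\<kappa> y))"
      using k_int by simp
    ultimately have "f x - trig_poly d (freq_box d R) a x = (LINT y|cube_measure d. f x * of_real (\<kappa> y) - f y * of_real (\<kappa> y))"
      using fk_int k_int by (subst Bochner_Integration.integral_diff) auto
    also have "cmod \<dots> \<le> (LINT y|cube_measure d. cmod (f x * of_real (\<kappa> y) - f y * of_real (\<kappa> y)))"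
      by (rule integral_norm_bound)
    also have "\<dots> \<le> (LINT y|cube_measure d. \<delta> powr \<alpha> * \<kappa> y +
        \<delta> powr \<alpha> / \<delta>\<^sup>2 * (\<Sum>i<d. \<kappa> y * (sin (pi * (x i - y i)))\<^sup>2))"
    proof (intro integral_mono)
      show "integrable (cube_measure d) (\<lambda>y. cmod (f x * of_real (\<kappa> y) - f y * of_real (\<kappa> y)))"
        using fk_int k_int by (intro integrable_norm Bochner_Integration.integrable_diff) auto
      show "integrable (cube_measure d) (\<lambda>y. \<delta> powr \<alpha> * \<kappa> y +
        \<delta> powr \<alpha> / \<delta>\<^sup>2 * (\<Sum>i<d. \<kappa> y * (sin (pi * (x i - y i)))\<^sup>2))"
        using k_int integral_fejer_kernel_sin_square[OF R(1)]
        by (intro Bochner_Integration.integrable_add integrable_mult_right Bochner_Integration.integrable_sum)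
           (auto simp: \<kappa>_def)
    next
      fix y assume "y \<in> space (cube_measure d)"
      then have y: "y \<in> cube d" by (simp add: space_cube_measure)
      have "cmod (f x * of_real (\<kappa> y) - f y * of_real (\<kappa> y)) = cmod (f x - f y) * \<kappa> y"
        by (simp add: left_diff_distrib[symmetric] norm_mult \<kappa>_def fejer_kernel_nonneg)
      also have "\<dots> \<le> (\<delta> powr \<alpha> + \<delta> powr \<alpha> / \<delta>\<^sup>2 * (\<Sum>i<d. (sin (pi * (x i - y i)))\<^sup>2)) * \<kappa> y"
        using modulus[OF x y] by (intro mult_right_mono) (auto simp: \<kappa>_def fejer_kernel_nonneg)
      also have "\<dots> = \<delta> powr \<alpha> * \<kappa> y + \<delta> powr \<alpha> / \<delta>\<^sup>2 * (\<Sum>i<d. \<kappa> y * (sin (pi * (x i - y i)))\<^sup>2)"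
        by (simp add: distrib_left distrib_right sum_distrib_left mult_ac)
      finally show "cmod (f x * of_real (\<kappa> y) - f y * of_real (\<kappa> y)) \<le> \<dots>" .
    qed
    also have "\<dots> = \<delta> powr \<alpha> + \<delta> powr \<alpha> / \<delta>\<^sup>2 * (\<Sum>i<d. 1 / (2 * real R))"
    proof -
      define c where "c = \<delta> powr \<alpha> / \<delta>\<^sup>2"
      define D where "D = (\<lambda>y. \<Sum>i<d. \<kappa> y * (sin (pi * (x i - y i)))\<^sup>2)"
      have D: "integrable (cube_measure d) D" "(LINT y|cube_measure d. D y) = (\<Sum>i<d. 1 / (2 * real R))"
        unfolding D_def \<kappa>_def using integral_fejer_kernel_sin_square[OF R(1), of _ d x]
        by (auto simp: Bochner_Integration.integral_sum)
      have "(LINT y|cube_measure d. \<delta> powr \<alpha> * \<kappa> y + c * D y) = \<delta> powr \<alpha> + c * (\<Sum>i<d. 1 / (2 * real R))"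
        using k_int D by (subst Bochner_Integration.integral_add) auto
      then show ?thesis by (simp only: c_def D_def)
    qed
    also have "\<dots> = \<delta> powr \<alpha> * (1 + real d / (2 * real R * \<delta>\<^sup>2))"
      using \<delta> R by (simp add: field_simps)
    also have "\<dots> \<le> \<delta> powr \<alpha> * 2"
      using R \<delta> by (intro mult_left_mono) (auto simp: divide_le_eq_1)
    finally show ?thesis by (simp add: mult.commute)
  qed
  show ?thesis using coeffs approx by blast
qed

section \<open>Sparse uniform approximation\<close>

lemma cis_diff_le: "cmod (cis a - cis b) \<le> \<bar>a - b\<bar>"
proof -
  have "cis a - cis b = cis b * (exp (\<i> * of_real (a - b)) - 1)"
    by (simp add: right_diff_distrib cis_conv_exp exp_diff[symmetric] exp_add[symmetric] algebra_simps)
  then have "cmod (cis a - cis b) = 2 * \<bar>sin ((a - b) / 2)\<bar>"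
    using dist_exp_i_1[of "a - b"] by (simp add: norm_mult)
  also have "\<dots> \<le> 2 * \<bar>(a - b) / 2\<bar>" using abs_sin_x_le_abs_x[of "(a - b) / 2"] by (intro mult_left_mono) simp_all
  finally show ?thesis by simp
qed

lemma character_lipschitz:
  assumes "k \<in> freq_box d R" "\<And>i. i < d \<Longrightarrow> \<bar>x i - y i\<bar> \<le> h"
  shows "cmod (character d k x - character d k y) \<le> 2 * pi * real R * real d * h"
proof -
  have "cmod (character d k x - character d k y) \<le>
      \<bar>2 * pi * (\<Sum>i<d. of_int (k i) * x i) - 2 * pi * (\<Sum>i<d. of_int (k i) * y i)\<bar>"
    unfolding character_def by (rule cis_diff_le)
  also have "\<dots> = 2 * pi * \<bar>\<Sum>i<d. of_int (k i) * (x i - y i)\<bar>"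
    by (simp add: right_diff_distrib[symmetric] abs_mult sum_subtractf[symmetric])
  also have "\<dots> \<le> 2 * pi * (\<Sum>i<d. real R * h)"
  proof (intro mult_left_mono order.trans[OF sum_abs] sum_mono)
    fix i assume "i \<in> {..<d}"
    then have "\<bar>k i\<bar> < int R" "\<bar>x i - y i\<bar> \<le> h" using assms by (auto simp: freq_box_def PiE_iff abs_less_iff minus_less_iff)
    then show "\<bar>of_int (k i) * (x i - y i)\<bar> \<le> real R * h"
      unfolding abs_mult by (intro mult_mono) auto
  qed auto
  finally show ?thesis by (simp add: mult_ac)
qed

type_synonym atom = "((nat \<Rightarrow> int) \<times> nat) option"

text \<open>
  An atom is a character with one of the four phases \<open>\<i> ^ c\<close>. The zero atom \<open>None\<close> absorbs the weight
  that is missing to 1.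
\<close>

definition atoms :: "nat \<Rightarrow> nat \<Rightarrow> atom set" where
  "atoms d R = insert None (Some ` (freq_box d R \<times> {..<4}))"

fun atom_fun :: "nat \<Rightarrow> atom \<Rightarrow> (nat \<Rightarrow> real) \<Rightarrow> complex" where
  "atom_fun d None x = 0"
| "atom_fun d (Some (k, c)) x = \<i> ^ c * character d k x"

text \<open>
  The factor 2 makes up for the factor \<open>1 / 2\<close> in \<open>atom_weight\<close>, which keeps the sum of the weights of
  real and imaginary parts below the absolute value of the coefficient.
\<close>

definition sparse_poly :: "nat \<Rightarrow> nat \<Rightarrow> (nat \<Rightarrow> atom) \<Rightarrow> (nat \<Rightarrow> real) \<Rightarrow> complex" where
  "sparse_poly d K s x = 2 / of_nat K * (\<Sum>t<K. atom_fun d (s t) x)"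

lemma finite_atoms [simp]: "finite (atoms d R)"
  by (simp add: atoms_def)

lemma card_atoms_le:
  assumes "R > 0"
  shows "real (card (atoms d R)) \<le> 5 * (2 * real R) ^ d"
proof -
  have "nat (2 * int R - 1) = 2 * R - 1" by linarith
  then have "card (freq_box d R) = (2 * R - 1) ^ d"
    unfolding freq_box_def by (subst card_PiE) auto
  then have "card (atoms d R) \<le> Suc ((2 * R - 1) ^ d * 4)"
    unfolding atoms_def using card_image_le[of "freq_box d R \<times> {..<4::nat}" Some]
    by (intro order.trans[OF card_insert_le_m1]) (auto simp: card_cartesian_product)
  also have "\<dots> \<le> (2 * R) ^ d + (2 * R) ^ d * 4"
  proof -
    have "(2 * R - 1) ^ d \<le> (2 * R) ^ d" by (intro power_mono) auto
    moreover have "1 \<le> (2 * R) ^ d" using assms by (intro one_le_power) auto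
    ultimately show ?thesis by linarith
  qed
  also have "\<dots> = 5 * (2 * R) ^ d" by simp
  finally have "card (atoms d R) \<le> 5 * (2 * R) ^ d" .
  then have "real (card (atoms d R)) \<le> real (5 * (2 * R) ^ d)" by (rule of_nat_mono)
  then show ?thesis by simp
qed

lemma norm_atom_fun_le: "cmod (atom_fun d u x) \<le> 1"
  by (cases "(d, u, x)" rule: atom_fun.cases) (auto simp: norm_mult norm_power)

lemma atom_fun_measurable [measurable]: "atom_fun d u \<in> borel_measurable (cube_measure d)"
proof (cases u)
  case None
  then have "atom_fun d u = (\<lambda>x. 0)" by auto
  then show ?thesis by simp
next
  case (Some kc)
  obtain k c where "kc = (k, c)" by force
  then have "atom_fun d u = (\<lambda>x. \<i> ^ c * character d k x)" using Some by auto
  then show ?thesis by simp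
qed

lemma sparse_poly_measurable [measurable]: "sparse_poly d K s \<in> borel_measurable (cube_measure d)"
  unfolding sparse_poly_def by measurable

lemma atom_fun_lipschitz:
  assumes "u \<in> atoms d R" "\<And>i. i < d \<Longrightarrow> \<bar>x i - y i\<bar> \<le> h" "h \<ge> 0"
  shows "cmod (atom_fun d u x - atom_fun d u y) \<le> 2 * pi * real R * real d * h"
proof (cases u)
  case (Some kc)
  then obtain k c where kc: "u = Some (k, c)" "k \<in> freq_box d R" using assms(1) by (auto simp: atoms_def)
  have "cmod (atom_fun d u x - atom_fun d u y) = cmod (character d k x - character d k y)"
    unfolding kc by (simp add: right_diff_distrib[symmetric] norm_mult norm_power)
  then show ?thesis using character_lipschitz[OF kc(2) assms(2)] by simp
qed (use assms in auto)

definition cube_grid :: "nat \<Rightarrow> nat \<Rightarrow> (nat \<Rightarrow> real) set" where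
  "cube_grid d m = {..<d} \<rightarrow>\<^sub>E (\<lambda>j. real j / real m) ` {..m}"

lemma finite_cube_grid [simp]: "finite (cube_grid d m)"
  by (simp add: cube_grid_def finite_PiE)

lemma card_cube_grid_le: "card (cube_grid d m) \<le> (m + 1) ^ d"
proof -
  have "card ((\<lambda>j. real j / real m) ` {..m}) \<le> m + 1"
    by (rule order.trans[OF card_image_le]) auto
  then show ?thesis by (simp add: cube_grid_def card_PiE power_mono)
qed

lemma cube_grid_dense:
  assumes "x \<in> cube d" "m > 0"
  shows "\<exists>y\<in>cube_grid d m. \<forall>i<d. \<bar>x i - y i\<bar> \<le> 1 / real m"
proof (intro bexI allI impI)
  let ?y = "\<lambda>i\<in>{..<d}. real (nat \<lfloor>real m * x i\<rfloor>) / real m"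
  have x: "0 \<le> x i" "x i \<le> 1" if "i < d" for i using assms(1) that by (auto simp: cube_def PiE_iff)
  show "?y \<in> cube_grid d m"
    unfolding cube_grid_def
  proof (intro restrict_PiE_iff[THEN iffD2] ballI imageI)
    fix i assume "i \<in> {..<d}"
    then have "real m * x i \<le> real m" using x(2)[of i] by (simp add: mult_left_le)
    then show "nat \<lfloor>real m * x i\<rfloor> \<in> {..m}" by (simp add: nat_le_iff floor_le_iff)
  qed
  fix i assume i: "i < d"
  have "real (nat \<lfloor>real m * x i\<rfloor>) = of_int \<lfloor>real m * x i\<rfloor>" using x(1)[OF i] by simp
  then have "\<bar>real m * x i - real (nat \<lfloor>real m * x i\<rfloor>)\<bar> \<le> 1" by linarith
  moreover have "x i - ?y i = (real m * x i - real (nat \<lfloor>real m * x i\<rfloor>)) / real m"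
    using i assms(2) by (simp add: field_simps)
  ultimately show "\<bar>x i - ?y i\<bar> \<le> 1 / real m" using assms(2) by (simp add: divide_right_mono)
qed

definition atom_weight :: "((nat \<Rightarrow> int) \<Rightarrow> complex) \<Rightarrow> (nat \<Rightarrow> int) \<Rightarrow> nat \<Rightarrow> real" where
  "atom_weight a k c = max 0 ([Re (a k), Im (a k), - Re (a k), - Im (a k)] ! c) / 2"

lemma sum_lessThan_4: "(\<Sum>c<4::nat. h c) = h 0 + h 1 + h 2 + (h 3 :: 'a :: comm_monoid_add)"
  by (simp add: eval_nat_numeral add.assoc)

lemma atom_weight_nonneg: "atom_weight a k c \<ge> 0"
  by (simp add: atom_weight_def)

lemma sum_atom_weight_le: "(\<Sum>c<4. atom_weight a k c) \<le> cmod (a k)"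
proof -
  have "(\<Sum>c<4. atom_weight a k c) = (\<bar>Re (a k)\<bar> + \<bar>Im (a k)\<bar>) / 2"
    unfolding sum_lessThan_4 by (simp add: atom_weight_def numeral_2_eq_2 numeral_3_eq_3 max_def)
  also have "\<dots> \<le> cmod (a k)" using add_mono[OF abs_Re_le_cmod[of "a k"] abs_Im_le_cmod[of "a k"]] by simp
  finally show ?thesis .
qed

lemma sum_atom_weight_phase: "(\<Sum>c<4. of_real (atom_weight a k c) * \<i> ^ c) = a k / 2"
  unfolding sum_lessThan_4
  by (auto simp: atom_weight_def numeral_2_eq_2 numeral_3_eq_3 max_def complex_eq_iff)

lemma trig_poly_lipschitz:
  assumes "(\<Sum>k\<in>freq_box d R. cmod (a k)) \<le> 1" "\<And>i. i < d \<Longrightarrow> \<bar>x i - y i\<bar> \<le> h" "h \<ge> 0"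
  shows "cmod (trig_poly d (freq_box d R) a x - trig_poly d (freq_box d R) a y) \<le> 2 * pi * real R * real d * h"
proof -
  let ?L = "2 * pi * real R * real d * h"
  have "cmod (trig_poly d (freq_box d R) a x - trig_poly d (freq_box d R) a y) =
      cmod (\<Sum>k\<in>freq_box d R. a k * (character d k x - character d k y))"
    by (simp add: trig_poly_def sum_subtractf[symmetric] right_diff_distrib)
  also have "\<dots> \<le> (\<Sum>k\<in>freq_box d R. cmod (a k) * ?L)"
    using character_lipschitz assms(2)
    by (intro order.trans[OF norm_sum] sum_mono) (auto simp: norm_mult intro!: mult_left_mono)
  also have "\<dots> = (\<Sum>k\<in>freq_box d R. cmod (a k)) * ?L" by (simp add: sum_distrib_right)
  also have "\<dots> \<le> 1 * ?L" using assms by (intro mult_right_mono) auto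
  finally show ?thesis by simp
qed

lemma sparse_poly_lipschitz:
  assumes "s ` {..<K} \<subseteq> atoms d R" "\<And>i. i < d \<Longrightarrow> \<bar>x i - y i\<bar> \<le> h" "h \<ge> 0" "K > 0"
  shows "cmod (sparse_poly d K s x - sparse_poly d K s y) \<le> 2 * (2 * pi * real R * real d * h)"
proof -
  let ?L = "2 * pi * real R * real d * h"
  have "sparse_poly d K s x - sparse_poly d K s y =
      2 / of_nat K * (\<Sum>t<K. atom_fun d (s t) x - atom_fun d (s t) y)"
    by (simp only: sparse_poly_def right_diff_distrib sum_subtractf)
  then have "cmod (sparse_poly d K s x - sparse_poly d K s y) =
      2 / real K * cmod (\<Sum>t<K. atom_fun d (s t) x - atom_fun d (s t) y)"
    by (simp only: norm_mult norm_divide norm_numeral norm_of_nat)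
  also have "\<dots> \<le> 2 / real K * (\<Sum>t<K. ?L)"
    using assms by (intro mult_left_mono order.trans[OF norm_sum] sum_mono atom_fun_lipschitz) auto
  finally show ?thesis using \<open>K > 0\<close> by simp
qed

text \<open>
  The polynomial is twice the mean of the atoms under the weights \<open>atom_weight\<close>. The empirical method
  is applied to real and imaginary parts at the points of a grid, and the Lipschitz bounds, at most
  \<open>l / 48\<close> for \<open>a\<close> and twice this for the average, carry the approximation from the grid to the cube.
\<close>

lemma sparse_approximation:
  assumes a: "(\<Sum>k\<in>freq_box d R. cmod (a k)) \<le> 1"
    and l: "0 < l" "l \<le> 1" and m: "m > 0" "96 * pi * real R * real d \<le> l * real m"
    and K: "4 * (real m + 1) ^ d < exp (real K * (l / 64)\<^sup>2 / 16)"
  shows "\<exists>s. s ` {..<K} \<subseteq> atoms d R \<and>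
    (\<forall>x\<in>cube d. cmod (trig_poly d (freq_box d R) a x - sparse_poly d K s x) \<le> l / 8)"
proof -
  define B where "B = freq_box d R"
  define w :: "atom \<Rightarrow> real" where "w u = (case u of None \<Rightarrow> 1 - (\<Sum>k\<in>B. \<Sum>c<4. atom_weight a k c)
      | Some (k, c) \<Rightarrow> atom_weight a k c)" for u
  have sum_atoms: "(\<Sum>u\<in>atoms d R. h u) = h None + (\<Sum>k\<in>B. \<Sum>c<4. h (Some (k, c)))"
    for h :: "atom \<Rightarrow> 'b :: comm_monoid_add"
    unfolding atoms_def B_def
    by (subst sum.insert) (auto simp: sum.reindex sum.cartesian_product)
  have tot: "(\<Sum>k\<in>B. \<Sum>c<4. atom_weight a k c) \<le> 1"
  proof -
    have "(\<Sum>k\<in>B. \<Sum>c<4. atom_weight a k c) \<le> (\<Sum>k\<in>B. cmod (a k))"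
      by (intro sum_mono sum_atom_weight_le)
    then show ?thesis using a by (simp add: B_def)
  qed
  have w0: "w u \<ge> 0" for u
    using tot by (auto simp: w_def atom_weight_nonneg split: option.splits)
  have w1: "sum w (atoms d R) = 1"
    unfolding sum_atoms by (simp add: w_def)
  have mean: "(\<Sum>u\<in>atoms d R. of_real (w u) * atom_fun d u x) = trig_poly d (freq_box d R) a x / 2" for x
  proof -
    have "(\<Sum>u\<in>atoms d R. of_real (w u) * atom_fun d u x) =
        (\<Sum>k\<in>B. (\<Sum>c<4. of_real (atom_weight a k c) * \<i> ^ c) * character d k x)"
      unfolding sum_atoms by (simp add: w_def sum_distrib_right mult.assoc)
    then show ?thesis by (simp add: sum_atom_weight_phase trig_poly_def B_def sum_divide_distrib)
  qed
  define v where "v u p = (if snd p then Re (atom_fun d u (fst p)) else Im (atom_fun d u (fst p)))"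
    for u :: atom and p :: "(nat \<Rightarrow> real) \<times> bool"
  define J where "J = cube_grid d m \<times> (UNIV :: bool set)"
  have "real (card J) \<le> real ((m + 1) ^ d * 2)"
    unfolding J_def card_cartesian_product using card_cube_grid_le[of d m] by (intro of_nat_mono) simp
  then have "2 * real (card J) < exp (real K * (l / 64)\<^sup>2 / 16)"
    using K by (simp add: add.commute)
  moreover have "\<bar>v u p\<bar> \<le> 1" for u p
    using abs_Re_le_cmod abs_Im_le_cmod norm_atom_fun_le order.trans unfolding v_def by (auto split: if_splits) blast+
  ultimately obtain s where s: "s ` {..<K} \<subseteq> atoms d R"
    and close: "\<And>p. p \<in> J \<Longrightarrow> \<bar>(\<Sum>t<K. v (s t) p) / real K - (\<Sum>u\<in>atoms d R. w u * v u p)\<bar> \<le> l / 64"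
    using empirical_average_close[of "atoms d R" w J v "l / 64" K] w0 w1 l
    by (auto simp: J_def)
  have "K > 0"
  proof (rule ccontr)
    assume "\<not> K > 0"
    then have "4 * (real m + 1) ^ d < 1" using K by simp
    moreover have "(real m + 1) ^ d \<ge> 1" by (intro one_le_power) auto
    ultimately show False by simp
  qed
  have grid: "cmod (trig_poly d (freq_box d R) a y - sparse_poly d K s y) \<le> l / 16" if y: "y \<in> cube_grid d m" for y
  proof -
    define D where "D = (\<Sum>t<K. atom_fun d (s t) y) / of_nat K - trig_poly d (freq_box d R) a y / 2"
    have "\<bar>Re D\<bar> \<le> l / 64"
    proof -
      have eq: "(\<Sum>u\<in>atoms d R. w u * Re (atom_fun d u y)) = Re (trig_poly d (freq_box d R) a y) / 2"
        using arg_cong[OF mean[of y], of Re] by simp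
      have cl: "\<bar>(\<Sum>t<K. Re (atom_fun d (s t) y)) / real K -
          (\<Sum>u\<in>atoms d R. w u * Re (atom_fun d u y))\<bar> \<le> l / 64"
        using close[of "(y, True)"] y by (simp add: v_def J_def)
      have "Re D = (\<Sum>t<K. Re (atom_fun d (s t) y)) / real K - (\<Sum>u\<in>atoms d R. w u * Re (atom_fun d u y))"
        unfolding eq by (simp add: D_def)
      then show ?thesis using cl by (simp only:)
    qed
    moreover have "\<bar>Im D\<bar> \<le> l / 64"
    proof -
      have eq: "(\<Sum>u\<in>atoms d R. w u * Im (atom_fun d u y)) = Im (trig_poly d (freq_box d R) a y) / 2"
        using arg_cong[OF mean[of y], of Im] by simp
      have cl: "\<bar>(\<Sum>t<K. Im (atom_fun d (s t) y)) / real K -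
          (\<Sum>u\<in>atoms d R. w u * Im (atom_fun d u y))\<bar> \<le> l / 64"
        using close[of "(y, False)"] y by (simp add: v_def J_def)
      have "Im D = (\<Sum>t<K. Im (atom_fun d (s t) y)) / real K - (\<Sum>u\<in>atoms d R. w u * Im (atom_fun d u y))"
        unfolding eq by (simp add: D_def)
      then show ?thesis using cl by (simp only:)
    qed
    ultimately have "cmod D \<le> l / 32" using cmod_le[of D] by simp
    moreover have "trig_poly d (freq_box d R) a y - sparse_poly d K s y = - 2 * D"
      by (simp add: D_def sparse_poly_def)
    ultimately show ?thesis by (simp add: norm_mult)
  qed
  have "cmod (trig_poly d (freq_box d R) a x - sparse_poly d K s x) \<le> l / 8" if x: "x \<in> cube d" for x
  proof -
    obtain y where y: "y \<in> cube_grid d m" "\<And>i. i < d \<Longrightarrow> \<bar>x i - y i\<bar> \<le> 1 / real m"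
      using cube_grid_dense[OF x m(1)] by blast
    let ?L = "2 * pi * real R * real d * (1 / real m)"
    let ?p = "trig_poly d (freq_box d R) a" and ?q = "sparse_poly d K s"
    have "?L \<le> l / 48" using m by (simp add: field_simps)
    moreover have "cmod (?p x - ?p y) \<le> ?L" using y by (intro trig_poly_lipschitz a) auto
    moreover have "cmod (?q x - ?q y) \<le> 2 * ?L" using y \<open>K > 0\<close> by (intro sparse_poly_lipschitz s) auto
    moreover have "cmod (?p x - ?q x) \<le> cmod (?p x - ?p y) + cmod (?p y - ?q y) + cmod (?q x - ?q y)"
      using norm_triangle_ineq[of "?p x - ?p y + (?p y - ?q y)" "- (?q x - ?q y)"]
        norm_triangle_ineq[of "?p x - ?p y" "?p y - ?q y"]
      by (simp add: algebra_simps norm_minus_commute)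
    ultimately show ?thesis using grid[OF y(1)] l by linarith
  qed
  then show ?thesis using s by blast
qed

section \<open>Sampling points\<close>

text \<open>
  If sets of measure at least \<open>\<nu>\<close> are still to be hit, the expected number of them that contain a
  random point is at least the fraction \<open>\<nu>\<close>, so some point hits this fraction. Each point
  therefore reduces the number of missed sets by the factor \<open>1 - \<nu>\<close>.
\<close>

lemma (in prob_space) hitting_points:
  assumes S: "finite S" and G: "\<And>i. i \<in> S \<Longrightarrow> G i \<in> sets M" "\<And>i. i \<in> S \<Longrightarrow> \<nu> \<le> measure M (G i)"
    and n: "\<nu> \<le> 1" "real (card S) * (1 - \<nu>) ^ n < 1"
  shows "\<exists>xs. length xs = n \<and> set xs \<subseteq> space M \<and> (\<forall>i\<in>S. set xs \<inter> G i \<noteq> {})"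
proof -
  have "\<exists>xs. length xs = k \<and> set xs \<subseteq> space M \<and>
      real (card {i\<in>S. set xs \<inter> G i = {}}) \<le> real (card S) * (1 - \<nu>) ^ k" for k
  proof (induction k)
    case 0
    then show ?case by (intro exI[of _ "[]"]) simp
  next
    case (Suc k)
    then obtain xs where xs: "length xs = k" "set xs \<subseteq> space M"
      "real (card {i\<in>S. set xs \<inter> G i = {}}) \<le> real (card S) * (1 - \<nu>) ^ k" by blast
    define T where "T = {i\<in>S. set xs \<inter> G i = {}}"
    have T: "finite T" "T \<subseteq> S" using S by (auto simp: T_def)
    define N where "N x = (\<Sum>i\<in>T. indicator (G i) x :: real)" for x
    have N_int: "integrable M N"
      unfolding N_def using T G by (intro Bochner_Integration.integrable_sum integrable_real_indicator) (auto simp: emeasure_eq_measure)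
    have "expectation N = (\<Sum>i\<in>T. measure M (G i))"
      unfolding N_def using T G by (subst Bochner_Integration.integral_sum) (auto simp: emeasure_eq_measure sets.Int_space_eq2 intro!: sum.cong)
    also have "\<dots> \<ge> (\<Sum>i\<in>T. \<nu>)" using T G by (intro sum_mono) auto
    finally have E: "expectation N \<ge> \<nu> * real (card T)" by (simp add: mult.commute)
    have "\<exists>x\<in>space M. N x \<ge> \<nu> * real (card T)"
    proof (rule ccontr)
      assume "\<not> ?thesis"
      then have "expectation N < \<nu> * real (card T)" using N_int by (intro expectation_less) (auto simp: not_le)
      then show False using E by simp
    qed
    then obtain x where x: "x \<in> space M" "N x \<ge> \<nu> * real (card T)" by blast
    have "N x = real (card {i\<in>T. x \<in> G i})"
      unfolding N_def using T by (simp add: indicator_def sum.If_cases Int_def)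
    moreover have "card {i\<in>T. x \<in> G i} + card {i\<in>T. x \<notin> G i} = card T"
      using T by (subst card_Un_disjoint[symmetric]) (auto intro!: arg_cong[where f = card])
    moreover have "{i\<in>S. set (x # xs) \<inter> G i = {}} = {i\<in>T. x \<notin> G i}" by (auto simp: T_def)
    ultimately have "real (card {i\<in>S. set (x # xs) \<inter> G i = {}}) \<le> real (card T) * (1 - \<nu>)"
      using x(2) by (simp add: algebra_simps flip: of_nat_add)
    also have "\<dots> \<le> real (card S) * (1 - \<nu>) ^ k * (1 - \<nu>)"
      using xs(3) n(1) unfolding T_def by (intro mult_right_mono) auto
    finally show ?case using xs x by (intro exI[of _ "x # xs"]) (simp add: mult_ac)
  qed
  from this[of n] obtain xs where xs: "length xs = n" "set xs \<subseteq> space M"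
    "real (card {i\<in>S. set xs \<inter> G i = {}}) < 1" using n(2) by (auto intro: le_less_trans)
  then have "{i\<in>S. set xs \<inter> G i = {}} = {}" using S by simp
  then show ?thesis using xs by blast
qed

lemma F_class_measurable:
  "f \<in> F_class \<alpha> d \<Longrightarrow> f \<in> borel_measurable (cube_measure d)"
  by (intro cube_continuous_measurable) (simp add: F_class_def)

definition resolves :: "real \<Rightarrow> nat \<Rightarrow> (nat \<Rightarrow> real) list \<Rightarrow> real \<Rightarrow> real \<Rightarrow> bool" where
  "resolves \<alpha> d xs l \<nu> \<longleftrightarrow>
     (\<forall>f\<in>F_class \<alpha> d. \<forall>g\<in>F_class \<alpha> d. map f xs = map g xs \<longrightarrow>
        measure (cube_measure d) {x\<in>cube d. l < cmod (f x - g x)} \<le> \<nu>)"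

lemma resolves_mono: "resolves \<alpha> d xs l \<nu> \<Longrightarrow> set xs \<subseteq> set ys \<Longrightarrow> resolves \<alpha> d ys l \<nu>"
  unfolding resolves_def map_eq_conv by blast

text \<open>
  The points hit every set of measure at least \<open>\<nu>\<close> on which two sparse polynomials differ by more
  than \<open>5 * l / 8\<close>. Such polynomials within \<open>3 * l / 16\<close> of \<open>f\<close> and \<open>g\<close> differ by at most \<open>3 * l / 8\<close>
  where \<open>f\<close> and \<open>g\<close> agree, and by more than \<open>5 * l / 8\<close> where \<open>\<bar>f - g\<bar> > l\<close>. A sparse polynomial has
  \<open>K\<close> atoms with \<open>K\<close> of order \<open>d * L / l^2\<close>, each chosen among \<open>exp (O (d * L))\<close> many; this explains
  the square of \<open>d * L\<close> in the bound.
\<close>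

lemma sampling_level:
  assumes \<alpha>: "0 < \<alpha>" "\<alpha> \<le> 1"
  shows "\<exists>C>0. \<forall>d l \<nu>. 1 \<le> d \<longrightarrow> 0 < l \<longrightarrow> l \<le> 1 \<longrightarrow> 0 < \<nu> \<longrightarrow>
    (\<exists>xs. set xs \<subseteq> cube d \<and>
       real (length xs) \<le> C * (real d)\<^sup>2 * (1 + ln (real d) + ln (1 / l))\<^sup>2 / (l\<^sup>2 * \<nu>) \<and>
       resolves \<alpha> d xs l \<nu>)"
proof -
  have ln2: "ln (2 ^ n) \<le> real n" for n :: nat
    using ln_2_less_1 by (simp add: ln_realpow mult_left_le)
  define A where "A = 3 + 10 / \<alpha>"
  have A: "A \<ge> 3" using \<alpha> by (simp add: A_def)
  define A2 where "A2 = 65537 * (A + 12)"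
  have A2: "A2 > 0" using A by (simp add: A2_def)
  define C where "C = 2 * A2 * (A + 3) + 1"
  have C: "C > 0" using A A2 by (simp add: C_def add_pos_pos)
  show ?thesis
  proof (intro exI[of _ C] conjI allI impI C)
    fix d :: nat and l \<nu> :: real
    assume d: "1 \<le> d" and l: "0 < l" "l \<le> 1" and \<nu>: "0 < \<nu>"
    define L where "L = 1 + ln (real d) + ln (1 / l)"
    have lnd: "0 \<le> ln (real d)" and lnl: "0 \<le> ln (1 / l)" using d l by auto
    have L: "1 \<le> L" using lnd lnl by (simp add: L_def)
    interpret prob_space "cube_measure d" by (rule prob_space_cube_measure)
    show "\<exists>xs. set xs \<subseteq> cube d \<and>
       real (length xs) \<le> C * (real d)\<^sup>2 * (1 + ln (real d) + ln (1 / l))\<^sup>2 / (l\<^sup>2 * \<nu>) \<and>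
       resolves \<alpha> d xs l \<nu>"
    proof (cases "\<nu> \<ge> 1")
      case True
      then have "measure (cube_measure d) S \<le> \<nu>" for S using prob_le_1[of S] by linarith
      then show ?thesis using C \<nu> by (intro exI[of _ "[]"]) (auto simp: resolves_def)
    next
      case False
      \<comment> \<open>the Fejer mean shall have error \<open>l / 16\<close>\<close>
      define \<delta> where "\<delta> = (l / 32) powr (1 / \<alpha>)"
      have \<delta>: "\<delta> > 0" using l by (simp add: \<delta>_def)
      have \<delta>\<alpha>: "2 * \<delta> powr \<alpha> = l / 16" using \<alpha> l by (simp add: \<delta>_def powr_powr)
      define r where "r = real d * (32 / l) powr (2 / \<alpha>)"
      have "(32 / l) powr (2 / \<alpha>) \<ge> 1" using l \<alpha> by (intro ge_one_powr_ge_zero) auto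
      then have r: "r \<ge> 1" using d mult_mono[of 1 "real d" 1 "(32 / l) powr (2 / \<alpha>)"] by (simp add: r_def)
      have r\<delta>: "r * \<delta>\<^sup>2 = real d"
      proof -
        have "\<delta>\<^sup>2 = (l / 32) powr (2 / \<alpha>)"
          by (simp add: \<delta>_def power2_eq_square flip: powr_add)
        also have "\<dots> = 1 / (32 / l) powr (2 / \<alpha>)"
          using l by (simp add: powr_divide)
        finally show ?thesis using l by (simp add: r_def)
      qed
      define R where "R = nat \<lceil>r\<rceil>"
      have R: "r \<le> real R" "real R \<le> 2 * r" "R > 0"
        using r by (auto simp: R_def) linarith+
      have Rd: "real d \<le> real R * \<delta>\<^sup>2"
        using R(1) r\<delta> mult_right_mono[of r "real R" "\<delta>\<^sup>2"] by simp
      have ln2R: "ln (2 * real R) \<le> A * L"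
      proof -
        have "ln (2 * real R) \<le> ln (4 * r)" using R by (subst ln_le_cancel_iff) auto
        also have "\<dots> = ln 4 + (ln (real d) + (2 / \<alpha>) * ln (32 / l))"
          using r l d by (simp add: r_def ln_mult ln_powr)
        also have "ln (32 / l) = ln 32 + ln (1 / l)" using l by (simp add: ln_div)
        also have "ln (32::real) \<le> 5" using ln2[of 5] by simp
        also have "ln (4::real) \<le> 2" using ln2[of 2] by simp
        finally have "ln (2 * real R) \<le> 2 + (ln (real d) + (2 / \<alpha>) * (5 + ln (1 / l)))"
          using \<alpha> by (simp add: divide_right_mono)
        also have "\<dots> \<le> 2 * L + (L + (2 / \<alpha>) * (5 * L))"
          using L lnd lnl \<alpha> by (intro add_mono mult_left_mono) (auto simp: L_def)
        also have "\<dots> = A * L" by (simp add: A_def algebra_simps)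
        finally show ?thesis .
      qed
      define m where "m = nat \<lceil>384 * real R * real d / l\<rceil>"
      define Q where "Q = real R * real d / l"
      have Q: "Q \<ge> 1"
      proof -
        have "1 * 1 \<le> real R * real d" using R(3) d by (intro mult_mono) auto
        then show ?thesis using l by (simp add: Q_def)
      qed
      have m: "384 * Q \<le> real m" "real m + 1 \<le> 386 * Q" "m > 0"
        using Q by (auto simp: m_def Q_def) linarith+
      have m2: "96 * pi * real R * real d \<le> l * real m"
      proof -
        have "96 * pi * (real R * real d) \<le> 384 * (real R * real d)"
          using pi_less_4 by (intro mult_right_mono) auto
        also have "\<dots> = l * (384 * Q)" using l by (simp add: Q_def)
        also have "\<dots> \<le> l * real m" using m l by (intro mult_left_mono) auto
        finally show ?thesis by (simp add: mult.assoc)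
      qed
      have lnm: "ln (real m + 1) \<le> (A + 10) * L"
      proof -
        have "ln (real m + 1) \<le> ln (386 * Q)" using m by (subst ln_le_cancel_iff) auto
        also have "\<dots> = ln 386 + (ln (real R) + ln (real d) + ln (1 / l))"
          using R(3) d l Q by (simp add: Q_def ln_mult ln_div)
        also have "ln (real R) \<le> ln (2 * real R)" using R(3) by (subst ln_le_cancel_iff) auto
        also have "ln (386::real) \<le> ln (2 ^ 9)" by (subst ln_le_cancel_iff) auto
        also have "\<dots> \<le> 9" using ln2[of 9] by simp
        finally have "ln (real m + 1) \<le> 9 + (A * L + ln (real d) + ln (1 / l))"
          using ln2R by linarith
        also have "\<dots> \<le> 9 * L + (A * L + L)" using L by (simp add: L_def)
        finally show ?thesis by (simp add: algebra_simps)
      qed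
      define Y where "Y = real d * ((A + 12) * L)"
      define K where "K = nat \<lfloor>65536 * Y / l\<^sup>2\<rfloor> + 1"
      have dL: "1 \<le> real d * L" using d L mult_mono[of 1 "real d" 1 L] by simp
      have Y: "Y \<ge> 1" using dL A mult_mono[of 1 "A + 12" 1 "real d * L"] by (simp add: Y_def mult_ac)
      have K1: "65536 * Y / l\<^sup>2 < real K"
        using Y l by (simp add: K_def) linarith
      have K2: "real K \<le> A2 * real d * L / l\<^sup>2"
      proof -
        have "1 \<le> Y / l\<^sup>2" using Y l by (simp add: power_le_one order.trans[OF power_le_one])
        moreover have "real K \<le> 65536 * (Y / l\<^sup>2) + 1" using Y l by (simp add: K_def)
        ultimately have "real K \<le> 65537 * (Y / l\<^sup>2)" by linarith
        then show ?thesis by (simp add: Y_def A2_def mult_ac)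
      qed
      have K3: "4 * (real m + 1) ^ d < exp (real K * (l / 64)\<^sup>2 / 16)"
      proof -
        have "4 * (real m + 1) ^ d = exp (ln 4 + real d * ln (real m + 1))"
          by (simp add: exp_add exp_of_nat_mult)
        also have "\<dots> \<le> exp Y"
        proof -
          have "ln 4 + real d * ln (real m + 1) \<le> 2 * (real d * L) + real d * ((A + 10) * L)"
            using ln2[of 2] dL lnm by (intro add_mono mult_left_mono) auto
          then show ?thesis by (simp add: Y_def algebra_simps)
        qed
        also have "\<dots> < exp (real K * (l / 64)\<^sup>2 / 16)"
          using K1 l by (simp add: field_simps power2_eq_square)
        finally show ?thesis .
      qed
      define S where "S = ({..<K} \<rightarrow>\<^sub>E atoms d R) \<times> ({..<K} \<rightarrow>\<^sub>E atoms d R)"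
      define G where "G = (\<lambda>(s, s'). {x\<in>cube d. 5 * l / 8 < cmod (sparse_poly d K s x - sparse_poly d K s' x)})"
      define T where "T = {p\<in>S. \<nu> \<le> measure (cube_measure d) (G p)}"
      \<comment> \<open>an upper bound for the logarithm of the number of pairs of sparse polynomials\<close>
      define X where "X = 2 * (real K * (real d * ((A + 3) * L)))"
      define n where "n = nat \<lfloor>X / \<nu>\<rfloor> + 1"
      have finS: "finite S" by (simp add: S_def finite_PiE)
      have cardS: "real (card S) \<le> exp X"
      proof -
        have "card (atoms d R) > 0" by (simp add: card_gt_0_iff atoms_def)
        then have "real (card S) = exp (2 * (real K * ln (real (card (atoms d R)))))"
          by (simp add: S_def card_cartesian_product card_PiE exp_double exp_of_nat_mult power2_eq_square)
        also have "\<dots> \<le> exp X"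
        proof -
          have "ln (real (card (atoms d R))) \<le> ln (5 * (2 * real R) ^ d)"
            using card_atoms_le[OF R(3), of d] \<open>card (atoms d R) > 0\<close> R(3) by (subst ln_le_cancel_iff) auto
          also have "\<dots> = ln 5 + real d * ln (2 * real R)"
            using R(3) by (simp add: ln_mult_pos ln_realpow distrib_left del: power_mult_distrib)
          also have "ln (5::real) \<le> ln (2 ^ 3)" by (subst ln_le_cancel_iff) auto
          also have "\<dots> \<le> 3" using ln2[of 3] by simp
          also have "3 + real d * ln (2 * real R) \<le> 3 * (real d * L) + real d * (A * L)"
            using dL ln2R by (intro add_mono mult_left_mono) auto
          also have "\<dots> = real d * ((A + 3) * L)" by (simp add: algebra_simps)
          finally show ?thesis by (simp add: X_def mult_left_mono)
        qed
        finally show ?thesis .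
      qed
      have X0: "X \<ge> 0" using A L by (simp add: X_def)
      have n: "X / \<nu> < real n" "real n \<le> X / \<nu> + 1"
        using X0 \<nu> by (auto simp: n_def) linarith+
      have small: "real (card T) * (1 - \<nu>) ^ n < 1"
      proof -
        have "real (card T) \<le> exp X"
          using cardS card_mono[OF finS, of T] by (simp add: T_def)
        moreover have "(1 - \<nu>) ^ n \<le> exp (- \<nu>) ^ n"
          using False exp_ge_add_one_self[of "- \<nu>"] by (intro power_mono) auto
        ultimately have "real (card T) * (1 - \<nu>) ^ n \<le> exp X * exp (- \<nu>) ^ n"
          using False by (intro mult_mono) auto
        also have "\<dots> = exp (X - real n * \<nu>)" by (simp add: exp_of_nat_mult[symmetric] exp_add[symmetric])
        also have "\<dots> < 1" using n(1) \<nu> by (simp add: field_simps)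
        finally show ?thesis .
      qed
      have G_sets: "G p \<in> sets (cube_measure d)" for p
        unfolding G_def space_cube_measure[symmetric] by (cases p) simp
      have "\<exists>xs. length xs = n \<and> set xs \<subseteq> space (cube_measure d) \<and> (\<forall>p\<in>T. set xs \<inter> G p \<noteq> {})"
      proof (rule hitting_points[OF _ G_sets _ _ small])
        show "finite T" using finS by (simp add: T_def)
        show "\<nu> \<le> prob (G p)" if "p \<in> T" for p using that by (simp add: T_def)
        show "\<nu> \<le> 1" using False by simp
      qed
      then obtain xs where xs: "length xs = n" "set xs \<subseteq> cube d" "\<And>p. p \<in> T \<Longrightarrow> set xs \<inter> G p \<noteq> {}"
        unfolding space_cube_measure by blast
      have len: "real (length xs) \<le> C * (real d)\<^sup>2 * (1 + ln (real d) + ln (1 / l))\<^sup>2 / (l\<^sup>2 * \<nu>)"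
      proof -
        have "X \<le> 2 * (A2 * real d * L / l\<^sup>2 * (real d * ((A + 3) * L)))"
          unfolding X_def using K2 A L by (intro mult_left_mono mult_right_mono) auto
        also have "\<dots> = (2 * A2 * (A + 3)) * ((real d)\<^sup>2 * L\<^sup>2 / l\<^sup>2)" by (simp add: power2_eq_square)
        finally have "X / \<nu> \<le> (2 * A2 * (A + 3)) * ((real d)\<^sup>2 * L\<^sup>2 / l\<^sup>2) / \<nu>"
          using \<nu> by (intro divide_right_mono) auto
        then have "X / \<nu> \<le> (2 * A2 * (A + 3)) * ((real d)\<^sup>2 * L\<^sup>2 / l\<^sup>2 / \<nu>)"
          by (simp only: times_divide_eq_right)
        moreover have "1 \<le> (real d)\<^sup>2 * L\<^sup>2 / l\<^sup>2 / \<nu>"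
        proof -
          have "l\<^sup>2 * \<nu> \<le> 1 * 1" using l \<nu> False by (intro mult_mono) (auto simp: power_le_one)
          also have "\<dots> \<le> (real d * L)\<^sup>2" using dL by (simp add: one_le_power)
          finally show ?thesis using l \<nu> by (simp add: field_simps power_mult_distrib)
        qed
        ultimately have "real n \<le> (2 * A2 * (A + 3) + 1) * ((real d)\<^sup>2 * L\<^sup>2 / l\<^sup>2 / \<nu>)"
          using n(2) unfolding distrib_right mult_1_left by linarith
        then show ?thesis by (simp add: xs C_def L_def mult_ac)
      qed
      have rec: "measure (cube_measure d) {x\<in>cube d. l < cmod (f x - g x)} \<le> \<nu>"
        if f: "f \<in> F_class \<alpha> d" and g: "g \<in> F_class \<alpha> d" and eq: "map f xs = map g xs" for f g
      proof (rule ccontr)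
        assume "\<not> ?thesis"
        then have big: "\<nu> < measure (cube_measure d) {x\<in>cube d. l < cmod (f x - g x)}" by simp
        have approx: "\<exists>s. s \<in> ({..<K} \<rightarrow>\<^sub>E atoms d R) \<and> (\<forall>x\<in>cube d. cmod (f x - sparse_poly d K s x) \<le> 3 * l / 16)"
          if f: "f \<in> F_class \<alpha> d" for f
        proof -
          obtain a where a: "(\<Sum>k\<in>freq_box d R. cmod (a k)) \<le> 1"
            "\<And>x. x \<in> cube d \<Longrightarrow> cmod (f x - trig_poly d (freq_box d R) a x) \<le> l / 16"
            using fejer_approximation[OF f \<alpha> \<delta> R(3) Rd] \<delta>\<alpha> by auto
          obtain s where s: "s ` {..<K} \<subseteq> atoms d R"
            "\<And>x. x \<in> cube d \<Longrightarrow> cmod (trig_poly d (freq_box d R) a x - sparse_poly d K s x) \<le> l / 8"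
            using sparse_approximation[OF a(1) l m(3) m2 K3] by blast
          have "sparse_poly d K (restrict s {..<K}) x = sparse_poly d K s x" for x
            by (simp add: sparse_poly_def)
          moreover have "cmod (f x - sparse_poly d K s x) \<le> 3 * l / 16" if x: "x \<in> cube d" for x
            using norm_triangle_ineq[of "f x - trig_poly d (freq_box d R) a x"
                "trig_poly d (freq_box d R) a x - sparse_poly d K s x"] a(2)[OF x] s(2)[OF x] by simp
          ultimately show ?thesis using s(1) by (intro exI[of _ "restrict s {..<K}"]) auto
        qed
        obtain s where s: "s \<in> ({..<K} \<rightarrow>\<^sub>E atoms d R)"
          "\<And>x. x \<in> cube d \<Longrightarrow> cmod (f x - sparse_poly d K s x) \<le> 3 * l / 16" using approx[OF f] by blast
        obtain s' where s': "s' \<in> ({..<K} \<rightarrow>\<^sub>E atoms d R)"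
          "\<And>x. x \<in> cube d \<Longrightarrow> cmod (g x - sparse_poly d K s' x) \<le> 3 * l / 16" using approx[OF g] by blast
        have close: "cmod ((f x - g x) - (sparse_poly d K s x - sparse_poly d K s' x)) \<le> 3 * l / 8" if "x \<in> cube d" for x
          using norm_triangle_ineq4[of "f x - sparse_poly d K s x" "g x - sparse_poly d K s' x"] s(2)[OF that] s'(2)[OF that]
          by (simp add: algebra_simps)
        have "{x\<in>cube d. l < cmod (f x - g x)} \<subseteq> G (s, s')"
        proof
          fix x assume "x \<in> {x\<in>cube d. l < cmod (f x - g x)}"
          then show "x \<in> G (s, s')"
            using close[of x] norm_triangle_ineq2[of "f x - g x" "sparse_poly d K s x - sparse_poly d K s' x"]
            by (auto simp: G_def)
        qed
        then have "measure (cube_measure d) {x\<in>cube d. l < cmod (f x - g x)} \<le> measure (cube_measure d) (G (s, s'))"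
          using G_sets by (intro finite_measure_mono)
        then have "(s, s') \<in> T" using big s s' by (simp add: T_def S_def)
        then obtain x where x: "x \<in> set xs" "x \<in> G (s, s')" using xs(3) by blast
        then have "f x = g x" using eq by simp
        then show False using close[of x] x l by (auto simp: G_def norm_minus_commute[of "sparse_poly d K s' x"])
      qed
      show ?thesis using xs(2) len rec unfolding resolves_def by blast
    qed
  qed
qed

section \<open>Translation invariance of the torus\<close>

text \<open>
  Addition of \<open>c\<close> on the torus, carried out inside the cube.
\<close>

definition torus_shift :: "nat \<Rightarrow> (nat \<Rightarrow> real) \<Rightarrow> (nat \<Rightarrow> real) \<Rightarrow> nat \<Rightarrow> real" where
  "torus_shift d c x = (\<lambda>i\<in>{..<d}. frac (x i + c i))"

lemma torus_shift_measurable: "torus_shift d c \<in> cube_measure d \<rightarrow>\<^sub>M cube_measure d"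
  unfolding torus_shift_def cube_measure_def
proof (rule measurable_restrict)
  fix i assume "i \<in> {..<d}"
  then have "(\<lambda>x. x i) \<in> (\<Pi>\<^sub>M i\<in>{..<d}. unit_interval_measure) \<rightarrow>\<^sub>M unit_interval_measure"
    by (rule measurable_component_singleton)
  from measurable_compose[OF this frac_translate_measurable[of "c i"]]
  show "(\<lambda>x. frac (x i + c i)) \<in> (\<Pi>\<^sub>M i\<in>{..<d}. unit_interval_measure) \<rightarrow>\<^sub>M unit_interval_measure" .
qed

lemma distr_torus_shift: "distr (cube_measure d) (cube_measure d) (torus_shift d c) = cube_measure d"
proof -
  interpret product_sigma_finite "\<lambda>i::nat. unit_interval_measure"
    by (rule product_sigma_finite_unit_interval)
  have "distr (cube_measure d) (cube_measure d) (torus_shift d c) = (\<Pi>\<^sub>M i\<in>{..<d}. unit_interval_measure)"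
  proof (rule PiM_eqI)
    fix A :: "nat \<Rightarrow> real set"
    assume A: "\<And>i. i \<in> {..<d} \<Longrightarrow> A i \<in> sets unit_interval_measure"
    define A' where "A' i = (\<lambda>x. frac (x + c i)) -` A i \<inter> {0..1}" for i
    have A': "A' i \<in> sets unit_interval_measure" if "i \<in> {..<d}" for i
      using measurable_sets[OF frac_translate_measurable A[OF that], of "c i"]
      by (simp add: A'_def space_restrict_space)
    have same: "emeasure unit_interval_measure (A' i) = emeasure unit_interval_measure (A i)" if "i \<in> {..<d}" for i
    proof -
      have "emeasure (distr unit_interval_measure unit_interval_measure (\<lambda>x. frac (x + c i))) (A i) =
          emeasure unit_interval_measure (A' i)"
        by (subst emeasure_distr[OF frac_translate_measurable A[OF that]]) (simp add: A'_def space_restrict_space)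
      then show ?thesis by (simp add: distr_unit_interval_frac)
    qed
    have "emeasure (distr (cube_measure d) (cube_measure d) (torus_shift d c)) (Pi\<^sub>E {..<d} A) =
        emeasure (cube_measure d) (torus_shift d c -` Pi\<^sub>E {..<d} A \<inter> space (cube_measure d))"
      using A by (intro emeasure_distr torus_shift_measurable) (auto simp: cube_measure_def intro!: sets_PiM_I_finite)
    also have "torus_shift d c -` Pi\<^sub>E {..<d} A \<inter> space (cube_measure d) = Pi\<^sub>E {..<d} A'"
    proof (rule set_eqI)
      fix x
      have "torus_shift d c x \<in> Pi\<^sub>E {..<d} A \<longleftrightarrow> (\<forall>i<d. frac (x i + c i) \<in> A i)"
        by (simp add: torus_shift_def restrict_PiE_iff Pi_iff Ball_def)
      then show "x \<in> torus_shift d c -` Pi\<^sub>E {..<d} A \<inter> space (cube_measure d) \<longleftrightarrow> x \<in> Pi\<^sub>E {..<d} A'"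
        by (simp only: Int_iff vimage_eq space_cube_measure cube_def A'_def PiE_iff lessThan_iff) blast
    qed
    also have "emeasure (cube_measure d) (Pi\<^sub>E {..<d} A') = (\<Prod>i<d. emeasure unit_interval_measure (A' i))"
      unfolding cube_measure_def using A' by (intro emeasure_PiM) auto
    finally show "emeasure (distr (cube_measure d) (cube_measure d) (torus_shift d c)) (Pi\<^sub>E {..<d} A) =
        (\<Prod>i<d. emeasure unit_interval_measure (A i))" using same by simp
  qed (auto simp: cube_measure_def)
  then show ?thesis by (simp add: cube_measure_def)
qed

lemma character_torus_shift: "character d k (torus_shift d c x) = character d k (\<lambda>i. c i + x i)"
  unfolding character_prod
  by (intro prod.cong refl) (simp add: torus_shift_def cis_2pi_frac add.commute)

lemma trig_poly_torus_shift: "trig_poly d \<Lambda> a (torus_shift d c x) = trig_poly d \<Lambda> a (\<lambda>i. c i + x i)"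
  by (simp add: trig_poly_def character_torus_shift)

lemma measure_trig_poly_translate:
  "measure (cube_measure d) {y\<in>cube d. l < cmod (trig_poly d \<Lambda> a (\<lambda>i. c i + y i))} =
   measure (cube_measure d) {y\<in>cube d. l < cmod (trig_poly d \<Lambda> a y)}"
proof -
  let ?A = "{y\<in>space (cube_measure d). l < cmod (trig_poly d \<Lambda> a y)}"
  have "measure (distr (cube_measure d) (cube_measure d) (torus_shift d c)) ?A =
     measure (cube_measure d) (torus_shift d c -` ?A \<inter> space (cube_measure d))"
    by (intro measure_distr torus_shift_measurable) measurable
  also have "torus_shift d c -` ?A \<inter> space (cube_measure d) =
      {y\<in>space (cube_measure d). l < cmod (trig_poly d \<Lambda> a (\<lambda>i. c i + y i))}"
    using measurable_space[OF torus_shift_measurable, of _ d c] by (auto simp: trig_poly_torus_shift)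
  finally show ?thesis by (simp add: distr_torus_shift space_cube_measure)
qed

section \<open>Convolution with visible test functions\<close>

text \<open>
  Multiplying Fourier coefficients by the square modulus of those of \<open>\<psi>\<close> is convolution with the
  autocorrelation of \<open>\<psi>\<close>. As \<open>\<psi>\<close> has norm at most 1 in $L_1$, this neither increases absolute values
  of coefficients nor the supremum, and it turns a function whose averages against all translates of
  \<open>\<psi>\<close> are small into a uniformly small one.
\<close>

locale test_function =
  fixes d :: nat and \<psi> :: "(nat \<Rightarrow> real) \<Rightarrow> complex" and B :: real
  assumes measurable_\<psi> [measurable]: "\<psi> \<in> borel_measurable (cube_measure d)"
    and bounded_\<psi>: "\<And>x. x \<in> cube d \<Longrightarrow> cmod (\<psi> x) \<le> B"
    and norm_\<psi>: "(LINT x|cube_measure d. cmod (\<psi> x)) \<le> 1"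
begin

lemma B_nonneg: "B \<ge> 0"
  using order.trans[OF norm_ge_zero bounded_\<psi>[of "\<lambda>i\<in>{..<d}. 0"]] by (auto simp: cube_def)

lemma integrable_mult_character:
  "integrable (cube_measure d) (\<lambda>x. \<psi> x * cnj (character d k x))"
  using bounded_\<psi> by (intro integrable_cube_bounded[where B = B]) (auto simp: norm_mult)

lemma integrable_cnj_mult_character:
  "integrable (cube_measure d) (\<lambda>x. cnj (\<psi> x) * character d k x)"
  using bounded_\<psi> by (intro integrable_cube_bounded[where B = B]) (auto simp: norm_mult)

lemma norm_integral_le:
  assumes [measurable]: "H \<in> borel_measurable (cube_measure d)"
    and "\<And>x. x \<in> cube d \<Longrightarrow> cmod (H x) \<le> s" "0 \<le> s"
  shows "cmod (LINT x|cube_measure d. \<psi> x * H x) \<le> s"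
proof -
  have "cmod (LINT x|cube_measure d. \<psi> x * H x) \<le> (LINT x|cube_measure d. cmod (\<psi> x * H x))"
    by (rule integral_norm_bound)
  also have "\<dots> \<le> (LINT x|cube_measure d. cmod (\<psi> x) * s)"
  proof (rule integral_mono)
    show "integrable (cube_measure d) (\<lambda>x. cmod (\<psi> x * H x))"
      using bounded_\<psi> assms by (intro integrable_cube_bounded[where B = "B * s"]) (auto simp: norm_mult B_nonneg intro!: mult_mono)
    show "integrable (cube_measure d) (\<lambda>x. cmod (\<psi> x) * s)"
      using bounded_\<psi> by (intro integrable_mult_left integrable_cube_bounded[where B = B]) auto
  qed (use assms in \<open>auto simp: space_cube_measure norm_mult intro!: mult_left_mono\<close>)
  also have "\<dots> = (LINT x|cube_measure d. cmod (\<psi> x)) * s" by simp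
  also have "\<dots> \<le> 1 * s" using norm_\<psi> assms by (intro mult_right_mono) auto
  finally show ?thesis by simp
qed

lemma norm_fourier_coeff_le: "cmod (fourier_coeff d \<psi> k) \<le> 1"
  unfolding fourier_coeff_eq by (rule norm_integral_le) auto

lemma integral_cnj_character: "(LINT x|cube_measure d. cnj (\<psi> x) * character d k x) = cnj (fourier_coeff d \<psi> k)"
  unfolding fourier_coeff_eq
  using integral_bounded_linear[OF bounded_linear_cnj integrable_mult_character, of k] by simp

lemma correlation:
  "(LINT y|cube_measure d. cnj (\<psi> y) * trig_poly d \<Lambda> a (\<lambda>i. z i + y i)) =
     trig_poly d \<Lambda> (\<lambda>k. cnj (fourier_coeff d \<psi> k) * a k) z"
proof -
  have "cnj (\<psi> y) * trig_poly d \<Lambda> a (\<lambda>i. z i + y i) =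
      (\<Sum>k\<in>\<Lambda>. (a k * character d k z) * (cnj (\<psi> y) * character d k y))" for y
    by (simp add: trig_poly_def character_add sum_distrib_left mult_ac)
  then have "(LINT y|cube_measure d. cnj (\<psi> y) * trig_poly d \<Lambda> a (\<lambda>i. z i + y i)) =
      (LINT y|cube_measure d. (\<Sum>k\<in>\<Lambda>. (a k * character d k z) * (cnj (\<psi> y) * character d k y)))"
    by (simp only:)
  also have "\<dots> = (\<Sum>k\<in>\<Lambda>. (a k * character d k z) * (LINT y|cube_measure d. cnj (\<psi> y) * character d k y))"
    by (subst Bochner_Integration.integral_sum)
       (auto intro!: integrable_mult_right integrable_cnj_mult_character)
  also have "\<dots> = trig_poly d \<Lambda> (\<lambda>k. cnj (fourier_coeff d \<psi> k) * a k) z"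
    by (simp add: integral_cnj_character trig_poly_def mult_ac)
  finally show ?thesis .
qed

lemma convolution:
  "(LINT x|cube_measure d. \<psi> x * trig_poly d \<Lambda> a (\<lambda>i. z i - x i)) =
     trig_poly d \<Lambda> (\<lambda>k. fourier_coeff d \<psi> k * a k) z"
proof -
  have "\<psi> x * trig_poly d \<Lambda> a (\<lambda>i. z i - x i) =
      (\<Sum>k\<in>\<Lambda>. (a k * character d k z) * (\<psi> x * cnj (character d k x)))" for x
    by (simp add: trig_poly_def character_diff sum_distrib_left mult_ac)
  then have "(LINT x|cube_measure d. \<psi> x * trig_poly d \<Lambda> a (\<lambda>i. z i - x i)) =
      (LINT x|cube_measure d. (\<Sum>k\<in>\<Lambda>. (a k * character d k z) * (\<psi> x * cnj (character d k x))))"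
    by (simp only:)
  also have "\<dots> = (\<Sum>k\<in>\<Lambda>. (a k * character d k z) * (LINT x|cube_measure d. \<psi> x * cnj (character d k x)))"
    by (subst Bochner_Integration.integral_sum)
       (auto intro!: integrable_mult_right integrable_mult_character)
  also have "\<dots> = trig_poly d \<Lambda> (\<lambda>k. fourier_coeff d \<psi> k * a k) z"
    by (simp add: fourier_coeff_eq trig_poly_def mult_ac)
  finally show ?thesis .
qed

lemma norm_autocorrelation_le:
  assumes "\<And>z. cmod (LINT y|cube_measure d. cnj (\<psi> y) * trig_poly d \<Lambda> a (\<lambda>i. z i + y i)) \<le> s"
  shows "cmod (trig_poly d \<Lambda> (\<lambda>k. of_real ((cmod (fourier_coeff d \<psi> k))\<^sup>2) * a k) z) \<le> s"
proof -
  have s: "s \<ge> 0" using assms[of undefined] by (rule order.trans[OF norm_ge_zero])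
  define b where "b k = cnj (fourier_coeff d \<psi> k) * a k" for k
  have bound: "cmod (trig_poly d \<Lambda> b z) \<le> s" for z
    using assms[of z] by (simp add: correlation b_def[abs_def])
  have meas: "(\<lambda>x. trig_poly d \<Lambda> b (\<lambda>i. z i - x i)) \<in> borel_measurable (cube_measure d)"
    unfolding trig_poly_def character_diff by measurable
  have "trig_poly d \<Lambda> (\<lambda>k. of_real ((cmod (fourier_coeff d \<psi> k))\<^sup>2) * a k) z =
      (LINT x|cube_measure d. \<psi> x * trig_poly d \<Lambda> b (\<lambda>i. z i - x i))"
    unfolding convolution b_def complex_norm_square by (simp add: mult.assoc)
  also have "cmod \<dots> \<le> s"
    using bound s meas by (intro norm_integral_le) auto
  finally show ?thesis .
qed

end

section \<open>Multipliers that detect all visible parts\<close>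

text \<open>
  The set \<open>\<S>\<close> consists of the coefficients of functions with the same samples, and \<open>g\<close> is one of them.
  Sets of measure at least \<open>\<nu>\<close> are called visible. The last assumption says that a difference from \<open>g\<close>
  is not noticeable on visible sets: its average modulus there is at most \<open>e\<close>, also after translation.
\<close>

locale visible_boosting =
  fixes d :: nat and \<Lambda> :: "(nat \<Rightarrow> int) set" and \<S> :: "((nat \<Rightarrow> int) \<Rightarrow> complex) set"
    and g :: "(nat \<Rightarrow> int) \<Rightarrow> complex" and \<nu> e :: real
  assumes g: "g \<in> \<S>"
    and coeffs: "\<And>a. a \<in> \<S> \<Longrightarrow> (\<Sum>k\<in>\<Lambda>. cmod (a k)) \<le> 1"
    and \<nu>: "\<nu> > 0" and e: "e \<ge> 0"
    and average: "\<And>a c G. a \<in> \<S> \<Longrightarrow> G \<in> sets (cube_measure d) \<Longrightarrow> \<nu> \<le> measure (cube_measure d) G \<Longrightarrow>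
      (LINT y|cube_measure d. indicator G y * cmod (trig_poly d \<Lambda> (\<lambda>k. a k - g k) (\<lambda>i. c i + y i)))
        \<le> e * measure (cube_measure d) G"
begin

text \<open>
  The multiplier \<open>1 - q\<close> selects the part of the functions that the samples determine uniformly up to
  \<open>(2 ^ j - 1) * e\<close>, and \<open>\<kappa>\<close> is a common lower bound for the absolute coefficient sum of this part.
\<close>

definition boost_state :: "nat \<Rightarrow> real \<Rightarrow> ((nat \<Rightarrow> int) \<Rightarrow> real) \<Rightarrow> bool" where
  "boost_state j \<kappa> q \<longleftrightarrow> (\<forall>k\<in>\<Lambda>. 0 \<le> q k \<and> q k \<le> 1) \<and>
     (\<forall>a\<in>\<S>. \<forall>z. cmod (trig_poly d \<Lambda> (\<lambda>k. of_real (1 - q k) * (a k - g k)) z) \<le> (2 ^ j - 1) * e) \<and>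
     (\<forall>a\<in>\<S>. \<kappa> \<le> (\<Sum>k\<in>\<Lambda>. (1 - q k) * cmod (a k)))"

definition residual :: "((nat \<Rightarrow> int) \<Rightarrow> real) \<Rightarrow> (nat \<Rightarrow> real) \<Rightarrow> complex" where
  "residual q = trig_poly d \<Lambda> (\<lambda>k. of_real (q k) * g k)"

lemma boost_state_initial: "boost_state 0 0 (\<lambda>k. 1)"
  by (simp add: boost_state_def trig_poly_def)

lemma boost_state_le_1:
  assumes "boost_state j \<kappa> q"
  shows "\<kappa> \<le> 1"
proof -
  have "\<kappa> \<le> (\<Sum>k\<in>\<Lambda>. (1 - q k) * cmod (g k))" using assms g by (auto simp: boost_state_def)
  also have "\<dots> \<le> (\<Sum>k\<in>\<Lambda>. cmod (g k))"
    using assms by (intro sum_mono mult_left_le_one_le) (auto simp: boost_state_def)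
  finally show ?thesis using coeffs[OF g] by simp
qed

text \<open>
  The test function \<open>\<psi>\<close> is the phase of \<open>q g\<close> on the visible set where \<open>q g\<close> is large, normalized in
  $L_1$. Its correlation with \<open>q g\<close> is at least \<open>l\<close>, and with \<open>q a\<close> still at least \<open>l / 2\<close>, because
  \<open>\<psi>\<close> hardly sees \<open>a - g\<close>. With \<open>w\<close> the square moduli of the coefficients of \<open>\<psi>\<close>, the Cauchy-Schwarz
  inequality gives \<open>q a\<close> a mass of at least \<open>l^2 / 4\<close> under \<open>w\<close>. The new multiplier \<open>q * (1 - w)\<close> moves
  this mass from \<open>q\<close> to \<open>1 - q\<close>.
\<close>

lemma boost_step:
  assumes state: "boost_state j \<kappa> q" and l: "l > 0" "2 ^ j * e \<le> l / 2"
    and visible: "\<nu> \<le> measure (cube_measure d) {x\<in>cube d. l < cmod (residual q x)}"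
  shows "\<exists>q'. boost_state (Suc j) (\<kappa> + l\<^sup>2 / 4) q'"
proof -
  interpret P: prob_space "cube_measure d" by (rule prob_space_cube_measure)
  define h where "h = residual q"
  define G where "G = {x\<in>cube d. l < cmod (h x)}"
  define \<gamma> where "\<gamma> = measure (cube_measure d) G"
  define \<psi> where "\<psi> x = indicator G x * sgn (h x) / of_real \<gamma>" for x
  have h_meas [measurable]: "h \<in> borel_measurable (cube_measure d)" by (simp add: h_def residual_def)
  have G_sets [measurable]: "G \<in> sets (cube_measure d)"
    unfolding G_def space_cube_measure[symmetric] by measurable
  have \<gamma>: "\<gamma> \<ge> \<nu>" "\<gamma> > 0" using visible \<nu> by (auto simp: \<gamma>_def G_def h_def)
  have \<psi>_le: "cmod (\<psi> x) \<le> indicator G x / \<gamma>" for x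
    using \<gamma> by (auto simp: \<psi>_def norm_mult norm_divide norm_sgn indicator_def divide_right_mono)
  have ind_int: "integrable (cube_measure d) (\<lambda>x. indicator G x / \<gamma>)"
    using G_sets by (intro integrable_divide P.integrable_const_bound[where B = 1]) (auto simp: indicator_def)
  have sgn_meas: "(\<lambda>x. sgn (h x)) \<in> borel_measurable (cube_measure d)"
    by (simp add: sgn_div_norm)
  interpret test_function d \<psi> "1 / \<gamma>"
  proof
    show [measurable]: "\<psi> \<in> borel_measurable (cube_measure d)" using sgn_meas unfolding \<psi>_def by measurable
    show "cmod (\<psi> x) \<le> 1 / \<gamma>" if "x \<in> cube d" for x
      using order.trans[OF \<psi>_le[of x]] \<gamma> by (auto simp: indicator_def divide_right_mono)
    have "(LINT x|cube_measure d. cmod (\<psi> x)) \<le> (LINT x|cube_measure d. indicator G x / \<gamma>)"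
      using \<psi>_le ind_int \<gamma>(2) by (intro integral_mono Bochner_Integration.integrable_bound[OF ind_int]) auto
    also have "\<dots> = 1" using \<gamma> by (simp add: \<gamma>_def sets.Int_space_eq2)
    finally show "(LINT x|cube_measure d. cmod (\<psi> x)) \<le> 1" .
  qed
  define w where "w k = (cmod (fourier_coeff d \<psi> k))\<^sup>2" for k
  have w: "0 \<le> w k" "w k \<le> 1" for k
    using norm_fourier_coeff_le by (auto simp: w_def power_le_one)
  have q: "0 \<le> q k" "q k \<le> 1" if "k \<in> \<Lambda>" for k using state that by (auto simp: boost_state_def)
  have drop: "cmod (trig_poly d \<Lambda> (\<lambda>k. of_real (1 - q k) * (a k - g k)) z) \<le> (2 ^ j - 1) * e" if "a \<in> \<S>" for a z
    using state that by (auto simp: boost_state_def)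
  have kept: "\<kappa> \<le> (\<Sum>k\<in>\<Lambda>. (1 - q k) * cmod (a k))" if "a \<in> \<S>" for a
    using state that by (auto simp: boost_state_def)
  have pow: "(2 ^ j - 1) * e \<ge> 0" using e by (intro mult_nonneg_nonneg) auto
  have corr1: "cmod (LINT y|cube_measure d. cnj (\<psi> y) * trig_poly d \<Lambda> (\<lambda>k. a k - g k) (\<lambda>i. z i + y i)) \<le> e"
    if a: "a \<in> \<S>" for a z
  proof -
    let ?t = "\<lambda>y. trig_poly d \<Lambda> (\<lambda>k. a k - g k) (\<lambda>i. z i + y i)"
    have int: "integrable (cube_measure d) (\<lambda>y. indicator G y * cmod (?t y) / \<gamma>)"
      by (intro integrable_divide integrable_cube_bounded[where B = "\<Sum>k\<in>\<Lambda>. cmod (a k - g k)"])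
         (auto simp: indicator_def norm_trig_poly_le sum_nonneg)
    have "cmod (LINT y|cube_measure d. cnj (\<psi> y) * ?t y) \<le> (LINT y|cube_measure d. cmod (cnj (\<psi> y) * ?t y))"
      by (rule integral_norm_bound)
    also have "\<dots> \<le> (LINT y|cube_measure d. indicator G y * cmod (?t y) / \<gamma>)"
    proof (rule integral_mono)
      have le: "cmod (cnj (\<psi> y) * ?t y) \<le> indicator G y * cmod (?t y) / \<gamma>" for y
        using mult_right_mono[OF \<psi>_le[of y], of "cmod (?t y)"] by (simp add: norm_mult)
      then show "cmod (cnj (\<psi> y) * ?t y) \<le> indicator G y * cmod (?t y) / \<gamma>" for y .
      show "integrable (cube_measure d) (\<lambda>y. cmod (cnj (\<psi> y) * ?t y))"
        using le \<gamma>(2) by (intro Bochner_Integration.integrable_bound[OF int]) auto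
    qed (rule int)
    also have "\<dots> \<le> e"
      using average[OF a G_sets, where c = z] \<gamma> by (simp add: \<gamma>_def pos_divide_le_eq)
    finally show ?thesis .
  qed
  have corr2: "cmod (LINT y|cube_measure d. cnj (\<psi> y) * trig_poly d \<Lambda> b (\<lambda>i. z i + y i)) \<le> s"
    if "\<And>z. cmod (trig_poly d \<Lambda> b z) \<le> s" for b z s
  proof -
    have "cmod (LINT y|cube_measure d. cnj (\<psi> y) * trig_poly d \<Lambda> b (\<lambda>i. z i + y i)) =
        cmod (LINT y|cube_measure d. \<psi> y * cnj (trig_poly d \<Lambda> b (\<lambda>i. z i + y i)))"
    proof -
      have "integrable (cube_measure d) (\<lambda>y. \<psi> y * cnj (trig_poly d \<Lambda> b (\<lambda>i. z i + y i)))"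
        using bounded_\<psi> that order.trans[OF norm_ge_zero that] B_nonneg
        by (intro integrable_cube_bounded[where B = "1 / \<gamma> * s"]) (auto simp: norm_mult simp del: times_divide_eq_left intro!: mult_mono)
      from integral_bounded_linear[OF bounded_linear_cnj this]
      have "(LINT y|cube_measure d. cnj (\<psi> y) * trig_poly d \<Lambda> b (\<lambda>i. z i + y i)) =
          cnj (LINT y|cube_measure d. \<psi> y * cnj (trig_poly d \<Lambda> b (\<lambda>i. z i + y i)))" by simp
      then show ?thesis by simp
    qed
    also have "\<dots> \<le> s" using that order.trans[OF norm_ge_zero that] by (intro norm_integral_le) auto
    finally show ?thesis .
  qed
  define q' where "q' k = q k * (1 - w k)" for k
  \<comment> \<open>the old error occurs twice and \<open>e\<close> once, so \<open>(2 ^ j - 1) * e\<close> becomes \<open>(2 ^ Suc j - 1) * e\<close>\<close>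
  have split: "of_real (1 - q' k) * x = of_real (1 - q k) * x + (of_real (w k) * x - of_real (w k) * (of_real (1 - q k) * x))"
    for k and x :: complex
    by (simp add: q'_def algebra_simps)
  have "boost_state (Suc j) (\<kappa> + l\<^sup>2 / 4) q'"
    unfolding boost_state_def
  proof (intro conjI ballI allI)
    fix k assume "k \<in> \<Lambda>"
    then show "0 \<le> q' k" "q' k \<le> 1" using q w by (auto simp: q'_def mult_le_one)
  next
    fix a z assume a: "a \<in> \<S>"
    let ?\<Delta> = "\<lambda>k. a k - g k"
    have 1: "cmod (trig_poly d \<Lambda> (\<lambda>k. of_real (w k) * ?\<Delta> k) z) \<le> e"
      unfolding w_def by (rule norm_autocorrelation_le) (rule corr1[OF a])
    have 2: "cmod (trig_poly d \<Lambda> (\<lambda>k. of_real (w k) * (of_real (1 - q k) * ?\<Delta> k)) z) \<le> (2 ^ j - 1) * e"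
      unfolding w_def by (rule norm_autocorrelation_le) (rule corr2[OF drop[OF a]])
    have "trig_poly d \<Lambda> (\<lambda>k. of_real (1 - q' k) * ?\<Delta> k) z =
        trig_poly d \<Lambda> (\<lambda>k. of_real (1 - q k) * ?\<Delta> k) z + (trig_poly d \<Lambda> (\<lambda>k. of_real (w k) * ?\<Delta> k) z -
        trig_poly d \<Lambda> (\<lambda>k. of_real (w k) * (of_real (1 - q k) * ?\<Delta> k)) z)"
      unfolding split trig_poly_add trig_poly_diff ..
    also have "cmod \<dots> \<le> (2 ^ j - 1) * e + (e + (2 ^ j - 1) * e)"
      using drop[OF a, of z] 1 2 by (intro norm_triangle_le add_mono norm_triangle_le_diff)
    also have "\<dots> = (2 ^ Suc j - 1) * e" by (simp add: algebra_simps)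
    finally show "cmod (trig_poly d \<Lambda> (\<lambda>k. of_real (1 - q' k) * ?\<Delta> k) z) \<le> (2 ^ Suc j - 1) * e" .
  next
    fix a assume a: "a \<in> \<S>"
    define m where "m k = q k * cmod (a k)" for k
    have m: "m k \<ge> 0" if "k \<in> \<Lambda>" for k using q[OF that] by (simp add: m_def)
    have mass: "(\<Sum>k\<in>\<Lambda>. m k) \<le> 1"
      using sum_mono[of \<Lambda> m "\<lambda>k. cmod (a k)"] q coeffs[OF a] by (auto simp: m_def mult_left_le_one_le)
    define I where "I b = (LINT y|cube_measure d. cnj (\<psi> y) * trig_poly d \<Lambda> b y)" for b
    have I_eq: "I b = (\<Sum>k\<in>\<Lambda>. cnj (fourier_coeff d \<psi> k) * b k)" for b
      using correlation[of \<Lambda> b "\<lambda>i. 0"] by (simp add: I_def trig_poly_def character_def)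
    have I_g: "cmod (I (\<lambda>k. of_real (q k) * g k)) \<ge> l"
    proof -
      have "I (\<lambda>k. of_real (q k) * g k) = (LINT y|cube_measure d. of_real (indicator G y * cmod (h y) / \<gamma>))"
        unfolding I_def
      proof (intro Bochner_Integration.integral_cong refl)
        fix y
        have "cnj (sgn (h y)) * h y = of_real (cmod (h y))"
          by (cases "h y = 0") (auto simp: sgn_eq complex_norm_square[symmetric] power2_eq_square mult.commute[of "cnj _"])
        then show "cnj (\<psi> y) * trig_poly d \<Lambda> (\<lambda>k. of_real (q k) * g k) y = of_real (indicator G y * cmod (h y) / \<gamma>)"
          unfolding residual_def[of q, symmetric, THEN fun_cong] h_def[symmetric] by (simp add: \<psi>_def indicator_def)
      qed
      also have "\<dots> = of_real (LINT y|cube_measure d. indicator G y * cmod (h y) / \<gamma>)"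
        by (rule integral_complex_of_real)
      finally have eq: "I (\<lambda>k. of_real (q k) * g k) = of_real (LINT y|cube_measure d. indicator G y * cmod (h y) / \<gamma>)" .
      have "l = (LINT y|cube_measure d. indicator G y * l / \<gamma>)"
        using \<gamma> by (simp add: \<gamma>_def sets.Int_space_eq2)
      also have "\<dots> \<le> (LINT y|cube_measure d. indicator G y * cmod (h y) / \<gamma>)"
      proof (rule integral_mono)
        show "integrable (cube_measure d) (\<lambda>y. indicator G y * l / \<gamma>)"
          by (intro integrable_divide integrable_cube_bounded[where B = l]) (use l in \<open>auto simp: indicator_def\<close>)
        show "integrable (cube_measure d) (\<lambda>y. indicator G y * cmod (h y) / \<gamma>)"
          unfolding h_def residual_def
          by (intro integrable_divide integrable_cube_bounded[where B = "\<Sum>k\<in>\<Lambda>. cmod (of_real (q k) * g k)"])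
             (auto simp: indicator_def norm_trig_poly_le sum_nonneg simp flip: h_def)
      qed (use \<gamma> in \<open>auto simp: indicator_def G_def divide_right_mono\<close>)
      finally show ?thesis unfolding eq norm_of_real by linarith
    qed
    have I_\<Delta>: "cmod (I (\<lambda>k. of_real (q k) * (a k - g k))) \<le> l / 2"
    proof -
      have "I (\<lambda>k. of_real (q k) * (a k - g k)) = I (\<lambda>k. a k - g k) - I (\<lambda>k. of_real (1 - q k) * (a k - g k))"
        unfolding I_eq by (simp add: sum_subtractf[symmetric] algebra_simps)
      also have "cmod \<dots> \<le> e + (2 ^ j - 1) * e"
        using corr1[OF a, of "\<lambda>i. 0"] corr2[OF drop[OF a], of "\<lambda>i. 0"]
        by (intro norm_triangle_le_diff add_mono) (simp_all add: I_def)
      also have "\<dots> = 2 ^ j * e" by (simp add: algebra_simps)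
      finally show ?thesis using l by simp
    qed
    have "l / 2 \<le> cmod (I (\<lambda>k. of_real (q k) * a k))"
    proof -
      have "I (\<lambda>k. of_real (q k) * a k) = I (\<lambda>k. of_real (q k) * g k) + I (\<lambda>k. of_real (q k) * (a k - g k))"
        unfolding I_eq by (simp add: sum.distrib[symmetric] algebra_simps)
      then show ?thesis using I_g I_\<Delta> norm_diff_ineq[of "I (\<lambda>k. of_real (q k) * g k)" "I (\<lambda>k. of_real (q k) * (a k - g k))"]
        by simp
    qed
    also have "\<dots> \<le> (\<Sum>k\<in>\<Lambda>. cmod (fourier_coeff d \<psi> k) * m k)"
      unfolding I_eq m_def by (rule order.trans[OF norm_sum]) (auto intro!: sum_mono simp: norm_mult q)
    finally have half: "l / 2 \<le> (\<Sum>k\<in>\<Lambda>. cmod (fourier_coeff d \<psi> k) * m k)" .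
    have "(l / 2)\<^sup>2 \<le> (\<Sum>k\<in>\<Lambda>. cmod (fourier_coeff d \<psi> k) * m k)\<^sup>2"
      using half l by (intro power_mono) auto
    also have "\<dots> = (\<Sum>k\<in>\<Lambda>. (cmod (fourier_coeff d \<psi> k) * sqrt (m k)) * sqrt (m k))\<^sup>2"
      using m by (intro arg_cong[where f = "\<lambda>x. x\<^sup>2"] sum.cong) (auto simp: mult.assoc)
    also have "\<dots> \<le> (\<Sum>k\<in>\<Lambda>. (cmod (fourier_coeff d \<psi> k) * sqrt (m k))\<^sup>2) * (\<Sum>k\<in>\<Lambda>. (sqrt (m k))\<^sup>2)"
      by (rule Cauchy_Schwarz_ineq_sum)
    also have "\<dots> = (\<Sum>k\<in>\<Lambda>. w k * m k) * (\<Sum>k\<in>\<Lambda>. m k)"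
      using m by (intro arg_cong2[where f = "(*)"] sum.cong) (auto simp: w_def power_mult_distrib)
    also have "\<dots> \<le> (\<Sum>k\<in>\<Lambda>. w k * m k) * 1"
      using mass m w by (intro mult_left_mono sum_nonneg) auto
    finally have gain: "l\<^sup>2 / 4 \<le> (\<Sum>k\<in>\<Lambda>. w k * m k)" by (simp add: power_divide)
    have "(\<Sum>k\<in>\<Lambda>. (1 - q' k) * cmod (a k)) = (\<Sum>k\<in>\<Lambda>. (1 - q k) * cmod (a k)) + (\<Sum>k\<in>\<Lambda>. w k * m k)"
      by (simp add: q'_def m_def sum.distrib[symmetric] algebra_simps)
    then show "\<kappa> + l\<^sup>2 / 4 \<le> (\<Sum>k\<in>\<Lambda>. (1 - q' k) * cmod (a k))" using gain kept[OF a] by linarith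
  qed
  then show ?thesis by blast
qed

text \<open>
  With \<open>s = \<theta> + \<kappa>\<close> and level \<open>s / 2\<close> a step replaces \<open>s\<close> by \<open>s + s^2 / 16\<close>, which lowers \<open>1 / s\<close> by at
  least \<open>1 / 32\<close>. Letting the level grow with \<open>\<kappa>\<close> makes the number of steps linear in \<open>1 / \<theta>\<close>; at the
  fixed level \<open>\<theta> / 2\<close> it would be quadratic, and the error \<open>2 ^ j * e\<close> could not be controlled.
\<close>

lemma boost_iterate:
  assumes state: "boost_state j0 \<kappa>0 q0" and \<theta>: "0 < \<theta>" "\<theta> \<le> 1" and \<kappa>0: "0 \<le> \<kappa>0"
    and J: "32 / \<theta> \<le> real J" and small: "2 ^ (j0 + J) * e \<le> \<theta> / 4"
  shows "\<exists>j \<kappa> q. boost_state j \<kappa> q \<and> j \<le> j0 + J \<and> \<kappa>0 \<le> \<kappa> \<and>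
    measure (cube_measure d) {x\<in>cube d. (\<theta> + \<kappa>) / 2 < cmod (residual q x)} < \<nu>"
proof (rule ccontr)
  assume neg: "\<not> ?thesis"
  have "\<exists>\<kappa> q. boost_state (j0 + i) \<kappa> q \<and> \<kappa>0 \<le> \<kappa> \<and> 1 / (\<theta> + \<kappa>) \<le> 1 / \<theta> - real i / 32" if "i \<le> J" for i
    using that
  proof (induction i)
    case 0
    then show ?case using state \<kappa>0 \<theta> by (intro exI[of _ \<kappa>0] exI[of _ q0]) (auto simp: frac_le)
  next
    case (Suc i)
    then obtain \<kappa> q where st: "boost_state (j0 + i) \<kappa> q" "\<kappa>0 \<le> \<kappa>" "1 / (\<theta> + \<kappa>) \<le> 1 / \<theta> - real i / 32" by auto
    define s where "s = \<theta> + \<kappa>"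
    have s: "s \<ge> \<theta>" "s \<le> 2" "s > 0" using st(2) \<kappa>0 \<theta> boost_state_le_1[OF st(1)] by (auto simp: s_def)
    have "\<nu> \<le> measure (cube_measure d) {x\<in>cube d. s / 2 < cmod (residual q x)}"
      using neg st Suc.prems unfolding s_def by (meson Suc_leD add_left_mono linorder_not_less)
    moreover have "2 ^ (j0 + i) * e \<le> s / 2 / 2"
    proof -
      have "(2::real) ^ (j0 + i) * e \<le> 2 ^ (j0 + J) * e"
        using e Suc.prems by (intro mult_right_mono power_increasing) auto
      then show ?thesis using small s by simp
    qed
    ultimately obtain q' where q': "boost_state (Suc (j0 + i)) (\<kappa> + (s / 2)\<^sup>2 / 4) q'"
      using boost_step[OF st(1), of "s / 2"] s by auto
    have "1 / (\<theta> + (\<kappa> + (s / 2)\<^sup>2 / 4)) = 1 / (s * (1 + s / 16))"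
      by (simp add: s_def power2_eq_square algebra_simps)
    also have "\<dots> \<le> 1 / s - 1 / 32"
    proof -
      have "s * s \<le> 16 * s" using s by (intro mult_right_mono) auto
      then have "1 \<le> (1 / s - 1 / 32) * (s * (1 + s / 16))" using s by (simp add: field_simps)
      then show ?thesis using s by (subst pos_divide_le_eq) auto
    qed
    also have "\<dots> \<le> 1 / \<theta> - real (Suc i) / 32" using st(3) by (simp add: s_def add_divide_distrib)
    finally have "1 / (\<theta> + (\<kappa> + (s / 2)\<^sup>2 / 4)) \<le> 1 / \<theta> - real (Suc i) / 32" .
    moreover have "\<kappa>0 \<le> \<kappa> + (s / 2)\<^sup>2 / 4" using st(2) by (simp add: add_increasing2)
    ultimately show ?case using q' by (intro exI[of _ "\<kappa> + (s / 2)\<^sup>2 / 4"] exI[of _ q']) auto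
  qed
  from this[of J] obtain \<kappa> where \<kappa>: "\<kappa>0 \<le> \<kappa>" "1 / (\<theta> + \<kappa>) \<le> 1 / \<theta> - real J / 32" by auto
  have "1 / \<theta> - real J / 32 \<le> 0" using J by simp
  moreover have "1 / (\<theta> + \<kappa>) > 0" using \<kappa> \<kappa>0 \<theta> by simp
  ultimately show False using \<kappa> by linarith
qed

text \<open>
  The parts under \<open>1 - q\<close> nearly coincide, and \<open>q a\<close> has absolute coefficient sum at most \<open>1 - \<kappa>\<close>.
\<close>

lemma boost_close:
  assumes state: "boost_state j \<kappa> q" and a: "a \<in> \<S>" and small: "cmod (residual q x) \<le> l"
  shows "cmod (trig_poly d \<Lambda> a x - trig_poly d \<Lambda> g x) \<le> 1 - \<kappa> + l + 2 ^ j * e"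
proof -
  have q: "0 \<le> q k" "q k \<le> 1" if "k \<in> \<Lambda>" for k using state that by (auto simp: boost_state_def)
  have "trig_poly d \<Lambda> a x - trig_poly d \<Lambda> g x =
      (trig_poly d \<Lambda> (\<lambda>k. of_real (q k) * a k) x - residual q x) +
      trig_poly d \<Lambda> (\<lambda>k. of_real (1 - q k) * (a k - g k)) x"
    unfolding residual_def trig_poly_diff[symmetric] trig_poly_add[symmetric]
    by (simp add: algebra_simps)
  also have "cmod \<dots> \<le> ((1 - \<kappa>) + l) + (2 ^ j - 1) * e"
  proof (intro norm_triangle_le add_mono norm_triangle_le_diff small)
    have "cmod (trig_poly d \<Lambda> (\<lambda>k. of_real (q k) * a k) x) \<le> (\<Sum>k\<in>\<Lambda>. cmod (of_real (q k) * a k))"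
      by (rule norm_trig_poly_le)
    also have "\<dots> = (\<Sum>k\<in>\<Lambda>. cmod (a k)) - (\<Sum>k\<in>\<Lambda>. (1 - q k) * cmod (a k))"
      using q by (simp add: sum_subtractf[symmetric] norm_mult algebra_simps)
    also have "\<dots> \<le> 1 - \<kappa>" using coeffs[OF a] state a by (intro diff_mono) (auto simp: boost_state_def)
    finally show "cmod (trig_poly d \<Lambda> (\<lambda>k. of_real (q k) * a k) x) \<le> 1 - \<kappa>" .
    show "cmod (trig_poly d \<Lambda> (\<lambda>k. of_real (1 - q k) * (a k - g k)) x) \<le> (2 ^ j - 1) * e"
      using state a by (auto simp: boost_state_def)
  qed
  also have "\<dots> \<le> 1 - \<kappa> + l + 2 ^ j * e" using e by (simp add: algebra_simps)
  finally show ?thesis .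
qed

end

section \<open>From closeness in measure to recovery\<close>

text \<open>
  One set of frequencies serves the whole class, so that boosting can work with finite sums.
\<close>

lemma F_class_trig_approx:
  assumes \<alpha>: "0 < \<alpha>" "\<alpha> \<le> 1" and \<rho>: "\<rho> > 0"
  shows "\<exists>R. \<forall>f\<in>F_class \<alpha> d. \<exists>a. (\<Sum>k\<in>freq_box d R. cmod (a k)) \<le> 1 \<and>
     (\<forall>x\<in>cube d. cmod (f x - trig_poly d (freq_box d R) a x) \<le> \<rho>)"
proof -
  define \<delta> where "\<delta> = (\<rho> / 2) powr (1 / \<alpha>)"
  define R where "R = nat \<lceil>real d / \<delta>\<^sup>2\<rceil> + 1"
  have \<delta>: "\<delta> > 0" "2 * \<delta> powr \<alpha> = \<rho>" using \<alpha> \<rho> by (auto simp: \<delta>_def powr_powr)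
  have "real d / \<delta>\<^sup>2 \<le> real R" unfolding R_def by linarith
  then have R: "R > 0" "real d \<le> real R * \<delta>\<^sup>2" using \<delta> by (auto simp: R_def field_simps)
  show ?thesis using fejer_approximation[OF _ \<alpha> \<delta>(1) R] \<delta>(2) by (intro exI[of _ R]) auto
qed

lemma F_class_le_1:
  assumes \<alpha>: "0 < \<alpha>" "\<alpha> \<le> 1" and f: "f \<in> F_class \<alpha> d" and x: "x \<in> cube d"
  shows "cmod (f x) \<le> 1"
proof (rule field_le_epsilon)
  fix \<rho> :: real assume "\<rho> > 0"
  then obtain R a where a: "(\<Sum>k\<in>freq_box d R. cmod (a k)) \<le> 1"
    "cmod (f x - trig_poly d (freq_box d R) a x) \<le> \<rho>"
    using F_class_trig_approx[OF \<alpha>] f x by meson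
  then show "cmod (f x) \<le> 1 + \<rho>"
    using norm_trig_poly_le[of d "freq_box d R" a x]
      norm_triangle_ineq[of "trig_poly d (freq_box d R) a x" "f x - trig_poly d (freq_box d R) a x"] by simp
qed

text \<open>
  The measures \<open>\<nu> i\<close> remain free. They are chosen proportional to \<open>4 ^ i\<close> for small \<open>p\<close>, where all levels
  cost the same, and to \<open>8 ^ i\<close> for large \<open>p\<close>, where the cost decreases geometrically, so that the
  number of levels does not matter.
\<close>

lemma sampling_levels:
  assumes \<alpha>: "0 < \<alpha>" "\<alpha> \<le> 1"
  shows "\<exists>C>0. \<forall>d I (\<nu> :: nat \<Rightarrow> real). 1 \<le> d \<longrightarrow> (\<forall>i. 0 < \<nu> i) \<longrightarrow>
    (\<exists>xs. set xs \<subseteq> cube d \<and>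
       real (length xs) \<le> (\<Sum>i\<le>I. C * (real d)\<^sup>2 * (1 + ln (real d) + real i)\<^sup>2 * 4 ^ i / \<nu> i) \<and>
       (\<forall>i\<le>I. resolves \<alpha> d xs ((1 / 2) ^ i) (\<nu> i)))"
proof -
  obtain C where C: "C > 0" and all: "\<forall>d l \<nu>. 1 \<le> d \<longrightarrow> 0 < l \<longrightarrow> l \<le> 1 \<longrightarrow> 0 < \<nu> \<longrightarrow>
    (\<exists>xs. set xs \<subseteq> cube d \<and>
       real (length xs) \<le> C * (real d)\<^sup>2 * (1 + ln (real d) + ln (1 / l))\<^sup>2 / (l\<^sup>2 * \<nu>) \<and>
       resolves \<alpha> d xs l \<nu>)"
    using sampling_level[OF \<alpha>] by (elim exE conjE) (rule that)
  note level = all[rule_format]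
  show ?thesis
  proof (intro exI[of _ C] conjI allI impI C)
    fix d I :: nat and \<nu> :: "nat \<Rightarrow> real" assume d: "1 \<le> d" and \<nu>: "\<forall>i. 0 < \<nu> i"
    define Q where "Q i xs \<longleftrightarrow> set xs \<subseteq> cube d \<and>
       real (length xs) \<le> C * (real d)\<^sup>2 * (1 + ln (real d) + real i)\<^sup>2 * 4 ^ i / \<nu> i \<and>
       resolves \<alpha> d xs ((1 / 2) ^ i) (\<nu> i)" for i xs
    have "\<exists>xs. Q i xs" for i
    proof -
      obtain xs where xs: "set xs \<subseteq> cube d"
        "real (length xs) \<le> C * (real d)\<^sup>2 * (1 + ln (real d) + ln (1 / (1 / 2) ^ i))\<^sup>2 / (((1 / 2) ^ i)\<^sup>2 * \<nu> i)"
        "resolves \<alpha> d xs ((1 / 2) ^ i) (\<nu> i)"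
        using level[OF d, of "(1 / 2) ^ i" "\<nu> i"] \<nu> by (auto simp: power_le_one)
      have lnp: "ln (1 / (1 / 2) ^ i) \<le> real i" "0 \<le> ln (1 / (1 / 2) ^ i :: real)"
        using ln_2_less_1 by (auto simp: power_one_over ln_realpow mult_left_le)
      have pw: "((1 / 2 :: real) ^ i)\<^sup>2 = 1 / 4 ^ i" by (simp add: power_one_over power_mult[symmetric] mult.commute[of i] power_mult)
      have "C * (real d)\<^sup>2 * (1 + ln (real d) + ln (1 / (1 / 2) ^ i))\<^sup>2 / (((1 / 2) ^ i)\<^sup>2 * \<nu> i) \<le>
          C * (real d)\<^sup>2 * (1 + ln (real d) + real i)\<^sup>2 / (((1 / 2) ^ i)\<^sup>2 * \<nu> i)"
        using C d lnp \<nu>[rule_format, of i] by (intro divide_right_mono mult_left_mono power_mono) auto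
      also have "\<dots> = C * (real d)\<^sup>2 * (1 + ln (real d) + real i)\<^sup>2 * 4 ^ i / \<nu> i"
        unfolding pw by simp
      finally show ?thesis using xs by (intro exI[of _ xs]) (auto simp: Q_def)
    qed
    then obtain X where "\<And>i. Q i (X i)" by metis
    then have X: "set (X i) \<subseteq> cube d"
       "real (length (X i)) \<le> C * (real d)\<^sup>2 * (1 + ln (real d) + real i)\<^sup>2 * 4 ^ i / \<nu> i"
       "resolves \<alpha> d (X i) ((1 / 2) ^ i) (\<nu> i)" for i
      by (auto simp: Q_def)
    define xs where "xs = concat (map X [0..<Suc I])"
    have set_xs: "set xs = (\<Union>i\<le>I. set (X i))"
      by (simp add: xs_def atLeast0LessThan lessThan_Suc_atMost del: upt_Suc)
    have "length xs = (\<Sum>i\<le>I. length (X i))"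
      by (simp add: xs_def length_concat comp_def sum_list_sum_nth interv_sum_list_conv_sum_set_nat atLeast0LessThan lessThan_Suc_atMost del: upt_Suc)
    then have "real (length xs) \<le> (\<Sum>i\<le>I. C * (real d)\<^sup>2 * (1 + ln (real d) + real i)\<^sup>2 * 4 ^ i / \<nu> i)"
      using X(2) by (simp add: sum_mono)
    moreover have "resolves \<alpha> d xs ((1 / 2) ^ i) (\<nu> i)" if "i \<le> I" for i
      using that set_xs by (intro resolves_mono[OF X(3)]) auto
    ultimately show "\<exists>xs. set xs \<subseteq> cube d \<and>
       real (length xs) \<le> (\<Sum>i\<le>I. C * (real d)\<^sup>2 * (1 + ln (real d) + real i)\<^sup>2 * 4 ^ i / \<nu> i) \<and>
       (\<forall>i\<le>I. resolves \<alpha> d xs ((1 / 2) ^ i) (\<nu> i))"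
      using X(1) set_xs by (intro exI[of _ xs]) auto
  qed
qed

lemma dyadic_level:
  assumes "(1 / 2) ^ I < (t :: real)" "t \<le> 1"
  shows "\<exists>i\<in>{1..I}. (1 / 2) ^ i < t \<and> t \<le> 2 * (1 / 2) ^ i"
proof -
  define i where "i = (LEAST i. (1 / 2) ^ i < t)"
  have i: "(1 / 2) ^ i < t" unfolding i_def using assms(1) by (rule LeastI)
  have "i \<le> I" unfolding i_def using assms(1) by (rule Least_le)
  have "i \<noteq> 0" using i assms(2) by (intro notI) simp
  then have "\<not> (1 / 2) ^ (i - 1) < t" unfolding i_def using not_less_Least[of "i - 1" "\<lambda>i. (1 / 2) ^ i < t"]
    by (simp add: i_def)
  moreover have "(1 / 2 :: real) ^ (i - 1) = 2 * (1 / 2) ^ i" using \<open>i \<noteq> 0\<close> by (cases i) auto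
  ultimately show ?thesis using i \<open>i \<le> I\<close> \<open>i \<noteq> 0\<close> by (intro bexI[of _ i]) auto
qed

text \<open>
  Pointwise, \<open>h\<close> is below the lowest level, or above 1, or within a factor 2 above one of the levels.
\<close>

lemma dyadic_layers_bound:
  fixes h :: "(nat \<Rightarrow> real) \<Rightarrow> real"
  assumes [measurable]: "h \<in> borel_measurable (cube_measure d)" "D \<in> sets (cube_measure d)"
    and h: "\<And>x. x \<in> cube d \<Longrightarrow> 0 \<le> h x" "\<And>x. x \<in> D \<Longrightarrow> h x \<le> B" and p: "0 < p" and B: "0 \<le> B"
    and level: "\<And>i. i \<le> I \<Longrightarrow> measure (cube_measure d) {x\<in>cube d. (1 / 2) ^ i < h x} \<le> \<nu> i"
  shows "(LINT x|cube_measure d. indicator D x * h x powr p) \<le>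
     ((1 / 2) ^ I) powr p + B powr p * \<nu> 0 + (\<Sum>i\<in>{1..I}. (2 * (1 / 2) ^ i) powr p * \<nu> i)"
proof -
  interpret prob_space "cube_measure d" by (rule prob_space_cube_measure)
  define L where "L i = {x\<in>cube d. (1 / 2) ^ i < h x}" for i
  have L [measurable]: "L i \<in> sets (cube_measure d)" for i
    unfolding L_def space_cube_measure[symmetric] by measurable
  have ind: "integrable (cube_measure d) (\<lambda>x. c * indicator (L i) x)" for i and c :: real
    by (intro integrable_mult_right integrable_real_indicator) (auto simp: emeasure_eq_measure)
  let ?U = "\<lambda>x. ((1 / 2) ^ I) powr p + B powr p * indicator (L 0) x + (\<Sum>i\<in>{1..I}. (2 * (1 / 2) ^ i) powr p * indicator (L i) x)"
  have U_int: "integrable (cube_measure d) ?U"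
    using ind by (intro Bochner_Integration.integrable_add Bochner_Integration.integrable_sum) auto
  have pointwise: "indicator D x * h x powr p \<le> ?U x" if x: "x \<in> space (cube_measure d)" for x
  proof (cases "x \<in> D")
    case False
    then show ?thesis by (auto intro!: add_nonneg_nonneg sum_nonneg)
  next
    case True
    have xc: "x \<in> cube d" using x by (simp add: space_cube_measure)
    have s0: "(\<Sum>i\<in>{1..I}. (2 * (1 / 2) ^ i) powr p * indicator (L i) x) \<ge> 0" by (intro sum_nonneg) auto
    consider "h x \<le> (1 / 2) ^ I" | "1 < h x" | "(1 / 2) ^ I < h x" "h x \<le> 1" by linarith
    then show ?thesis
    proof cases
      case 1
      then have "h x powr p \<le> ((1 / 2) ^ I) powr p" using h(1)[OF xc] p by (intro powr_mono2) auto
      then show ?thesis using True s0 by (simp add: add_increasing2 indicator_def)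
    next
      case 2
      then have "x \<in> L 0" using xc by (simp add: L_def)
      moreover have "h x powr p \<le> B powr p" using h(1)[OF xc] h(2)[OF True] p by (intro powr_mono2) auto
      ultimately show ?thesis using True s0 by (simp add: add_increasing add_increasing2)
    next
      case 3
      then obtain i where i: "i \<in> {1..I}" "(1 / 2) ^ i < h x" "h x \<le> 2 * (1 / 2) ^ i"
        using dyadic_level by blast
      have "h x powr p \<le> (2 * (1 / 2) ^ i) powr p * indicator (L i) x"
        using i h(1)[OF xc] p xc by (auto simp: L_def intro!: powr_mono2)
      also have "\<dots> \<le> (\<Sum>i\<in>{1..I}. (2 * (1 / 2) ^ i) powr p * indicator (L i) x)"
        using i by (intro member_le_sum) auto
      finally show ?thesis using True by (simp add: add_increasing add_increasing2 indicator_def)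
    qed
  qed
  have "(LINT x|cube_measure d. indicator D x * h x powr p) \<le> (LINT x|cube_measure d. ?U x)"
    using pointwise by (intro integral_mono' U_int) (auto intro!: add_nonneg_nonneg sum_nonneg)
  also have "\<dots> = ((1 / 2) ^ I) powr p + B powr p * prob (L 0) + (\<Sum>i\<in>{1..I}. (2 * (1 / 2) ^ i) powr p * prob (L i))"
  proof -
    have 1: "integrable (cube_measure d) (\<lambda>x. ((1 / 2) ^ I) powr p + B powr p * indicator (L 0) x)"
      using ind by (intro Bochner_Integration.integrable_add) auto
    have 2: "integrable (cube_measure d) (\<lambda>x. \<Sum>i\<in>{1..I}. (2 * (1 / 2) ^ i) powr p * indicator (L i) x)"
      using ind by (intro Bochner_Integration.integrable_sum)
    have L_int: "(LINT x|cube_measure d. c * indicator (L i) x) = c * prob (L i)" for c :: real and i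
      by (simp add: sets.Int_space_eq2)
    have "(LINT x|cube_measure d. ((1 / 2) ^ I) powr p + B powr p * indicator (L 0) x) =
        ((1 / 2) ^ I) powr p + B powr p * prob (L 0)"
      using ind by (subst Bochner_Integration.integral_add) (simp_all only: L_int, auto simp: prob_space)
    moreover have "(LINT x|cube_measure d. (\<Sum>i\<in>{1..I}. (2 * (1 / 2) ^ i) powr p * indicator (L i) x)) =
        (\<Sum>i\<in>{1..I}. (2 * (1 / 2) ^ i) powr p * prob (L i))"
      using ind by (subst Bochner_Integration.integral_sum) (simp_all only: L_int)
    ultimately show ?thesis using Bochner_Integration.integral_add[OF 1 2] by (simp only:)
  qed
  also have "\<dots> \<le> ((1 / 2) ^ I) powr p + B powr p * \<nu> 0 + (\<Sum>i\<in>{1..I}. (2 * (1 / 2) ^ i) powr p * \<nu> i)"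
    using level level[of 0] by (intro add_mono mult_left_mono sum_mono) (auto simp: L_def)
  finally show ?thesis .
qed

lemma bounded_in_Lp_space:
  assumes [measurable]: "\<phi> \<in> borel_measurable (cube_measure d)"
    and "\<And>x. x \<in> cube d \<Longrightarrow> cmod (\<phi> x) \<le> B" and "0 < p"
  shows "\<phi> \<in> Lp_space p d"
  unfolding Lp_space_def
  using assms by (auto intro!: integrable_cube_bounded[where B = "B powr p"] powr_mono2)

text \<open>
  A recovery map only has to treat each fibre of the sampling map separately, and any element \<open>g\<close> of
  the fibre may be used to describe it. Data that no function produces are sent to 0.
\<close>

lemma recoverableI:
  assumes xs: "set xs \<subseteq> cube d" and p: "0 < p" and \<epsilon>: "0 \<le> \<epsilon>"
    and ex: "\<And>g. g \<in> F \<Longrightarrow> \<exists>\<phi>\<in>Lp_space p d. \<forall>f\<in>F. map f xs = map g xs \<longrightarrow>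
       (LINT x|cube_measure d. cmod (f x - \<phi> x) powr p) \<le> \<epsilon> powr p"
  shows "recoverable p d F \<epsilon> (length xs)"
proof -
  have "\<forall>g\<in>F. \<exists>\<phi>. \<phi> \<in> Lp_space p d \<and> (\<forall>f\<in>F. map f xs = map g xs \<longrightarrow>
       (LINT x|cube_measure d. cmod (f x - \<phi> x) powr p) \<le> \<epsilon> powr p)"
    using ex by blast
  from bchoice[OF this] obtain \<Phi> where \<Phi>: "\<And>g. g \<in> F \<Longrightarrow> \<Phi> g \<in> Lp_space p d"
    "\<And>f g. g \<in> F \<Longrightarrow> f \<in> F \<Longrightarrow> map f xs = map g xs \<Longrightarrow>
       (LINT x|cube_measure d. cmod (f x - \<Phi> g x) powr p) \<le> \<epsilon> powr p"
    by blast
  define sel where "sel ys = (SOME g. g \<in> F \<and> map g xs = ys)" for ys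
  define \<phi> where "\<phi> ys = (if \<exists>g\<in>F. map g xs = ys then \<Phi> (sel ys) else (\<lambda>x. 0))" for ys
  have sel: "sel ys \<in> F \<and> map (sel ys) xs = ys" if "\<exists>g\<in>F. map g xs = ys" for ys
    unfolding sel_def using that someI_ex[of "\<lambda>g. g \<in> F \<and> map g xs = ys"] by blast
  have zero: "(\<lambda>x. 0) \<in> Lp_space p d" using p by (intro bounded_in_Lp_space[where B = 0]) auto
  show ?thesis
    unfolding recoverable_def
  proof (intro exI[of _ xs] exI[of _ \<phi>] conjI allI impI ballI refl xs)
    show "\<phi> ys \<in> Lp_space p d" for ys using sel \<Phi>(1) zero by (auto simp: \<phi>_def)
    fix f assume f: "f \<in> F"
    then have fib: "\<exists>g\<in>F. map g xs = map f xs" by blast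
    then have "(LINT x|cube_measure d. cmod (f x - \<phi> (map f xs) x) powr p) \<le> \<epsilon> powr p"
      using \<Phi>(2)[OF conjunct1[OF sel[OF fib]] f] sel[OF fib] by (simp add: \<phi>_def)
    then have "Lp_norm p d (\<lambda>x. f x - \<phi> (map f xs) x) \<le> (\<epsilon> powr p) powr (1 / p)"
      unfolding Lp_norm_def using p by (intro powr_mono2) (auto intro!: integral_nonneg_AE)
    also have "\<dots> = \<epsilon>" using p \<epsilon> by (simp add: powr_powr)
    finally show "Lp_norm p d (\<lambda>x. f x - \<phi> (map f xs) x) \<le> \<epsilon>" .
  qed
qed

lemma info_complexity_le:
  assumes "recoverable p d F \<epsilon> n" "real n \<le> b"
  shows "ereal_of_enat (info_complexity p d F \<epsilon>) \<le> ereal b"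
proof -
  have "info_complexity p d F \<epsilon> \<le> enat n" unfolding info_complexity_def using assms(1) by (intro INF_lower) auto
  then have "ereal_of_enat (info_complexity p d F \<epsilon>) \<le> ereal_of_enat (enat n)" by (simp only: ereal_of_enat_le_iff)
  also have "\<dots> \<le> ereal b" using assms(2) by simp
  finally show ?thesis .
qed

lemma F_class_in_Lp_space:
  assumes "0 < \<alpha>" "\<alpha> \<le> 1" "f \<in> F_class \<alpha> d" "0 < p"
  shows "f \<in> Lp_space p d"
  using assms F_class_le_1 by (intro bounded_in_Lp_space[where B = 1]) (auto simp: F_class_measurable)

section \<open>Recovery for large exponents\<close>

text \<open>
  On a visible set \<open>G\<close> the difference is at most \<open>2 * \<tau>\<close> outside a set of measure \<open>m\<close>, where it is at
  most 2. Translation invariance makes \<open>m\<close> independent of the shift.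
\<close>

lemma visible_boosting_of_fibre:
  assumes \<alpha>: "0 < \<alpha>" "\<alpha> \<le> 1" and g: "g \<in> T"
    and approx: "\<And>f. f \<in> T \<Longrightarrow> (\<Sum>k\<in>\<Lambda>. cmod (A f k)) \<le> 1"
      "\<And>f x. f \<in> T \<Longrightarrow> x \<in> cube d \<Longrightarrow> cmod (f x - trig_poly d \<Lambda> (A f) x) \<le> \<rho>"
    and meas: "\<And>f. f \<in> T \<Longrightarrow> f \<in> borel_measurable (cube_measure d)"
    and \<rho>: "2 * \<rho> \<le> \<tau>" and \<tau>: "\<tau> > 0" and \<nu>: "\<nu> > 0"
    and level: "\<And>f. f \<in> T \<Longrightarrow> measure (cube_measure d) {x\<in>cube d. \<tau> < cmod (f x - g x)} \<le> m"
  shows "visible_boosting d \<Lambda> (A ` T) (A g) \<nu> (2 * \<tau> + 2 * m / \<nu>)"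
proof
  interpret prob_space "cube_measure d" by (rule prob_space_cube_measure)
  have m: "m \<ge> 0" using level[OF g] measure_nonneg order.trans by blast
  show "A g \<in> A ` T" using g by blast
  show "(\<Sum>k\<in>\<Lambda>. cmod (a k)) \<le> 1" if "a \<in> A ` T" for a using that approx by auto
  show "\<nu> > 0" by fact
  show "2 * \<tau> + 2 * m / \<nu> \<ge> 0" using m \<tau> \<nu> by simp
  fix a c G
  assume a: "a \<in> A ` T" and G [measurable]: "G \<in> sets (cube_measure d)" and big: "\<nu> \<le> measure (cube_measure d) G"
  then obtain f where f: "f \<in> T" "a = A f" by blast
  define b where "b = (\<lambda>k. a k - A g k)"
  define h where "h = trig_poly d \<Lambda> b"
  have h_meas [measurable]: "(\<lambda>y. h (\<lambda>i. c i + y i)) \<in> borel_measurable (cube_measure d)"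
    unfolding h_def by measurable
  have h_le: "cmod (h x) \<le> 2" for x
    using norm_trig_poly_le[of d \<Lambda> a x] norm_trig_poly_le[of d \<Lambda> "A g" x] approx(1)[OF f(1)] approx(1)[OF g]
      norm_triangle_ineq4[of "trig_poly d \<Lambda> a x" "trig_poly d \<Lambda> (A g) x"]
    unfolding h_def b_def trig_poly_diff f by linarith
  define S where "S = {y\<in>cube d. 2 * \<tau> < cmod (h (\<lambda>i. c i + y i))}"
  have S [measurable]: "S \<in> sets (cube_measure d)" unfolding S_def space_cube_measure[symmetric] by measurable
  have "prob S = prob {y\<in>cube d. 2 * \<tau> < cmod (h y)}"
    unfolding S_def h_def by (rule measure_trig_poly_translate)
  also have "\<dots> \<le> prob {x\<in>cube d. \<tau> < cmod (f x - g x)}"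
  proof (rule finite_measure_mono)
    show "{y\<in>cube d. 2 * \<tau> < cmod (h y)} \<subseteq> {x\<in>cube d. \<tau> < cmod (f x - g x)}"
    proof safe
      fix y assume y: "y \<in> cube d" "2 * \<tau> < cmod (h y)"
      have "h y = (f y - g y) - ((f y - trig_poly d \<Lambda> (A f) y) - (g y - trig_poly d \<Lambda> (A g) y))"
        unfolding h_def b_def trig_poly_diff f by simp
      also have "cmod \<dots> \<le> cmod (f y - g y) + (\<rho> + \<rho>)"
        using approx(2)[OF f(1) y(1)] approx(2)[OF g y(1)]
          norm_triangle_ineq4[of "f y - g y" "(f y - trig_poly d \<Lambda> (A f) y) - (g y - trig_poly d \<Lambda> (A g) y)"]
          norm_triangle_ineq4[of "f y - trig_poly d \<Lambda> (A f) y" "g y - trig_poly d \<Lambda> (A g) y"]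
        by linarith
      finally show "\<tau> < cmod (f y - g y)" using y(2) \<rho> by simp
    qed
    have [measurable]: "f \<in> borel_measurable (cube_measure d)" "g \<in> borel_measurable (cube_measure d)"
      using meas f g by auto
    show "{x\<in>cube d. \<tau> < cmod (f x - g x)} \<in> sets (cube_measure d)"
      unfolding space_cube_measure[symmetric] by measurable
  qed
  also have "\<dots> \<le> m" by (rule level[OF f(1)])
  finally have S_le: "prob S \<le> m" .
  have ind: "integrable (cube_measure d) (\<lambda>y. 2 * \<tau> * indicator G y)" "integrable (cube_measure d) (\<lambda>y. 2 * indicator S y :: real)"
    by (auto intro!: integrable_mult_right integrable_real_indicator simp: emeasure_eq_measure)
  have "(LINT y|cube_measure d. indicator G y * cmod (h (\<lambda>i. c i + y i))) \<le>
      (LINT y|cube_measure d. 2 * \<tau> * indicator G y + 2 * indicator S y)"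
  proof (rule integral_mono)
    show "integrable (cube_measure d) (\<lambda>y. indicator G y * cmod (h (\<lambda>i. c i + y i)))"
      by (intro integrable_cube_bounded[where B = 2]) (auto simp: indicator_def h_le)
    show "integrable (cube_measure d) (\<lambda>y. 2 * \<tau> * indicator G y + 2 * indicator S y)"
      using ind by (rule Bochner_Integration.integrable_add)
    fix y assume "y \<in> space (cube_measure d)"
    then show "indicator G y * cmod (h (\<lambda>i. c i + y i)) \<le> 2 * \<tau> * indicator G y + 2 * indicator S y"
      using h_le[of "\<lambda>i. c i + y i"] \<tau> by (auto simp: indicator_def S_def space_cube_measure)
  qed
  also have "\<dots> = 2 * \<tau> * prob G + 2 * prob S"
    using ind by (subst Bochner_Integration.integral_add) (auto simp: sets.Int_space_eq2)
  also have "\<dots> \<le> 2 * \<tau> * prob G + 2 * m * (prob G / \<nu>)"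
  proof -
    have "m * 1 \<le> m * (prob G / \<nu>)" using m big \<nu> by (intro mult_left_mono) auto
    then show ?thesis using S_le by simp
  qed
  also have "\<dots> = (2 * \<tau> + 2 * m / \<nu>) * prob G" by (simp add: algebra_simps)
  finally show "(LINT y|cube_measure d. indicator G y * cmod (trig_poly d \<Lambda> (\<lambda>k. a k - A g k) (\<lambda>i. c i + y i)))
      \<le> (2 * \<tau> + 2 * m / \<nu>) * prob G"
    by (simp only: h_def b_def)
qed

lemma ln_ge_half: "2 \<le> x \<Longrightarrow> 1 / 2 \<le> ln (x::real)"
  using ln_ge_iff[of x "1 / 2"] exp_half_le2 by simp

lemma geometric_layers_le:
  assumes "p \<ge> 4" "\<mu> \<ge> 0"
  shows "(\<Sum>i\<in>{1..I}. (2 * (1 / 2) ^ i) powr p * (\<mu> * 8 ^ i)) \<le> 16 * (\<mu> :: real)"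
proof -
  have "(\<Sum>i\<in>{1..I}. (2 * (1 / 2) ^ i) powr p * (\<mu> * 8 ^ i)) \<le> (\<Sum>i\<in>{1..I}. 16 * \<mu> * (1 / 2) ^ i)"
  proof (intro sum_mono)
    fix i assume "i \<in> {1..I}"
    then have "(1 / 2 :: real) ^ i \<le> (1 / 2) ^ 1" by (intro power_decreasing) auto
    then have le1: "2 * (1 / 2 :: real) ^ i \<le> 1" by simp
    have "(2 * (1 / 2 :: real) ^ i) powr p \<le> (2 * (1 / 2) ^ i) powr 4" using le1 assms by (intro powr_mono') auto
    also have "\<dots> = (2 * (1 / 2) ^ i) ^ 4" by (subst powr_numeral) auto
    also have "\<dots> = 16 * (1 / 16) ^ i"
    proof -
      have "((1 / 2 :: real) ^ i) ^ 4 = ((1 / 2) ^ 4) ^ i" by (simp only: power_mult[symmetric] mult.commute)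
      then show ?thesis unfolding power_mult_distrib by (simp add: power_one_over)
    qed
    finally have "(2 * (1 / 2 :: real) ^ i) powr p * (\<mu> * 8 ^ i) \<le> 16 * (1 / 16) ^ i * (\<mu> * 8 ^ i)"
      using assms by (intro mult_right_mono) auto
    also have "\<dots> = 16 * \<mu> * ((1 / 16) * 8) ^ i" by (simp only: power_mult_distrib) simp
    finally show "(2 * (1 / 2 :: real) ^ i) powr p * (\<mu> * 8 ^ i) \<le> 16 * \<mu> * (1 / 2) ^ i" by simp
  qed
  also have "\<dots> = 16 * \<mu> * (\<Sum>i\<in>{1..I}. (1 / 2) ^ i)" by (simp add: sum_distrib_left)
  also have "(\<Sum>i\<in>{1..I}. (1 / 2 :: real) ^ i) \<le> 1"
  proof -
    have "(\<Sum>i\<in>{1..I}. (1 / 2 :: real) ^ i) = 1 - (1 / 2) ^ I" by (induction I) auto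
    then show ?thesis by simp
  qed
  finally show ?thesis using assms by (simp add: mult_left_mono)
qed

text \<open>
  The layers with \<open>i \<ge> 1\<close> contribute a convergent geometric series because \<open>p \<ge> 4\<close> outweighs \<open>8 ^ i\<close>.
  On \<open>D\<close> the values of \<open>\<bar>f - g\<bar>\<close> above 1 are counted with the bound \<open>B\<close>; off \<open>D\<close> the error is \<open>\<bar>f\<bar>\<close>.
\<close>

lemma hard_threshold_recovery:
  assumes \<alpha>: "0 < \<alpha>" "\<alpha> \<le> 1" and p: "p \<ge> 4" and T: "T \<subseteq> F_class \<alpha> d" and g: "g \<in> T" and f: "f \<in> T"
    and D: "D \<in> sets (cube_measure d)" and \<mu>: "\<mu> \<ge> 0"
    and level: "\<And>i. i \<le> I \<Longrightarrow> measure (cube_measure d) {x\<in>cube d. (1 / 2) ^ i < cmod (f x - g x)} \<le> \<mu> * 8 ^ i"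
    and close: "\<And>x. x \<in> D \<Longrightarrow> cmod (f x - g x) \<le> B" and B: "B \<ge> 0"
    and off: "(LINT x|cube_measure d. indicator (cube d - D) x * cmod (f x) powr p) \<le> \<beta>"
  shows "(LINT x|cube_measure d. cmod (f x - indicator D x * g x) powr p) \<le>
     ((1 / 2) ^ I) powr p + B powr p * \<mu> + 16 * \<mu> + \<beta>"
proof -
  have F: "f \<in> F_class \<alpha> d" "g \<in> F_class \<alpha> d" using T f g by auto
  have [measurable]: "f \<in> borel_measurable (cube_measure d)" "g \<in> borel_measurable (cube_measure d)"
    using F by (auto intro: F_class_measurable)
  note D [measurable]
  have D_sub: "D \<subseteq> cube d" using sets.sets_into_space[OF D] by (simp add: space_cube_measure)
  have cube_D [measurable]: "cube d - D \<in> sets (cube_measure d)" using D by (simp flip: space_cube_measure)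
  have f1: "cmod (f x) \<le> 1" "cmod (g x) \<le> 1" if "x \<in> cube d" for x
    using F_class_le_1[OF \<alpha>] F that by auto
  have int1: "integrable (cube_measure d) (\<lambda>x. indicator D x * cmod (f x - g x) powr p)"
    using B p by (intro integrable_cube_bounded[where B = "B powr p"]) (auto simp: indicator_def intro!: powr_mono2 close)
  have int2: "integrable (cube_measure d) (\<lambda>x. indicator (cube d - D) x * cmod (f x) powr p)"
    using p f1 by (intro integrable_cube_bounded[where B = 1]) (measurable, auto simp: indicator_def intro!: powr_le1)
  have "(LINT x|cube_measure d. cmod (f x - indicator D x * g x) powr p) =
      (LINT x|cube_measure d. indicator D x * cmod (f x - g x) powr p + indicator (cube d - D) x * cmod (f x) powr p)"
    using D_sub by (intro Bochner_Integration.integral_cong refl) (auto simp: indicator_def space_cube_measure)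
  also have "\<dots> = (LINT x|cube_measure d. indicator D x * cmod (f x - g x) powr p) +
      (LINT x|cube_measure d. indicator (cube d - D) x * cmod (f x) powr p)"
    by (rule Bochner_Integration.integral_add[OF int1 int2])
  also have "\<dots> \<le> (((1 / 2) ^ I) powr p + B powr p * (\<mu> * 8 ^ 0) + (\<Sum>i\<in>{1..I}. (2 * (1 / 2) ^ i) powr p * (\<mu> * 8 ^ i))) + \<beta>"
    using level close p B by (intro add_mono off dyadic_layers_bound) auto
  also have "\<dots> \<le> ((1 / 2) ^ I) powr p + B powr p * \<mu> + 16 * \<mu> + \<beta>"
    using geometric_layers_le[OF p \<mu>, of I] by simp
  finally show ?thesis .
qed

text \<open>
  The set \<open>D\<close> is where the residual is at most \<open>(\<theta> + \<kappa>) / 2\<close> at the end of the iteration.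
\<close>

lemma (in visible_boosting) boosted_set:
  assumes state: "boost_state j0 \<kappa>0 q0" and \<theta>: "0 < \<theta>" "\<theta> \<le> 1" and \<kappa>0: "0 \<le> \<kappa>0"
    and J: "32 / \<theta> \<le> real J" and small: "2 ^ (j0 + J) * e \<le> \<theta> / 4"
  shows "\<exists>D\<in>sets (cube_measure d). measure (cube_measure d) (cube d - D) < \<nu> \<and>
    (\<forall>a\<in>\<S>. \<forall>x\<in>D. cmod (trig_poly d \<Lambda> a x - trig_poly d \<Lambda> g x) \<le> 1 + 3 / 4 * \<theta> - \<kappa>0 / 2)"
proof -
  obtain j \<kappa> q where st: "boost_state j \<kappa> q" "j \<le> j0 + J" "\<kappa>0 \<le> \<kappa>"
    "measure (cube_measure d) {x\<in>cube d. (\<theta> + \<kappa>) / 2 < cmod (residual q x)} < \<nu>"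
    using boost_iterate[OF assms] by blast
  define D where "D = {x\<in>cube d. cmod (residual q x) \<le> (\<theta> + \<kappa>) / 2}"
  have [measurable]: "residual q \<in> borel_measurable (cube_measure d)" by (simp add: residual_def)
  have "D \<in> sets (cube_measure d)" unfolding D_def space_cube_measure[symmetric] by measurable
  moreover have "cube d - D = {x\<in>cube d. (\<theta> + \<kappa>) / 2 < cmod (residual q x)}" by (auto simp: D_def)
  moreover have "cmod (trig_poly d \<Lambda> a x - trig_poly d \<Lambda> g x) \<le> 1 + 3 / 4 * \<theta> - \<kappa>0 / 2"
    if "a \<in> \<S>" "x \<in> D" for a x
  proof -
    have "(2::real) ^ j * e \<le> 2 ^ (j0 + J) * e"
      using e st(2) by (intro mult_right_mono power_increasing) auto
    moreover have "cmod (trig_poly d \<Lambda> a x - trig_poly d \<Lambda> g x) \<le> 1 - \<kappa> + (\<theta> + \<kappa>) / 2 + 2 ^ j * e"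
      using that by (intro boost_close[OF st(1)]) (auto simp: D_def)
    ultimately show ?thesis using small st(3) by (simp add: field_simps)
  qed
  ultimately show ?thesis using st(4) by (intro bexI[of _ D]) auto
qed

text \<open>
  Two cases are distinguished by the set \<open>G0\<close> where the approximant of \<open>g\<close> exceeds \<open>1 / 16\<close>.

  If \<open>G0\<close> has measure at least \<open>\<mu>0\<close>, a first boosting step at the level \<open>1 / 16\<close> secures
  \<open>\<kappa> \<ge> 1 / 1024\<close>. Boosting with \<open>\<theta> = 1 / 2048\<close> then takes boundedly many steps and ends with
  \<open>\<bar>f - g\<bar> \<le> 1\<close> on \<open>D\<close>, while the complement of \<open>D\<close> has measure below \<open>\<mu>0\<close>, which is
  affordable as \<open>\<bar>f\<bar> \<le> 1\<close>.

  Otherwise \<open>g\<close>, and with it \<open>f\<close>, is at most \<open>1 / 4\<close> outside a set of measure of order \<open>\<mu>0\<close>. The complement of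
  \<open>D\<close> may then have measure \<open>\<nu> = 4 powr p * \<mu>0\<close>. Sets that large make \<open>e\<close> exponentially small in
  \<open>p\<close>, which pays for the \<open>p / 8\<close> boosting steps needed for \<open>\<theta> = 256 / p\<close>; the final bound
  \<open>\<bar>f - g\<bar> \<le> 1 + \<theta>\<close> costs only the factor \<open>(1 + \<theta>) powr p \<le> exp 256\<close>.
\<close>

lemma large_exponent_recovery:
  assumes \<alpha>: "0 < \<alpha>" "\<alpha> \<le> 1"
  shows "\<exists>\<eta>>0. \<forall>p\<ge>256. \<forall>\<epsilon> d. 0 < \<epsilon> \<longrightarrow> (\<exists>I. \<forall>T g. T \<subseteq> F_class \<alpha> d \<longrightarrow> g \<in> T \<longrightarrow>
     (\<forall>f\<in>T. \<forall>i\<le>I. measure (cube_measure d) {x\<in>cube d. (1 / 2) ^ i < cmod (f x - g x)} \<le> \<eta> * \<epsilon> powr p * 8 ^ i) \<longrightarrow>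
     (\<exists>\<phi>\<in>Lp_space p d. \<forall>f\<in>T. (LINT x|cube_measure d. cmod (f x - \<phi> x) powr p) \<le> \<epsilon> powr p))"
proof -
  \<comment> \<open>the number of steps in the first case: 32 divided by \<open>\<theta> = 1 / 2048\<close>\<close>
  define J :: nat where "J = 65536"
  have J: "32 / (1 / 2048) \<le> real J" by (simp add: J_def)
  \<comment> \<open>\<open>1 / 8192\<close> is \<open>\<theta> / 4\<close>, the error that \<open>boosted_set\<close> tolerates\<close>
  define eA :: real where "eA = 1 / 8192 / 2 ^ (1 + J)"
  have eA: "eA > 0" "2 ^ (1 + J) * eA = 1 / 8192" by (simp_all add: eA_def)
  have eA_le: "eA \<le> 1 / 8192"
    using eA mult_right_mono[of 1 "2 ^ (1 + J)" eA] one_le_power[of "2::real" "1 + J"] by linarith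
  obtain iA where iA: "(1 / 2) ^ iA < eA / 8" using real_arch_pow_inv[of "eA / 8" "1 / 2"] eA by auto
  define \<eta> where "\<eta> = min (eA / (32 * 8 ^ iA)) (1 / (4 * (exp 256 + 528)))"
  have \<eta>: "\<eta> > 0" using eA by (simp add: \<eta>_def add_pos_pos)
  have \<eta>A: "16 * \<eta> * 8 ^ iA \<le> eA / 2"
  proof -
    have "\<eta> * (32 * 8 ^ iA) \<le> eA" using eA unfolding \<eta>_def by (subst pos_le_divide_eq[symmetric]) auto
    then show ?thesis by simp
  qed
  have \<eta>B: "\<eta> * (exp 256 + 528) \<le> 1 / 4"
  proof -
    have "\<eta> * (4 * (exp 256 + 528)) \<le> 1" unfolding \<eta>_def
      by (subst pos_le_divide_eq[symmetric]) (auto intro: add_pos_pos)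
    then show ?thesis by (simp add: algebra_simps)
  qed
  have \<eta>_small: "\<eta> * 528 \<le> 1 / 4"
  proof -
    have "\<eta> * 528 \<le> \<eta> * (exp 256 + 528)" using \<eta> by (intro mult_left_mono) auto
    then show ?thesis using \<eta>B by linarith
  qed
  have main: "\<exists>I. \<forall>T g. T \<subseteq> F_class \<alpha> d \<longrightarrow> g \<in> T \<longrightarrow>
     (\<forall>f\<in>T. \<forall>i\<le>I. measure (cube_measure d) {x\<in>cube d. (1 / 2) ^ i < cmod (f x - g x)} \<le> \<eta> * \<epsilon> powr p * 8 ^ i) \<longrightarrow>
     (\<exists>\<phi>\<in>Lp_space p d. \<forall>f\<in>T. (LINT x|cube_measure d. cmod (f x - \<phi> x) powr p) \<le> \<epsilon> powr p)"
    if p: "p \<ge> 256" and \<epsilon>: "\<epsilon> > 0" for p \<epsilon> :: real and d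
  proof -
    interpret prob_space "cube_measure d" by (rule prob_space_cube_measure)
    define E where "E = \<epsilon> powr p"
    have E: "E > 0" using \<epsilon> by (simp add: E_def)
    define \<mu> where "\<mu> = \<eta> * E"
    define \<mu>0 where "\<mu>0 = E / 8"
    have \<mu>: "\<mu> > 0" "\<mu>0 > 0" using E \<eta> by (auto simp: \<mu>_def \<mu>0_def)
    have \<mu>_sum: "exp 256 * \<mu> + 528 * \<mu> \<le> E / 4"
      using mult_right_mono[OF \<eta>B, of E] E by (simp add: \<mu>_def algebra_simps)
    \<comment> \<open>at this level both \<open>(1 / 2) ^ iB\<close> and \<open>8 ^ iB / 4 powr p\<close> are of order \<open>2 powr (- p / 2)\<close>\<close>
    define iB where "iB = nat \<lceil>p / 2\<rceil>"
    obtain i1 where i1: "(1 / 2) ^ i1 < \<epsilon> / 4" using real_arch_pow_inv[of "\<epsilon> / 4" "1 / 2"] \<epsilon> by auto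
    define I where "I = iA + iB + i1 + 3"
    have tail: "((1 / 2) ^ I) powr p \<le> E / 4"
    proof -
      have "(1 / 2 :: real) ^ I \<le> (1 / 2) ^ i1" by (intro power_decreasing) (auto simp: I_def)
      also have "\<dots> \<le> \<epsilon> * (1 / 4)" using i1 by simp
      finally have "((1 / 2) ^ I) powr p \<le> (\<epsilon> * (1 / 4)) powr p" using p by (intro powr_mono2) auto
      also have "\<dots> = E * (1 / 4) powr p" using \<epsilon> by (simp add: E_def powr_mult del: times_divide_eq_right)
      also have "(1 / 4 :: real) powr p \<le> (1 / 4) powr 1" using p by (intro powr_mono') auto
      finally show ?thesis using E by simp
    qed
    \<comment> \<open>a precision far below every level in use and below \<open>\<theta> / 8\<close>\<close>
    define \<rho> where "\<rho> = min ((1 / 2) ^ (I + 15)) (32 / p)"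
    have \<rho>: "\<rho> > 0" "\<rho> \<le> 32 / p" using p by (auto simp: \<rho>_def)
    have \<rho>_le: "2 * \<rho> \<le> (1 / 2) ^ i" if "i \<le> I + 14" for i
    proof -
      have "2 * \<rho> \<le> 2 * (1 / 2) ^ (I + 15)" by (simp add: \<rho>_def)
      also have "\<dots> = (1 / 2) ^ (I + 14)" by (simp add: eval_nat_numeral)
      also have "\<dots> \<le> (1 / 2) ^ i" using that by (intro power_decreasing) auto
      finally show ?thesis .
    qed
    obtain R where R: "\<forall>f\<in>F_class \<alpha> d. \<exists>a. (\<Sum>k\<in>freq_box d R. cmod (a k)) \<le> 1 \<and>
       (\<forall>x\<in>cube d. cmod (f x - trig_poly d (freq_box d R) a x) \<le> \<rho>)"
      using F_class_trig_approx[OF \<alpha> \<rho>(1)] by blast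
    define \<Lambda> where "\<Lambda> = freq_box d R"
    from bchoice[OF R] obtain A where A: "\<And>f. f \<in> F_class \<alpha> d \<Longrightarrow> (\<Sum>k\<in>\<Lambda>. cmod (A f k)) \<le> 1"
       "\<And>f x. f \<in> F_class \<alpha> d \<Longrightarrow> x \<in> cube d \<Longrightarrow> cmod (f x - trig_poly d \<Lambda> (A f) x) \<le> \<rho>"
      unfolding \<Lambda>_def by blast
    show ?thesis
    proof (intro exI[of _ I] allI impI)
      fix T g assume T: "T \<subseteq> F_class \<alpha> d" and gT: "g \<in> T"
        and lev: "\<forall>f\<in>T. \<forall>i\<le>I. prob {x\<in>cube d. (1 / 2) ^ i < cmod (f x - g x)} \<le> \<eta> * \<epsilon> powr p * 8 ^ i"
      have level: "prob {x\<in>cube d. (1 / 2) ^ i < cmod (f x - g x)} \<le> \<mu> * 8 ^ i" if "f \<in> T" "i \<le> I" for f i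
        using lev that by (simp add: \<mu>_def E_def)
      have gF: "g \<in> F_class \<alpha> d" using T gT by auto
      have A1: "\<And>f. f \<in> T \<Longrightarrow> (\<Sum>k\<in>\<Lambda>. cmod (A f k)) \<le> 1" using A T by auto
      have A2: "\<And>f x. f \<in> T \<Longrightarrow> x \<in> cube d \<Longrightarrow> cmod (f x - trig_poly d \<Lambda> (A f) x) \<le> \<rho>" using A T by auto
      have mT: "\<And>f. f \<in> T \<Longrightarrow> f \<in> borel_measurable (cube_measure d)" using T by (auto intro: F_class_measurable)
      have vb: "visible_boosting d \<Lambda> (A ` T) (A g) \<nu> (2 * (1 / 2) ^ i + 2 * (\<mu> * 8 ^ i) / \<nu>)"
        if "\<nu> > 0" "i \<le> I" for \<nu> i
        using that level \<rho>_le[of i]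
        by (intro visible_boosting_of_fibre[OF \<alpha> gT A1 A2 mT]) auto
      have transfer: "cmod (f x - g x) \<le> c + 2 * \<rho>"
        if "f \<in> T" "x \<in> cube d" "cmod (trig_poly d \<Lambda> (A f) x - trig_poly d \<Lambda> (A g) x) \<le> c" for f x c
        using A2[OF that(1,2)] A2[OF gT that(2)] that(3)
          norm_triangle_ineq4[of "f x - trig_poly d \<Lambda> (A f) x" "g x - trig_poly d \<Lambda> (A g) x"]
          norm_triangle_ineq[of "(f x - trig_poly d \<Lambda> (A f) x) - (g x - trig_poly d \<Lambda> (A g) x)"
            "trig_poly d \<Lambda> (A f) x - trig_poly d \<Lambda> (A g) x"]
        by simp
      define G0 where "G0 = {x\<in>cube d. 1 / 16 < cmod (trig_poly d \<Lambda> (A g) x)}"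
      have G0 [measurable]: "G0 \<in> sets (cube_measure d)" unfolding G0_def space_cube_measure[symmetric] by measurable
      have "\<exists>D B. D \<in> sets (cube_measure d) \<and> 0 \<le> B \<and> (\<forall>f\<in>T. \<forall>x\<in>D. cmod (f x - g x) \<le> B) \<and>
        (\<forall>f\<in>T. (LINT x|cube_measure d. indicator (cube d - D) x * cmod (f x) powr p) \<le> 2 * \<mu>0 + 512 * \<mu>) \<and>
        B powr p \<le> exp 256"
      proof (cases "\<mu>0 \<le> prob G0")
        case True
        define e where "e = 2 * (1 / 2) ^ iA + 2 * (\<mu> * 8 ^ iA) / \<mu>0"
        interpret visible_boosting d \<Lambda> "A ` T" "A g" \<mu>0 e
          unfolding e_def using \<mu> by (intro vb) (auto simp: I_def)
        have "2 * (\<mu> * 8 ^ iA) / \<mu>0 = 16 * \<eta> * 8 ^ iA" using E by (simp add: \<mu>_def \<mu>0_def)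
        then have e_le: "e \<le> eA" using iA \<eta>A eA(1) unfolding e_def by linarith
        have "residual (\<lambda>k. 1) = trig_poly d \<Lambda> (A g)" by (simp add: residual_def)
        then obtain q where q: "boost_state (Suc 0) (0 + (1 / 16)\<^sup>2 / 4) q"
          using boost_step[OF boost_state_initial, of "1 / 16"] True e_le eA_le by (auto simp: G0_def)
        have "2 ^ (Suc 0 + J) * e \<le> 2 ^ (1 + J) * eA" using e_le by (simp add: mult_left_mono)
        then have "2 ^ (Suc 0 + J) * e \<le> (1 / 2048) / 4" unfolding eA(2) by simp
        from boosted_set[OF q _ _ _ J this]
        obtain D where D: "D \<in> sets (cube_measure d)" "prob (cube d - D) < \<mu>0"
          "\<And>a x. a \<in> A ` T \<Longrightarrow> x \<in> D \<Longrightarrow> cmod (trig_poly d \<Lambda> a x - trig_poly d \<Lambda> (A g) x) \<le> 1 + 3 / 4 * (1 / 2048) - (0 + (1 / 16)\<^sup>2 / 4) / 2"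
          by auto
        have D_sub: "x \<in> cube d" if "x \<in> D" for x using sets.sets_into_space[OF D(1)] that by (auto simp: space_cube_measure)
        have "cmod (f x - g x) \<le> 1" if "f \<in> T" "x \<in> D" for f x
        proof -
          have "2 * \<rho> \<le> (1 / 2) ^ (14 + 0)" by (rule \<rho>_le) simp
          then have "2 * \<rho> \<le> 1 / 16384" by (simp add: power_one_over)
          then show ?thesis
            using transfer[OF that(1) D_sub[OF that(2)] D(3)[OF imageI[OF that(1)] that(2)]] by (simp add: power2_eq_square)
        qed
        moreover have "(LINT x|cube_measure d. indicator (cube d - D) x * cmod (f x) powr p) \<le> 2 * \<mu>0 + 512 * \<mu>" if f: "f \<in> T" for f
        proof -
          have cD: "cube d - D \<in> sets (cube_measure d)" using D(1) by (simp flip: space_cube_measure)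
          have "(LINT x|cube_measure d. indicator (cube d - D) x * cmod (f x) powr p) \<le> (LINT x|cube_measure d. indicator (cube d - D) x)"
            using cD p F_class_le_1[OF \<alpha>, of f d] f T
            by (intro integral_mono' integrable_real_indicator)
               (auto simp: emeasure_eq_measure space_cube_measure intro!: mult_left_le powr_le1)
          also have "\<dots> = prob (cube d - D)" using cD by (simp add: sets.Int_space_eq2)
          finally show ?thesis using D(2) \<mu> by simp
        qed
        ultimately show ?thesis using D(1) by (intro exI[of _ D] exI[of _ 1]) auto
      next
        case False
        define \<theta> where "\<theta> = 256 / p"
        have \<theta>: "0 < \<theta>" "\<theta> \<le> 1" using p by (auto simp: \<theta>_def)
        define \<nu> where "\<nu> = 4 powr p * \<mu>0"
        have \<nu>: "\<nu> > 0" using \<mu> by (simp add: \<nu>_def)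
        define e where "e = 2 * (1 / 2) ^ iB + 2 * (\<mu> * 8 ^ iB) / \<nu>"
        interpret visible_boosting d \<Lambda> "A ` T" "A g" \<nu> e
          unfolding e_def using \<nu> by (intro vb) (auto simp: I_def)
        have iB: "p / 2 \<le> real iB" "real iB \<le> p / 2 + 1" using p by (auto simp: iB_def)
        have e_le: "e \<le> 3 * 2 powr (- p / 2)"
        proof -
          have "(1 / 2 :: real) ^ iB = 2 powr (- real iB)" by (simp add: powr_minus powr_realpow power_one_over inverse_eq_divide)
          also have "\<dots> \<le> 2 powr (- p / 2)" using iB by (intro powr_mono) auto
          finally have 1: "(1 / 2 :: real) ^ iB \<le> 2 powr (- p / 2)" .
          have "(8 :: real) ^ iB = 8 powr (real iB)" by (simp add: powr_realpow)
          also have "\<dots> \<le> 8 powr (p / 2 + 1)" using iB by (intro powr_mono) auto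
          also have "\<dots> = 8 * (2 powr 3) powr (p / 2)" by (simp add: powr_add)
          also have "\<dots> = 8 * (4 powr p * 2 powr (- p / 2))"
          proof -
            have "(4::real) powr p = (2 powr 2) powr p" by simp
            then show ?thesis by (simp only: powr_powr powr_add[symmetric]) (simp add: field_simps)
          qed
          finally have "2 * (\<mu> * 8 ^ iB) / \<nu> \<le> 2 * (\<mu> * (8 * (4 powr p * 2 powr (- p / 2)))) / \<nu>"
            using \<mu> \<nu> by (intro divide_right_mono mult_left_mono) auto
          also have "\<dots> = 128 * \<eta> * 2 powr (- p / 2)" using E by (simp add: \<nu>_def \<mu>_def \<mu>0_def)
          also have "\<dots> \<le> 1 * 2 powr (- p / 2)" using \<eta>_small \<eta> by (intro mult_right_mono) auto
          finally show ?thesis using 1 by (simp add: e_def)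
        qed
        define JB where "JB = nat \<lceil>p / 8\<rceil>"
        have JB: "p / 8 \<le> real JB" "real JB \<le> p / 8 + 1" using p by (auto simp: JB_def)
        have "2 ^ (0 + JB) * e \<le> \<theta> / 4"
        proof -
          have "(2::real) ^ JB = 2 powr (real JB)" by (simp add: powr_realpow)
          also have "\<dots> \<le> 2 powr (p / 8 + 1)" using JB by (intro powr_mono) auto
          also have "\<dots> = 2 * 2 powr (p / 8)" by (simp add: powr_add)
          finally have "2 ^ JB * e \<le> 2 * 2 powr (p / 8) * (3 * 2 powr (- p / 2))"
            using e_le e by (intro mult_mono) auto
          also have "\<dots> = 6 * 2 powr (- (3 / 8 * p))"
          proof -
            have "(2::real) powr (p / 8) * 2 powr (- p / 2) = 2 powr (- (3 / 8 * p))"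
              unfolding powr_add[symmetric] by (simp add: field_simps)
            then show ?thesis by simp
          qed
          also have "\<dots> \<le> 64 / p"
          proof -
            have "1 / 2 \<le> ln (2::real)" by (rule ln_ge_half) simp
            then have "3 / 16 * p \<le> 3 / 8 * p * ln 2" using p by simp
            also have "\<dots> \<le> exp (3 / 8 * p * ln 2)" using exp_ge_add_one_self[of "3 / 8 * p * ln 2"] by linarith
            also have "\<dots> = 2 powr (3 / 8 * p)" by (simp add: powr_def)
            finally have "3 / 16 * p \<le> 2 powr (3 / 8 * p)" .
            then show ?thesis using p by (simp add: powr_minus field_simps)
          qed
          finally show ?thesis by (simp add: \<theta>_def)
        qed
        moreover have "32 / \<theta> \<le> real JB" using JB p by (simp add: \<theta>_def)
        ultimately obtain D where D: "D \<in> sets (cube_measure d)" "prob (cube d - D) < \<nu>"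
          "\<And>a x. a \<in> A ` T \<Longrightarrow> x \<in> D \<Longrightarrow> cmod (trig_poly d \<Lambda> a x - trig_poly d \<Lambda> (A g) x) \<le> 1 + 3 / 4 * \<theta> - 0 / 2"
          using boosted_set[OF boost_state_initial \<theta>, of JB] by auto
        have D_sub: "x \<in> cube d" if "x \<in> D" for x using sets.sets_into_space[OF D(1)] that by (auto simp: space_cube_measure)
        have "cmod (f x - g x) \<le> 1 + \<theta>" if "f \<in> T" "x \<in> D" for f x
          using transfer[OF that(1) D_sub[OF that(2)] D(3)[OF imageI[OF that(1)] that(2)]] \<rho>(2) by (simp add: \<theta>_def)
        moreover have "(1 + \<theta>) powr p \<le> exp 256"
        proof -
          have "(1 + \<theta>) powr p \<le> (exp \<theta>) powr p" using \<theta> p by (intro powr_mono2) auto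
          also have "\<dots> = exp 256" using p by (simp add: \<theta>_def exp_powr_real)
          finally show ?thesis .
        qed
        moreover have "(LINT x|cube_measure d. indicator (cube d - D) x * cmod (f x) powr p) \<le> 2 * \<mu>0 + 512 * \<mu>" if f: "f \<in> T" for f
        proof -
          have cD [measurable]: "cube d - D \<in> sets (cube_measure d)" using D(1) by (simp flip: space_cube_measure)
          define L where "L = {x\<in>cube d. (1 / 2) ^ 3 < cmod (f x - g x)}"
          have [measurable]: "f \<in> borel_measurable (cube_measure d)" "g \<in> borel_measurable (cube_measure d)"
            using mT f gT by auto
          have L [measurable]: "L \<in> sets (cube_measure d)" unfolding L_def space_cube_measure[symmetric] by measurable
          have ind: "integrable (cube_measure d) (\<lambda>x. c * indicator S x :: real)" if "S \<in> sets (cube_measure d)" for S c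
            using that by (intro integrable_mult_right integrable_real_indicator) (auto simp: emeasure_eq_measure)
          have "(LINT x|cube_measure d. indicator (cube d - D) x * cmod (f x) powr p) \<le>
             (LINT x|cube_measure d. (1 / 4) powr p * indicator (cube d - D) x + (1 * indicator G0 x + 1 * indicator L x))"
          proof (intro integral_mono')
            show "integrable (cube_measure d) (\<lambda>x. (1 / 4) powr p * indicator (cube d - D) x + (1 * indicator G0 x + 1 * indicator L x :: real))"
              by (intro Bochner_Integration.integrable_add ind cD G0 L)
            fix x assume "x \<in> space (cube_measure d)"
            then have x: "x \<in> cube d" by (simp add: space_cube_measure)
            show "indicator (cube d - D) x * cmod (f x) powr p \<le>
               (1 / 4) powr p * indicator (cube d - D) x + (1 * indicator G0 x + 1 * indicator L x)"
            proof (cases "x \<in> G0 \<or> x \<in> L")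
              case True
              have "cmod (f x) powr p \<le> 1" using F_class_le_1[OF \<alpha>, of f d x] f T x p by (intro powr_le1) auto
              then have "indicator (cube d - D) x * cmod (f x) powr p \<le> 1" by (auto simp: indicator_def)
              moreover have "1 \<le> indicator G0 x + (indicator L x :: real)" using True by (auto simp: indicator_def)
              ultimately show ?thesis by (auto intro: add_increasing)
            next
              case False
              have "2 * \<rho> \<le> (1 / 2) ^ 14" by (rule \<rho>_le) simp
              then have "\<rho> \<le> 1 / 16" by (simp add: power_one_over)
              moreover have "cmod (trig_poly d \<Lambda> (A g) x) \<le> 1 / 16" "cmod (f x - g x) \<le> 1 / 8"
                using False x by (auto simp: G0_def L_def power_one_over)
              ultimately have "cmod (f x) \<le> 1 / 4"
                using A2[OF gT x] norm_triangle_ineq[of "f x - g x" "g x"]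
                  norm_triangle_ineq[of "g x - trig_poly d \<Lambda> (A g) x" "trig_poly d \<Lambda> (A g) x"] by simp
              then have "cmod (f x) powr p \<le> (1 / 4) powr p" using p by (intro powr_mono2) auto
              then show ?thesis by (auto simp: indicator_def)
            qed
          qed auto
          also have "\<dots> = (1 / 4) powr p * prob (cube d - D) + (1 * prob G0 + 1 * prob L)"
          proof -
            have int: "integrable (cube_measure d) (\<lambda>x. 1 * indicator G0 x + 1 * indicator L x :: real)"
              by (intro Bochner_Integration.integrable_add ind G0 L)
            show ?thesis
              unfolding Bochner_Integration.integral_add[OF ind[OF cD] int]
                Bochner_Integration.integral_add[OF ind[OF G0] ind[OF L]]
              using cD G0 L by (simp add: sets.Int_space_eq2)
          qed
          also have "\<dots> \<le> \<mu>0 + (\<mu>0 + 512 * \<mu>)"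
          proof (intro add_mono)
            have "(1 / 4) powr p * prob (cube d - D) \<le> (1 / 4) powr p * \<nu>" using D(2) by (intro mult_left_mono) auto
            also have "\<dots> = \<mu>0" by (simp add: \<nu>_def powr_divide)
            finally show "(1 / 4) powr p * prob (cube d - D) \<le> \<mu>0" .
            show "1 * prob G0 \<le> \<mu>0" using False by simp
            show "1 * prob L \<le> 512 * \<mu>" using level[OF f, of 3] by (simp add: L_def I_def)
          qed
          finally show ?thesis by simp
        qed
        ultimately show ?thesis using D(1) \<theta> by (intro exI[of _ D] exI[of _ "1 + \<theta>"]) auto
      qed
      then obtain D B where D: "D \<in> sets (cube_measure d)" and B: "0 \<le> B" "B powr p \<le> exp 256"
        and close: "\<And>f x. f \<in> T \<Longrightarrow> x \<in> D \<Longrightarrow> cmod (f x - g x) \<le> B"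
        and off: "\<And>f. f \<in> T \<Longrightarrow> (LINT x|cube_measure d. indicator (cube d - D) x * cmod (f x) powr p) \<le> 2 * \<mu>0 + 512 * \<mu>"
        by blast
      define \<phi> where "\<phi> x = indicator D x * g x" for x
      have "\<phi> \<in> Lp_space p d"
      proof (rule bounded_in_Lp_space[where B = 1])
        have [measurable]: "g \<in> borel_measurable (cube_measure d)" using mT gT by auto
        show "\<phi> \<in> borel_measurable (cube_measure d)" using D unfolding \<phi>_def by measurable
        show "cmod (\<phi> x) \<le> 1" if "x \<in> cube d" for x
          using F_class_le_1[OF \<alpha> gF that] by (auto simp: \<phi>_def indicator_def)
      qed (use p in auto)
      moreover have "(LINT x|cube_measure d. cmod (f x - \<phi> x) powr p) \<le> \<epsilon> powr p" if f: "f \<in> T" for f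
      proof -
        have "(LINT x|cube_measure d. cmod (f x - \<phi> x) powr p) \<le>
           ((1 / 2) ^ I) powr p + B powr p * \<mu> + 16 * \<mu> + (2 * \<mu>0 + 512 * \<mu>)"
          unfolding \<phi>_def
        proof (rule hard_threshold_recovery[OF \<alpha> _ T gT f D(1)])
          show "prob {x\<in>cube d. (1 / 2) ^ i < cmod (f x - g x)} \<le> \<mu> * 8 ^ i" if "i \<le> I" for i
            by (rule level[OF f that])
          show "cmod (f x - g x) \<le> B" if "x \<in> D" for x by (rule close[OF f that])
        qed (use p \<mu> B off[OF f] in auto)
        also have "\<dots> \<le> E / 4 + exp 256 * \<mu> + 16 * \<mu> + (2 * \<mu>0 + 512 * \<mu>)"
          using tail B \<mu> by (intro add_mono mult_right_mono) auto
        also have "\<dots> \<le> E" using \<mu>_sum E by (simp add: \<mu>0_def)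
        finally show ?thesis by (simp add: E_def)
      qed
      ultimately show "\<exists>\<phi>\<in>Lp_space p d. \<forall>f\<in>T. (LINT x|cube_measure d. cmod (f x - \<phi> x) powr p) \<le> \<epsilon> powr p"
        by blast
    qed
  qed
  show ?thesis using \<eta> main by blast
qed

section \<open>Information complexity\<close>

text \<open>
  One level \<open>l = \<epsilon> / 2\<close> suffices: \<open>\<bar>f - g\<bar>\<close> is at most \<open>l\<close> outside a set of measure \<open>(\<epsilon> / 4) powr p\<close>,
  and at most 2 on it. For \<open>\<epsilon> \<ge> 1\<close> no sample is needed, since \<open>\<bar>f\<bar> \<le> 1\<close>.
\<close>

lemma tractability:
  assumes \<alpha>: "0 < \<alpha>" "\<alpha> \<le> 1" and p: "p \<ge> 1"
  shows "polynomially_tractable p (F_class \<alpha>)"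
proof -
  obtain C where C: "C > 0" and all: "\<forall>d l \<nu>. 1 \<le> d \<longrightarrow> 0 < l \<longrightarrow> l \<le> 1 \<longrightarrow> 0 < \<nu> \<longrightarrow>
    (\<exists>xs. set xs \<subseteq> cube d \<and>
       real (length xs) \<le> C * (real d)\<^sup>2 * (1 + ln (real d) + ln (1 / l))\<^sup>2 / (l\<^sup>2 * \<nu>) \<and>
       resolves \<alpha> d xs l \<nu>)"
    using sampling_level[OF \<alpha>] by (elim exE conjE) (rule that)
  define C' where "C' = 64 * C * 4 powr p"
  have C': "C' \<ge> 0" using C by (simp add: C'_def)
  have bound: "ereal_of_enat (info_complexity p d (F_class \<alpha> d) \<epsilon>) \<le> ereal (C' * real d powr 4 * \<epsilon> powr (- (p + 4)))"
    if d: "1 \<le> d" and \<epsilon>: "0 < \<epsilon>" for d and \<epsilon> :: real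
  proof (cases "\<epsilon> \<ge> 1")
    case True
    have "recoverable p d (F_class \<alpha> d) \<epsilon> (length ([] :: (nat \<Rightarrow> real) list))"
    proof (rule recoverableI)
      fix g assume "g \<in> F_class \<alpha> d"
      have "(LINT x|cube_measure d. cmod (f x - 0) powr p) \<le> \<epsilon> powr p" if f: "f \<in> F_class \<alpha> d" for f
      proof -
        interpret prob_space "cube_measure d" by (rule prob_space_cube_measure)
        have "(LINT x|cube_measure d. cmod (f x - 0) powr p) \<le> (LINT x|cube_measure d. 1)"
          using F_class_le_1[OF \<alpha> f] p by (intro integral_mono') (auto simp: space_cube_measure intro!: powr_le1)
        also have "\<dots> = 1" by (simp add: prob_space)
        also have "1 \<le> \<epsilon> powr p" using True p by (intro ge_one_powr_ge_zero) auto
        finally show ?thesis .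
      qed
      moreover have "(\<lambda>x. 0) \<in> Lp_space p d" using p by (intro bounded_in_Lp_space[where B = 0]) auto
      ultimately show "\<exists>\<phi>\<in>Lp_space p d. \<forall>f\<in>F_class \<alpha> d. map f [] = map g [] \<longrightarrow>
         (LINT x|cube_measure d. cmod (f x - \<phi> x) powr p) \<le> \<epsilon> powr p"
        by (intro bexI[of _ "\<lambda>x. 0"]) auto
    qed (use p \<epsilon> in auto)
    then show ?thesis using C' by (intro info_complexity_le) auto
  next
    case False
    define l where "l = \<epsilon> / 2"
    define \<nu> where "\<nu> = (\<epsilon> / 4) powr p"
    have l: "0 < l" "l \<le> 1" "0 < \<nu>" using \<epsilon> False by (auto simp: l_def \<nu>_def)
    obtain xs where xs: "set xs \<subseteq> cube d"
       "real (length xs) \<le> C * (real d)\<^sup>2 * (1 + ln (real d) + ln (1 / l))\<^sup>2 / (l\<^sup>2 * \<nu>)"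
       "resolves \<alpha> d xs l \<nu>"
      using all[rule_format, OF d l] by blast
    have "recoverable p d (F_class \<alpha> d) \<epsilon> (length xs)"
    proof (rule recoverableI)
      fix g assume g: "g \<in> F_class \<alpha> d"
      have "(LINT x|cube_measure d. cmod (f x - g x) powr p) \<le> \<epsilon> powr p"
        if f: "f \<in> F_class \<alpha> d" and eq: "map f xs = map g xs" for f
      proof -
        interpret prob_space "cube_measure d" by (rule prob_space_cube_measure)
        have [measurable]: "f \<in> borel_measurable (cube_measure d)" "g \<in> borel_measurable (cube_measure d)"
          using f g by (auto intro: F_class_measurable)
        define S where "S = {x\<in>cube d. l < cmod (f x - g x)}"
        have S [measurable]: "S \<in> sets (cube_measure d)" unfolding S_def space_cube_measure[symmetric] by measurable
        have S_le: "prob S \<le> \<nu>" unfolding S_def using xs(3) f g eq unfolding resolves_def by blast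
        have int: "integrable (cube_measure d) (\<lambda>x. 2 powr p * indicator S x :: real)"
          by (intro integrable_mult_right integrable_real_indicator) (auto simp: emeasure_eq_measure)
        have "(LINT x|cube_measure d. cmod (f x - g x) powr p) \<le> (LINT x|cube_measure d. l powr p + 2 powr p * indicator S x)"
        proof (intro integral_mono')
          show "integrable (cube_measure d) (\<lambda>x. l powr p + 2 powr p * indicator S x :: real)"
            using int by (intro Bochner_Integration.integrable_add) auto
          fix x assume "x \<in> space (cube_measure d)"
          then have x: "x \<in> cube d" by (simp add: space_cube_measure)
          have "cmod (f x - g x) \<le> 2"
            using F_class_le_1[OF \<alpha> f x] F_class_le_1[OF \<alpha> g x] norm_triangle_ineq4[of "f x" "g x"] by linarith
          then have "cmod (f x - g x) powr p \<le> 2 powr p" using p by (intro powr_mono2) auto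
          moreover have "cmod (f x - g x) powr p \<le> l powr p" if "x \<notin> S"
            using that x p by (intro powr_mono2) (auto simp: S_def)
          ultimately show "cmod (f x - g x) powr p \<le> l powr p + 2 powr p * indicator S x"
            by (cases "x \<in> S") (auto intro: add_increasing)
        qed auto
        also have "\<dots> = l powr p + 2 powr p * prob S"
          using int by (subst Bochner_Integration.integral_add) (auto simp: prob_space sets.Int_space_eq2)
        also have "\<dots> \<le> l powr p + 2 powr p * \<nu>" using S_le by simp
        also have "2 powr p * \<nu> = l powr p"
          unfolding \<nu>_def l_def using \<epsilon> by (subst powr_mult[symmetric]) auto
        also have "l powr p + l powr p = 2 * (1 / 2) powr p * \<epsilon> powr p"
          using \<epsilon> by (simp add: l_def powr_divide)
        also have "\<dots> \<le> 1 * \<epsilon> powr p"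
        proof (intro mult_right_mono)
          have "(1 / 2 :: real) powr p \<le> (1 / 2) powr 1" using p by (intro powr_mono') auto
          then show "2 * (1 / 2 :: real) powr p \<le> 1" by simp
        qed auto
        finally show ?thesis by simp
      qed
      then show "\<exists>\<phi>\<in>Lp_space p d. \<forall>f\<in>F_class \<alpha> d. map f xs = map g xs \<longrightarrow>
         (LINT x|cube_measure d. cmod (f x - \<phi> x) powr p) \<le> \<epsilon> powr p"
        using F_class_in_Lp_space[OF \<alpha> g, of p] p by (intro bexI[of _ g]) auto
    qed (use p \<epsilon> xs in auto)
    moreover have "real (length xs) \<le> C' * real d powr 4 * \<epsilon> powr (- (p + 4))"
    proof -
      have d1: "1 \<le> real d" using d by simp
      have "1 + ln (real d) + ln (1 / l) \<le> 4 * real d / \<epsilon>"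
      proof -
        have "ln (real d) \<le> real d - 1" using d by (intro ln_le_minus_one) auto
        moreover have "ln (1 / l) \<le> 2 / \<epsilon> - 1" using ln_le_minus_one[of "1 / l"] l by (simp add: l_def)
        moreover have "real d * 1 \<le> real d * (1 / \<epsilon>)" using \<epsilon> False by (intro mult_left_mono) auto
        moreover have "1 * (2 / \<epsilon>) \<le> real d * (2 / \<epsilon>)" using \<epsilon> d by (intro mult_right_mono) auto
        moreover have "4 * real d / \<epsilon> = real d * (1 / \<epsilon>) + real d * (2 / \<epsilon>) + real d * (1 / \<epsilon>)" by simp
        moreover have "0 \<le> real d * (1 / \<epsilon>)" using \<epsilon> by simp
        ultimately show ?thesis by linarith
      qed
      moreover have "0 \<le> 1 + ln (real d) + ln (1 / l)"
        using l d by (intro add_nonneg_nonneg) auto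
      ultimately have "(1 + ln (real d) + ln (1 / l))\<^sup>2 \<le> (4 * real d / \<epsilon>)\<^sup>2" by (intro power_mono)
      then have "C * (real d)\<^sup>2 * (1 + ln (real d) + ln (1 / l))\<^sup>2 / (l\<^sup>2 * \<nu>) \<le>
          C * (real d)\<^sup>2 * (4 * real d / \<epsilon>)\<^sup>2 / (l\<^sup>2 * \<nu>)"
        using C l by (intro divide_right_mono mult_left_mono) auto
      also have "\<dots> = C' * real d ^ 4 / (\<epsilon> ^ 4 * \<epsilon> powr p)"
        using \<epsilon> by (simp add: C'_def l_def \<nu>_def powr_divide power_divide field_simps eval_nat_numeral)
      also have "\<dots> = C' * real d powr 4 * \<epsilon> powr (- (p + 4))"
      proof -
        have "\<epsilon> powr (p + 4) = \<epsilon> ^ 4 * \<epsilon> powr p" using \<epsilon> by (simp add: powr_add)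
        then show ?thesis unfolding powr_minus using d1 by (simp add: divide_inverse)
      qed
      finally show ?thesis using xs(2) by linarith
    qed
    ultimately show ?thesis by (rule info_complexity_le)
  qed
  show ?thesis
    unfolding polynomially_tractable_def
    using C' p bound by (intro exI[of _ C'] exI[of _ 4] exI[of _ "p + 4"]) auto
qed

lemma sum_squares_halves_le: "(\<Sum>i\<le>I. (1 + real i)\<^sup>2 * (1 / 2) ^ i) \<le> 12"
proof -
  have "(\<Sum>i\<le>I. (1 + real i)\<^sup>2 * (1 / 2) ^ i) = 12 - ((real I)\<^sup>2 + 6 * real I + 11) * (1 / 2) ^ I"
  proof (induction I)
    case (Suc I)
    show ?case
      unfolding sum.atMost_Suc Suc.IH by (simp add: power2_eq_square field_simps)
  qed simp
  then show ?thesis by simp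
qed

text \<open>
  The number of levels is of order \<open>ln (1 / \<epsilon>)\<close>. It enters twice, as all levels cost the same and as
  \<open>\<mu>\<close> must be divided by it; two more logarithms come from \<open>(1 + ln d + i)^2\<close>.
\<close>

lemma complexity_small_exponent:
  assumes \<alpha>: "0 < \<alpha>" "\<alpha> \<le> 1"
  shows "\<exists>c>0. \<forall>p. 2 \<le> p \<longrightarrow> p \<le> 256 \<longrightarrow> (\<forall>d\<ge>2. \<forall>\<epsilon>. 0 < \<epsilon> \<and> \<epsilon> < 1 / 2 \<longrightarrow>
       ereal_of_enat (info_complexity p d (F_class \<alpha> d) \<epsilon>)
         \<le> ereal (c * real d ^ 2 * ln (real d) ^ 2 * \<epsilon> powr (- p) * ln (1 / \<epsilon>) ^ 4))"
proof -
  obtain C where C: "C > 0" and all: "\<forall>d I (\<nu> :: nat \<Rightarrow> real). 1 \<le> d \<longrightarrow> (\<forall>i. 0 < \<nu> i) \<longrightarrow>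
    (\<exists>xs. set xs \<subseteq> cube d \<and>
       real (length xs) \<le> (\<Sum>i\<le>I. C * (real d)\<^sup>2 * (1 + ln (real d) + real i)\<^sup>2 * 4 ^ i / \<nu> i) \<and>
       (\<forall>i\<le>I. resolves \<alpha> d xs ((1 / 2) ^ i) (\<nu> i)))"
    using sampling_levels[OF \<alpha>] by (elim exE conjE) (rule that)
  define W :: real where "W = 2 powr 256"
  have W: "W \<ge> 4"
  proof -
    have "(2::real) powr 2 \<le> 2 powr 256" by (intro powr_mono) auto
    then show ?thesis by (simp add: W_def)
  qed
  define c where "c = C * 200 * W * 22\<^sup>2"
  have c: "c > 0" using C W by (simp add: c_def)
  have bound: "ereal_of_enat (info_complexity p d (F_class \<alpha> d) \<epsilon>)
         \<le> ereal (c * real d ^ 2 * ln (real d) ^ 2 * \<epsilon> powr (- p) * ln (1 / \<epsilon>) ^ 4)"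
    if p: "2 \<le> p" "p \<le> 256" and d: "2 \<le> d" and \<epsilon>: "0 < \<epsilon>" "\<epsilon> < 1 / 2" for p \<epsilon> :: real and d
  proof -
    define t where "t = ln (1 / \<epsilon>)"
    define D where "D = ln (real d)"
    have D: "1 / 2 \<le> D" unfolding D_def using d by (intro ln_ge_half) auto
    have t: "1 / 2 \<le> t" unfolding t_def using \<epsilon> by (intro ln_ge_half) (auto simp: field_simps)
    define I where "I = nat \<lceil>2 * t\<rceil> + 2"
    have I: "2 * t \<le> real I - 2" "real I \<le> 2 * t + 3" using t unfolding I_def by linarith+
    have I_small: "real I + 1 \<le> 10 * t" using I t by linarith
    have tail: "(1 / 2) ^ I \<le> \<epsilon> / 4"
    proof -
      have "t \<le> ln 2 * (real I - 2)"
      proof -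
        have "t \<le> (1 / 2) * (real I - 2)" using I by simp
        also have "\<dots> \<le> ln 2 * (real I - 2)" using ln_ge_half[of 2] I t by (intro mult_right_mono) auto
        finally show ?thesis .
      qed
      moreover have "1 / \<epsilon> = exp t" using \<epsilon> by (simp add: t_def)
      ultimately have "1 / \<epsilon> \<le> exp (ln 2 * (real I - 2))" by simp
      also have "\<dots> = 2 powr (real I - 2)" by (simp add: powr_def mult.commute)
      also have "\<dots> = 2 ^ I / 4" by (simp add: powr_diff powr_realpow)
      finally show ?thesis using \<epsilon> by (simp add: power_one_over field_simps)
    qed
    define \<mu> where "\<mu> = \<epsilon> powr p / (20 * t * W)"
    have \<mu>: "\<mu> > 0" using \<epsilon> t W by (simp add: \<mu>_def)
    obtain xs where xs: "set xs \<subseteq> cube d"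
       "real (length xs) \<le> (\<Sum>i\<le>I. C * (real d)\<^sup>2 * (1 + ln (real d) + real i)\<^sup>2 * 4 ^ i / (\<mu> * 4 ^ i))"
       "\<forall>i\<le>I. resolves \<alpha> d xs ((1 / 2) ^ i) (\<mu> * 4 ^ i)"
      using all[rule_format, of d "\<lambda>i. \<mu> * 4 ^ i" I] d \<mu> by auto
    have "recoverable p d (F_class \<alpha> d) \<epsilon> (length xs)"
    proof (rule recoverableI)
      fix g assume g: "g \<in> F_class \<alpha> d"
      have "(LINT x|cube_measure d. cmod (f x - g x) powr p) \<le> \<epsilon> powr p"
        if f: "f \<in> F_class \<alpha> d" and eq: "map f xs = map g xs" for f
      proof -
        have [measurable]: "f \<in> borel_measurable (cube_measure d)" "g \<in> borel_measurable (cube_measure d)"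
          using f g by (auto intro: F_class_measurable)
        have "(LINT x|cube_measure d. cmod (f x - g x) powr p) = (LINT x|cube_measure d. indicator (cube d) x * cmod (f x - g x) powr p)"
          by (intro Bochner_Integration.integral_cong refl) (auto simp: space_cube_measure)
        also have "\<dots> \<le> ((1 / 2) ^ I) powr p + 2 powr p * (\<mu> * 4 ^ 0) + (\<Sum>i\<in>{1..I}. (2 * (1 / 2) ^ i) powr p * (\<mu> * 4 ^ i))"
        proof (rule dyadic_layers_bound)
          show "cube d \<in> sets (cube_measure d)" by (metis sets.top space_cube_measure)
          show "cmod (f x - g x) \<le> 2" if "x \<in> cube d" for x
            using F_class_le_1[OF \<alpha> f that] F_class_le_1[OF \<alpha> g that] norm_triangle_ineq4[of "f x" "g x"] by linarith
          show "measure (cube_measure d) {x\<in>cube d. (1 / 2) ^ i < cmod (f x - g x)} \<le> \<mu> * 4 ^ i" if "i \<le> I" for i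
            using xs(3) f g eq that unfolding resolves_def by blast
        qed (use p in auto)
        also have "\<dots> \<le> \<epsilon> powr p / 4 + W * \<mu> + (\<Sum>i\<in>{1..I}. W * \<mu>)"
        proof (intro add_mono sum_mono)
          have "((1 / 2) ^ I) powr p \<le> (\<epsilon> * (1 / 4)) powr p" using tail p by (intro powr_mono2) auto
          also have "\<dots> = \<epsilon> powr p * (1 / 4) powr p" using \<epsilon> by (simp add: powr_mult del: times_divide_eq_right)
          also have "\<dots> \<le> \<epsilon> powr p * (1 / 4) powr 1" using p by (intro mult_left_mono powr_mono') auto
          finally show "((1 / 2) ^ I) powr p \<le> \<epsilon> powr p / 4" by simp
          have "2 powr p \<le> W" unfolding W_def using p by (intro powr_mono) auto
          then show "2 powr p * (\<mu> * 4 ^ 0) \<le> W * \<mu>" using \<mu> by simp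
          fix i assume "i \<in> {1..I}"
          then have "(1 / 2 :: real) ^ i \<le> (1 / 2) ^ 1" by (intro power_decreasing) auto
          then have "(2 * (1 / 2 :: real) ^ i) powr p \<le> (2 * (1 / 2) ^ i) powr 2" using p by (intro powr_mono') auto
          also have "\<dots> = (2 * (1 / 2) ^ i) ^ 2" by (subst powr_numeral) auto
          also have "\<dots> = 4 * (1 / 4) ^ i"
          proof -
            have "((1 / 2 :: real) ^ i)\<^sup>2 = ((1 / 2)\<^sup>2) ^ i" by (simp only: power_mult[symmetric] mult.commute)
            then show ?thesis unfolding power_mult_distrib by (simp add: power_one_over)
          qed
          finally have "(2 * (1 / 2 :: real) ^ i) powr p * (\<mu> * 4 ^ i) \<le> 4 * (1 / 4) ^ i * (\<mu> * 4 ^ i)"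
            using \<mu> by (intro mult_right_mono) auto
          also have "\<dots> = 4 * \<mu>" by (simp add: power_one_over)
          also have "\<dots> \<le> W * \<mu>" using W \<mu> by (intro mult_right_mono) auto
          finally show "(2 * (1 / 2 :: real) ^ i) powr p * (\<mu> * 4 ^ i) \<le> W * \<mu>" .
        qed
        also have "\<dots> = \<epsilon> powr p / 4 + (real I + 1) * (W * \<mu>)" by (simp add: algebra_simps)
        also have "\<dots> \<le> \<epsilon> powr p / 4 + (10 * t) * (W * \<mu>)"
          using I_small W \<mu> by (intro add_left_mono mult_right_mono) auto
        also have "\<dots> = \<epsilon> powr p / 4 + \<epsilon> powr p / 2" using t W by (simp add: \<mu>_def)
        also have "\<dots> \<le> \<epsilon> powr p" by simp
        finally show ?thesis .
      qed
      then show "\<exists>\<phi>\<in>Lp_space p d. \<forall>f\<in>F_class \<alpha> d. map f xs = map g xs \<longrightarrow>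
         (LINT x|cube_measure d. cmod (f x - \<phi> x) powr p) \<le> \<epsilon> powr p"
        using F_class_in_Lp_space[OF \<alpha> g, of p] p by (intro bexI[of _ g]) auto
    qed (use p \<epsilon> xs in auto)
    moreover have "real (length xs) \<le> c * real d ^ 2 * ln (real d) ^ 2 * \<epsilon> powr (- p) * ln (1 / \<epsilon>) ^ 4"
    proof -
      have DI: "1 + D + real I \<le> 22 * (t * D)"
      proof -
        have "1 / 2 * (1 / 2) \<le> t * D" using t D by (intro mult_mono) auto
        moreover have "1 / 2 * D \<le> t * D" using t D by (intro mult_right_mono) auto
        moreover have "t * (1 / 2) \<le> t * D" using t D by (intro mult_left_mono) auto
        ultimately show ?thesis using I by linarith
      qed
      have "real (length xs) \<le> (\<Sum>i\<le>I. C * (real d)\<^sup>2 * (22 * (t * D))\<^sup>2 / \<mu>)"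
      proof (rule order.trans[OF xs(2)], rule sum_mono)
        fix i assume "i \<in> {..I}"
        then have "1 + ln (real d) + real i \<le> 22 * (t * D)" using DI by (simp add: D_def)
        then have "(1 + ln (real d) + real i)\<^sup>2 \<le> (22 * (t * D))\<^sup>2"
          using D by (intro power_mono) (auto simp: D_def)
        then show "C * (real d)\<^sup>2 * (1 + ln (real d) + real i)\<^sup>2 * 4 ^ i / (\<mu> * 4 ^ i) \<le> C * (real d)\<^sup>2 * (22 * (t * D))\<^sup>2 / \<mu>"
          using C \<mu> by (simp add: divide_right_mono mult_left_mono)
      qed
      also have "\<dots> = (real I + 1) * (C * (real d)\<^sup>2 * (22 * (t * D))\<^sup>2 / \<mu>)" by simp
      also have "\<dots> \<le> (10 * t) * (C * (real d)\<^sup>2 * (22 * (t * D))\<^sup>2 / \<mu>)"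
        using I_small C \<mu> by (intro mult_right_mono) auto
      also have "\<dots> = c * (real d)\<^sup>2 * D\<^sup>2 * t ^ 4 / \<epsilon> powr p"
        using \<epsilon> t W by (simp add: c_def \<mu>_def field_simps eval_nat_numeral)
      finally show ?thesis by (simp add: D_def t_def powr_minus divide_inverse mult_ac)
    qed
    ultimately show ?thesis by (rule info_complexity_le)
  qed
  show ?thesis using c bound by (intro exI[of _ c]) auto
qed

text \<open>
  The cost of level \<open>i\<close> is proportional to \<open>(1 + ln d + i)^2 / 2 ^ i\<close>, so the sum is of order
  \<open>(ln d)^2\<close> whatever the number of levels is.
\<close>

lemma complexity_large_exponent:
  assumes \<alpha>: "0 < \<alpha>" "\<alpha> \<le> 1"
  shows "\<exists>c>0. \<forall>p\<ge>256. (\<forall>d\<ge>2. \<forall>\<epsilon>. 0 < \<epsilon> \<and> \<epsilon> < 1 / 2 \<longrightarrow>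
       ereal_of_enat (info_complexity p d (F_class \<alpha> d) \<epsilon>)
         \<le> ereal (c * real d ^ 2 * ln (real d) ^ 2 * \<epsilon> powr (- p) * ln (1 / \<epsilon>) ^ 4))"
proof -
  obtain C where C: "C > 0" and all: "\<forall>d I (\<nu> :: nat \<Rightarrow> real). 1 \<le> d \<longrightarrow> (\<forall>i. 0 < \<nu> i) \<longrightarrow>
    (\<exists>xs. set xs \<subseteq> cube d \<and>
       real (length xs) \<le> (\<Sum>i\<le>I. C * (real d)\<^sup>2 * (1 + ln (real d) + real i)\<^sup>2 * 4 ^ i / \<nu> i) \<and>
       (\<forall>i\<le>I. resolves \<alpha> d xs ((1 / 2) ^ i) (\<nu> i)))"
    using sampling_levels[OF \<alpha>] by (elim exE conjE) (rule that)
  obtain \<eta> where \<eta>: "\<eta> > 0" and rec: "\<forall>p\<ge>256. \<forall>\<epsilon> d. 0 < \<epsilon> \<longrightarrow> (\<exists>I. \<forall>T g. T \<subseteq> F_class \<alpha> d \<longrightarrow> g \<in> T \<longrightarrow>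
     (\<forall>f\<in>T. \<forall>i\<le>I. measure (cube_measure d) {x\<in>cube d. (1 / 2) ^ i < cmod (f x - g x)} \<le> \<eta> * \<epsilon> powr p * 8 ^ i) \<longrightarrow>
     (\<exists>\<phi>\<in>Lp_space p d. \<forall>f\<in>T. (LINT x|cube_measure d. cmod (f x - \<phi> x) powr p) \<le> \<epsilon> powr p))"
    using large_exponent_recovery[OF \<alpha>] by (elim exE conjE) (rule that)
  define c where "c = C * 12 * 9 * 16 / \<eta>"
  have c: "c > 0" using C \<eta> by (simp add: c_def)
  have bound: "ereal_of_enat (info_complexity p d (F_class \<alpha> d) \<epsilon>)
         \<le> ereal (c * real d ^ 2 * ln (real d) ^ 2 * \<epsilon> powr (- p) * ln (1 / \<epsilon>) ^ 4)"
    if p: "256 \<le> p" and d: "2 \<le> d" and \<epsilon>: "0 < \<epsilon>" "\<epsilon> < 1 / 2" for p \<epsilon> :: real and d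
  proof -
    define D where "D = ln (real d)"
    have D: "1 / 2 \<le> D" unfolding D_def using d by (intro ln_ge_half) auto
    define t where "t = ln (1 / \<epsilon>)"
    have t: "1 / 2 \<le> t" unfolding t_def using \<epsilon> by (intro ln_ge_half) (auto simp: field_simps)
    define \<mu> where "\<mu> = \<eta> * \<epsilon> powr p"
    have \<mu>: "\<mu> > 0" using \<epsilon> \<eta> by (simp add: \<mu>_def)
    obtain I where I: "\<forall>T g. T \<subseteq> F_class \<alpha> d \<longrightarrow> g \<in> T \<longrightarrow>
       (\<forall>f\<in>T. \<forall>i\<le>I. measure (cube_measure d) {x\<in>cube d. (1 / 2) ^ i < cmod (f x - g x)} \<le> \<mu> * 8 ^ i) \<longrightarrow>
       (\<exists>\<phi>\<in>Lp_space p d. \<forall>f\<in>T. (LINT x|cube_measure d. cmod (f x - \<phi> x) powr p) \<le> \<epsilon> powr p)"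
      using rec[rule_format, OF p \<epsilon>(1), of d, folded \<mu>_def] by (elim exE) (rule that)
    obtain xs where xs: "set xs \<subseteq> cube d"
       "real (length xs) \<le> (\<Sum>i\<le>I. C * (real d)\<^sup>2 * (1 + ln (real d) + real i)\<^sup>2 * 4 ^ i / (\<mu> * 8 ^ i))"
       "\<forall>i\<le>I. resolves \<alpha> d xs ((1 / 2) ^ i) (\<mu> * 8 ^ i)"
      using all[rule_format, of d "\<lambda>i. \<mu> * 8 ^ i" I] d \<mu> by auto
    have "recoverable p d (F_class \<alpha> d) \<epsilon> (length xs)"
    proof (rule recoverableI)
      fix g assume g: "g \<in> F_class \<alpha> d"
      define T where "T = {f\<in>F_class \<alpha> d. map f xs = map g xs}"
      have "\<exists>\<phi>\<in>Lp_space p d. \<forall>f\<in>T. (LINT x|cube_measure d. cmod (f x - \<phi> x) powr p) \<le> \<epsilon> powr p"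
        using I[rule_format, of T g] xs(3) g by (auto simp: T_def resolves_def)
      then show "\<exists>\<phi>\<in>Lp_space p d. \<forall>f\<in>F_class \<alpha> d. map f xs = map g xs \<longrightarrow>
         (LINT x|cube_measure d. cmod (f x - \<phi> x) powr p) \<le> \<epsilon> powr p"
        by (auto simp: T_def)
    qed (use p \<epsilon> xs in auto)
    moreover have "real (length xs) \<le> c * real d ^ 2 * ln (real d) ^ 2 * \<epsilon> powr (- p) * ln (1 / \<epsilon>) ^ 4"
    proof -
      have "real (length xs) \<le> (\<Sum>i\<le>I. C * (real d)\<^sup>2 * (3 * D)\<^sup>2 / \<mu> * ((1 + real i)\<^sup>2 * (1 / 2) ^ i))"
      proof (rule order.trans[OF xs(2)], rule sum_mono)
        fix i assume "i \<in> {..I}"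
        have "1 + ln (real d) + real i \<le> 3 * D * (1 + real i)"
        proof -
          have "1 * real i \<le> 3 * D * real i" using D by (intro mult_right_mono) auto
          then show ?thesis using D by (simp add: D_def[symmetric] algebra_simps)
        qed
        then have "(1 + ln (real d) + real i)\<^sup>2 \<le> (3 * D * (1 + real i))\<^sup>2"
          using D by (intro power_mono) (auto simp: D_def)
        then have "C * (real d)\<^sup>2 * (1 + ln (real d) + real i)\<^sup>2 * 4 ^ i / (\<mu> * 8 ^ i) \<le>
            C * (real d)\<^sup>2 * (3 * D * (1 + real i))\<^sup>2 * 4 ^ i / (\<mu> * 8 ^ i)"
          using C \<mu> by (intro divide_right_mono mult_right_mono mult_left_mono) auto
        also have "\<dots> = C * (real d)\<^sup>2 * (3 * D)\<^sup>2 / \<mu> * ((1 + real i)\<^sup>2 * (4 ^ i / 8 ^ i))"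
          by (simp add: power_mult_distrib)
        also have "(4 ^ i / 8 ^ i :: real) = (1 / 2) ^ i" by (simp add: power_divide[symmetric])
        finally show "C * (real d)\<^sup>2 * (1 + ln (real d) + real i)\<^sup>2 * 4 ^ i / (\<mu> * 8 ^ i) \<le>
            C * (real d)\<^sup>2 * (3 * D)\<^sup>2 / \<mu> * ((1 + real i)\<^sup>2 * (1 / 2) ^ i)" .
      qed
      also have "\<dots> = C * (real d)\<^sup>2 * (3 * D)\<^sup>2 / \<mu> * (\<Sum>i\<le>I. (1 + real i)\<^sup>2 * (1 / 2) ^ i)"
        by (simp only: sum_distrib_left)
      also have "\<dots> \<le> C * (real d)\<^sup>2 * (3 * D)\<^sup>2 / \<mu> * 12"
        using C \<mu> by (intro mult_left_mono sum_squares_halves_le) auto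
      also have "\<dots> = C * (real d)\<^sup>2 * (3 * D)\<^sup>2 / \<mu> * 12 * 1" by simp
      also have "\<dots> \<le> C * (real d)\<^sup>2 * (3 * D)\<^sup>2 / \<mu> * 12 * (16 * t ^ 4)"
      proof (intro mult_left_mono)
        have "(1 / 2) ^ 4 \<le> t ^ 4" using t by (intro power_mono) auto
        then show "1 \<le> 16 * t ^ 4" by (simp add: power_one_over)
      qed (use C \<mu> in auto)
      also have "\<dots> = c * (real d)\<^sup>2 * D\<^sup>2 * t ^ 4 / \<epsilon> powr p"
        by (simp add: c_def \<mu>_def power_mult_distrib)
      finally show ?thesis by (simp add: D_def t_def powr_minus divide_inverse mult_ac)
    qed
    ultimately show ?thesis by (rule info_complexity_le)
  qed
  show ?thesis using c bound by (intro exI[of _ c]) auto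
qed

text \<open>
  The exponents are divided at 256 because the boosting parameter \<open>\<theta> = 256 / p\<close> has to be at most 1.
\<close>

theorem corollary17:
  fixes \<alpha> :: real
  assumes "0 < \<alpha>" and "\<alpha> \<le> 1"
  shows "(\<forall>p\<ge>1. polynomially_tractable p (F_class \<alpha>)) \<and>
    (\<exists>c>0. \<forall>p\<ge>2. \<forall>d\<ge>2. \<forall>\<epsilon>. 0 < \<epsilon> \<and> \<epsilon> < 1 / 2 \<longrightarrow>
       ereal_of_enat (info_complexity p d (F_class \<alpha> d) \<epsilon>)
         \<le> ereal (c * real d ^ 2 * ln (real d) ^ 2 * \<epsilon> powr (- p) * ln (1 / \<epsilon>) ^ 4))"
proof (intro conjI)
  show "\<forall>p\<ge>1. polynomially_tractable p (F_class \<alpha>)"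
    using tractability[OF assms] by blast
  define bnd where "bnd c p d \<epsilon> = c * real d ^ 2 * ln (real d) ^ 2 * \<epsilon> powr (- p) * ln (1 / \<epsilon>) ^ 4"
    for c p \<epsilon> :: real and d :: nat
  obtain c1 where c1: "c1 > 0" "\<And>p d \<epsilon>. 2 \<le> p \<Longrightarrow> p \<le> 256 \<Longrightarrow> d \<ge> 2 \<Longrightarrow> 0 < \<epsilon> \<and> \<epsilon> < 1 / 2 \<Longrightarrow>
      ereal_of_enat (info_complexity p d (F_class \<alpha> d) \<epsilon>) \<le> ereal (bnd c1 p d \<epsilon>)"
    using complexity_small_exponent[OF assms] unfolding bnd_def by blast
  obtain c2 where c2: "c2 > 0" "\<And>p d \<epsilon>. 256 \<le> p \<Longrightarrow> d \<ge> 2 \<Longrightarrow> 0 < \<epsilon> \<and> \<epsilon> < 1 / 2 \<Longrightarrow>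
      ereal_of_enat (info_complexity p d (F_class \<alpha> d) \<epsilon>) \<le> ereal (bnd c2 p d \<epsilon>)"
    using complexity_large_exponent[OF assms] unfolding bnd_def by blast
  have mono: "bnd c p d \<epsilon> \<le> bnd (max c1 c2) p d \<epsilon>" if "c \<le> max c1 c2" for c p d \<epsilon>
    unfolding bnd_def using that by (intro mult_right_mono) auto
  have "ereal_of_enat (info_complexity p d (F_class \<alpha> d) \<epsilon>) \<le> ereal (bnd (max c1 c2) p d \<epsilon>)"
    if "2 \<le> p" "2 \<le> d" "0 < \<epsilon> \<and> \<epsilon> < 1 / 2" for p d \<epsilon>
  proof (cases "p \<le> 256")
    case True
    then show ?thesis using c1(2)[OF that(1) True that(2,3)] mono[of c1 p d \<epsilon>] order.trans by fastforce
  next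
    case False
    then show ?thesis using c2(2)[OF _ that(2,3), of p] mono[of c2 p d \<epsilon>] order.trans by fastforce
  qed
  then show "\<exists>c>0. \<forall>p\<ge>2. \<forall>d\<ge>2. \<forall>\<epsilon>. 0 < \<epsilon> \<and> \<epsilon> < 1 / 2 \<longrightarrow>
       ereal_of_enat (info_complexity p d (F_class \<alpha> d) \<epsilon>)
         \<le> ereal (c * real d ^ 2 * ln (real d) ^ 2 * \<epsilon> powr (- p) * ln (1 / \<epsilon>) ^ 4)"
    unfolding bnd_def using c1(1) by (intro exI[of _ "max c1 c2"]) auto
qed

end
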